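(* Let $\alpha>0$, $L>0$, $C_Z>0$, $0<\beta_0\le 1$. In the functional data model described in the context, suppose that the errors satisfy (A1) and the design satisfies (A3). Let $\widehat\mu_{n,\boldsymbol p,h}(\boldsymbol x)=\sum_{\boldsymbol j=\boldsymbol 1}^{\boldsymbol p} w_{\boldsymbol j,\boldsymbol p}(\boldsymbol x;h)\,\bar Y_{\boldsymbol j}$ be a linear estimator whose weights satisfy (A2) with polynomial degree $\zeta=\lfloor\alpha\rfloor$ for the given Hölder smoothness $\alpha>0$, and let $c>0$, $h_0>0$ be the constants in (A2). Then for sufficiently large $\boldsymbol p_{\min}$ and $n$, $$\sup_{h\in(c/\boldsymbol p_{\min},\,h_0]}\ \sup_{Z\in\mathcal P_T(\beta_0,C_Z),\ \mu\in\mathcal H_T(\alpha,L)} a_{n,\boldsymbol p,h}^{-1}\;\mathbb E_{\mu,Z}\big[\|\widehat\mu_{n,\boldsymbol p,h}-\mu\|_\infty\big]=\mathcal O(1),$$ where $$a_{n,\boldsymbol p,h}=\max\Big(h^\alpha,\ \Big(\frac{\log(h^{-1})}{n\,\boldsymbol p^{\boldsymbol 1}h^d}\Big)^{1/2},\ n^{-1/2}\Big).$$ Therefore, setting $$h^\star=\max\Big(\frac{c}{\boldsymbol p_{\min}},\ \Big(\frac{\log(n\,\boldsymbol p^{\boldsymbol 1})}{n\,\boldsymbol p^{\boldsymbol 1}}\Big)^{\frac1{2\alpha+d}}\Big),$$ one obtains $$\sup_{Z\in\mathcal P_T(\beta_0,C_Z),\ \mu\in\mathcal H_T(\alpha,L)}\mathbb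 E_{\mu,Z}\big[\|\widehat\mu_{n,\boldsymbol p,h^\star}-\mu\|_\infty\big]=\mathcal O\Big(\max\Big(\boldsymbol p_{\min}^{-\alpha},\ \Big(\frac{\log(n\,\boldsymbol p^{\boldsymbol 1})}{n\,\boldsymbol p^{\boldsymbol 1}}\Big)^{\frac{\alpha}{2\alpha+d}},\ n^{-1/2}\Big)\Big).$$
   Context: Notation. $T=[0,1]^d$; $\|\cdot\|_\infty$ is the sup-norm on $T$ for functions and the max-norm for vectors. $\lfloor\alpha\rfloor=\max\{k\in\mathbb N_0: k<\alpha\}$. For $\boldsymbol p=(p_1,\dots,p_d)$: $\boldsymbol p^{\boldsymbol 1}=\prod_k p_k$, $\boldsymbol p_{\min}=\min_k p_k$; $\sum_{\boldsymbol j=\boldsymbol 1}^{\boldsymbol p}$ is the sum over all multi-indices $\boldsymbol j$ with $1\le j_k\le p_k$. For $\boldsymbol r\in\mathbb N_0^d$: $|\boldsymbol r|=r_1+\dots+r_d$, $\boldsymbol x^{\boldsymbol r}=\prod_k x_k^{r_k}$. Inequalities between vectors are componentwise. Model. One observes $Y_{i,\boldsymbol j}=\mu(\boldsymbol x_{\boldsymbol j})+Z_i(\boldsymbol x_{\boldsymbol j})+\varepsilon_{i,\boldsymbol j}$, $i=1,\dots,n$, $\boldsymbol 1\le\boldsymbol j\le\boldsymbol p$, at deterministic design points $\boldsymbol x_{\boldsymbol j}=(x_{1,j_1},\dots,x_{d,j_d})\in T$ with $x_{k,l}<x_{k,l+1}$; $\boldsymbol p$ and the design depend on $n$. The errors $\varepsilon_{i,\boldsymbol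 j}$ are independent with mean zero, and $Z_1,\dots,Z_n$ are i.i.d. copies of a centered square-integrable random field $Z$ on $T$. $\bar Y_{\boldsymbol j}=\frac1n\sum_{i=1}^nY_{i,\boldsymbol j}$. $\mathbb E_{\mu,Z}$ is expectation under mean function $\mu$ and process $Z$. Hölder class. $\mathcal H_T(\alpha,L)$ is the set of $f:T\to\mathbb R$ with $\|f\|_{\mathcal H,\alpha}\le L$, where $\|f\|_{\mathcal H,\alpha}=\max_{|\boldsymbol\beta|\le\lfloor\alpha\rfloor}\sup_{\boldsymbol x}|\partial^{\boldsymbol\beta}f(\boldsymbol x)|+\max_{|\boldsymbol\beta|=\lfloor\alpha\rfloor}\sup_{\boldsymbol x\ne\boldsymbol y}\frac{|\partial^{\boldsymbol\beta}f(\boldsymbol x)-\partial^{\boldsymbol\beta}f(\boldsymbol y)|}{\|\boldsymbol x-\boldsymbol y\|_\infty^{\alpha-\lfloor\alpha\rfloor}}$. Process class. $\mathcal P_T(\beta_0,C_Z)$ is the set of random fields $Z$ on $T$ (centered and square-integrable as in the model) for which there are $\beta\in[\beta_0,1]$ and a random variable $M>0$ with $\mathbb E[M^2]+\mathbb E[Z(\boldsymbol 0)^2]\le C_Z$ and $|Z(\boldsymbol x)-Z(\boldsymbol y)|\le M\|\boldsymbol x-\boldsymbol y\|_\infty^\beta$ almost surely for all $\boldsymbol x,\boldsymbol y\in T$. (A1) The $\varepsilon_{i,\boldsymbol j}$ are independent and independent of $Z_1,\dots,Z_n$. Their distributions are sub-Gaussian; with $\sigma_{i,\boldsymbol j}^2=\mathbb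 E[\varepsilon_{i,\boldsymbol j}^2]$ one has $\sigma^2:=\sup_n\max_{i,\boldsymbol j}\sigma_{i,\boldsymbol j}^2<\infty$, and there is $\zeta_0>0$ such that $\zeta_0^2\sigma_{i,\boldsymbol j}^2$ is an upper bound for the sub-Gaussian norm of $\varepsilon_{i,\boldsymbol j}$. (A2) The weights $w_{\boldsymbol j,\boldsymbol p}(\boldsymbol x;h)$ are deterministic, depending on the design points and the bandwidth $h>0$. There are $c>0$ and $h_0>0$ such that for sufficiently large $\boldsymbol p_{\min}$ the following holds for all $h\in(c/\boldsymbol p_{\min},h_0]$, with constants $C_1,C_2>0$ independent of $n,\boldsymbol p,h,\boldsymbol x$: (W1) the weights reproduce polynomials of a degree $\zeta\ge1$: for $\boldsymbol x\in T$, $\sum_{\boldsymbol j}w_{\boldsymbol j,\boldsymbol p}(\boldsymbol x;h)=1$ and $\sum_{\boldsymbol j}(\boldsymbol x_{\boldsymbol j}-\boldsymbol x)^{\boldsymbol r}w_{\boldsymbol j,\boldsymbol p}(\boldsymbol x;h)=0$ for all $\boldsymbol r\in\mathbb N_0^d$ with $|\boldsymbol r|=1,\dots,\zeta$; (W2) $w_{\boldsymbol j,\boldsymbol p}(\boldsymbol x;h)=0$ if $\|\boldsymbol x_{\boldsymbol j}-\boldsymbol x\|_\infty>h$, $\boldsymbol x\in T$; (W3) $\max_{\boldsymbol j}|w_{\boldsymbol j,\boldsymbol p}(\boldsymbol x;h)|\le C_1/(\boldsymbol p^{\boldsymbol 1}h^d)$, $\boldsymbol x\in T$; (W4) $|w_{\boldsymbol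 j,\boldsymbol p}(\boldsymbol x;h)-w_{\boldsymbol j,\boldsymbol p}(\boldsymbol y;h)|\le\frac{C_2}{\boldsymbol p^{\boldsymbol 1}h^d}\big(\frac{\|\boldsymbol x-\boldsymbol y\|_\infty}{h}\wedge1\big)$, $\boldsymbol x,\boldsymbol y\in T$. (A3) There is a constant $C_3>0$ such that for each $\boldsymbol x\in T$ and each $h>0$, the number of indices $\boldsymbol j$, $\boldsymbol 1\le\boldsymbol j\le\boldsymbol p$, with $\boldsymbol x-(h,\dots,h)\le\boldsymbol x_{\boldsymbol j}\le\boldsymbol x+(h,\dots,h)$ is at most $C_3h^d\boldsymbol p^{\boldsymbol 1}$.
   Formalization: (A3), contradictory for all h>0, is assumed only for h>c/p_min; the second claim additionally assumes that (W1)–(W4) hold with uniform constants at h* whenever h*=c/p_min, a bandwidth that (A2) excludes and where the weights would otherwise be arbitrary. *)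

theory Defs
  imports "HOL-Probability.Probability"
begin

text \<open>
  The dimension \<open>d\<close> is \<open>CARD('d)\<close>; points are vectors in \<open>real ^ 'd\<close>, multi-indices are
  functions \<open>'d \<Rightarrow> nat\<close>, and the max-norm of a vector is the library's \<^const>\<open>infnorm\<close>.
  Functions on the cube are total functions of which only the values on the cube are used.
\<close>

definition unit_cube :: "(real ^ 'd) set" where
  "unit_cube = {x. \<forall>k. 0 \<le> x $ k \<and> x $ k \<le> 1}"

definition strict_floor :: "real \<Rightarrow> nat" where
  "strict_floor \<alpha> = Max {k::nat. real k < \<alpha>}"

definition multi_degree :: "('d::finite \<Rightarrow> nat) \<Rightarrow> nat" where
  "multi_degree r = (\<Sum>k\<in>UNIV. r k)"

definition multi_power :: "real ^ 'd \<Rightarrow> ('d::finite \<Rightarrow> nat) \<Rightarrow> real" where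
  "multi_power x r = (\<Prod>k\<in>UNIV. (x $ k) ^ r k)"

definition p_prod :: "('d::finite \<Rightarrow> nat) \<Rightarrow> real" where
  "p_prod p = (\<Prod>k\<in>UNIV. real (p k))"

definition p_min :: "('d::finite \<Rightarrow> nat) \<Rightarrow> nat" where
  "p_min p = Min (range p)"

definition grid :: "('d::finite \<Rightarrow> nat) \<Rightarrow> ('d \<Rightarrow> nat) set" where
  "grid p = {j. \<forall>k. 1 \<le> j k \<and> j k \<le> p k}"

definition sup_norm :: "(real ^ 'd \<Rightarrow> real) \<Rightarrow> ennreal" where
  "sup_norm f = (SUP x\<in>unit_cube. ennreal \<bar>f x\<bar>)"

text \<open>
  \<open>partial_derivs m f D\<close>: the functions \<open>D \<beta>\<close>, for multi-indices \<open>\<beta>\<close> of degree at most \<open>m\<close>, are the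
  partial derivatives of \<open>f\<close> on the cube (one-sided at the faces). Each \<open>D \<beta>\<close> must be obtained from
  \<open>f\<close> by differentiating in any order of the coordinates, so \<open>D \<beta>\<close> is uniquely determined on the
  cube. The order of differentiation is immaterial as soon as the highest derivatives are
  continuous, which holds when the Hoelder norm below is finite.
\<close>

definition partial_derivs ::
  "nat \<Rightarrow> (real ^ 'd \<Rightarrow> real) \<Rightarrow> (('d::finite \<Rightarrow> nat) \<Rightarrow> real ^ 'd \<Rightarrow> real) \<Rightarrow> bool" where
  "partial_derivs m f D \<longleftrightarrow>
     (\<forall>x\<in>unit_cube. D (\<lambda>_. 0) x = f x) \<and>
     (\<forall>\<beta> k. multi_degree \<beta> < m \<longrightarrow>
        (\<forall>x\<in>unit_cube.
           ((\<lambda>t. D \<beta> (x + t *\<^sub>R axis k 1)) has_real_derivative D (\<beta>(k := Suc (\<beta> k))) x)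
             (at 0 within {t. x + t *\<^sub>R axis k 1 \<in> unit_cube})))"

definition holder_norm ::
  "real \<Rightarrow> (('d::finite \<Rightarrow> nat) \<Rightarrow> real ^ 'd \<Rightarrow> real) \<Rightarrow> ennreal" where
  "holder_norm \<alpha> D =
     (SUP \<beta>\<in>{\<beta>. multi_degree \<beta> \<le> strict_floor \<alpha>}. sup_norm (D \<beta>)) +
     (SUP \<beta>\<in>{\<beta>. multi_degree \<beta> = strict_floor \<alpha>}.
        SUP (x, y)\<in>{(x, y). x \<in> unit_cube \<and> y \<in> unit_cube \<and> x \<noteq> y}.
          ennreal (\<bar>D \<beta> x - D \<beta> y\<bar> / infnorm (x - y) powr (\<alpha> - real (strict_floor \<alpha>))))"

definition holder_class :: "real \<Rightarrow> real \<Rightarrow> (real ^ 'd::finite \<Rightarrow> real) set" where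
  "holder_class \<alpha> L =
     {f. \<exists>D. partial_derivs (strict_floor \<alpha>) f D \<and> holder_norm \<alpha> D \<le> ennreal L}"

text \<open>
  A random field is a pair of a probability space and a family of random variables on it. The
  Hoelder bound is required almost surely for each pair of points, which is implied by the variant
  with one exceptional null set for all pairs.
\<close>

definition process_class ::
  "real \<Rightarrow> real \<Rightarrow> ('b measure \<times> (real ^ 'd \<Rightarrow> 'b \<Rightarrow> real)) set" where
  "process_class \<beta>\<^sub>0 C\<^sub>Z =
     {(N, Z). prob_space N \<and>
        (\<forall>x\<in>unit_cube. Z x \<in> borel_measurable N \<and> integrable N (\<lambda>\<omega>. (Z x \<omega>)\<^sup>2) \<and>
           integrable N (Z x) \<and> (\<integral>\<omega>. Z x \<omega> \<partial>N) = 0) \<and>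
        (\<exists>\<beta> M. \<beta>\<^sub>0 \<le> \<beta> \<and> \<beta> \<le> 1 \<and> M \<in> borel_measurable N \<and> (AE \<omega> in N. 0 < M \<omega>) \<and>
           (\<integral>\<^sup>+\<omega>. ennreal ((M \<omega>)\<^sup>2) \<partial>N) + (\<integral>\<^sup>+\<omega>. ennreal ((Z 0 \<omega>)\<^sup>2) \<partial>N) \<le> ennreal C\<^sub>Z \<and>
           (\<forall>x\<in>unit_cube. \<forall>y\<in>unit_cube.
              AE \<omega> in N. \<bar>Z x \<omega> - Z y \<omega>\<bar> \<le> M \<omega> * infnorm (x - y) powr \<beta>))}"

text \<open>\<open>t k l\<close> is the \<open>l\<close>-th design coordinate in direction \<open>k\<close>.\<close>

definition design_point :: "('d::finite \<Rightarrow> nat \<Rightarrow> real) \<Rightarrow> ('d \<Rightarrow> nat) \<Rightarrow> real ^ 'd" where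
  "design_point t j = (\<chi> k. t k (j k))"

definition design :: "('d::finite \<Rightarrow> nat) \<Rightarrow> ('d \<Rightarrow> nat \<Rightarrow> real) \<Rightarrow> bool" where
  "design p t \<longleftrightarrow>
     (\<forall>j\<in>grid p. design_point t j \<in> unit_cube) \<and>
     (\<forall>k l. 1 \<le> l \<and> l < p k \<longrightarrow> t k l < t k (Suc l))"

text \<open>
  The sub-Gaussian norm is taken on the scale of a variance (the optimal variance proxy), since it is
  compared with a multiple of the variance. It is finite iff the distribution is centered
  sub-Gaussian.
\<close>

definition sub_gaussian_norm :: "real measure \<Rightarrow> ennreal" where
  "sub_gaussian_norm P =
     (INF s\<in>{s. 0 \<le> s \<and> (\<forall>v. (\<integral>\<^sup>+u. ennreal (exp (v * u)) \<partial>P) \<le> ennreal (exp (v\<^sup>2 * s / 2)))}.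
        ennreal s)"

text \<open>
  \<open>err n i j\<close> is the distribution of the error with indices \<open>i\<close> and \<open>j\<close> at sample size \<open>n\<close>. The
  independence assumptions on the errors are part of the set \<open>fda_model\<close> below.
\<close>

definition errors_A1 ::
  "(nat \<Rightarrow> 'd::finite \<Rightarrow> nat) \<Rightarrow> (nat \<Rightarrow> nat \<Rightarrow> ('d \<Rightarrow> nat) \<Rightarrow> real measure) \<Rightarrow> bool" where
  "errors_A1 p err \<longleftrightarrow>
     (\<forall>n. \<forall>i\<in>{1..n}. \<forall>j\<in>grid (p n).
        prob_space (err n i j) \<and> sets (err n i j) = sets borel \<and>
        integrable (err n i j) (\<lambda>u. u) \<and> (\<integral>u. u \<partial>err n i j) = 0 \<and>
        integrable (err n i j) (\<lambda>u. u\<^sup>2)) \<and>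
     bdd_above {(\<integral>u. u\<^sup>2 \<partial>err n i j) | n i j. i \<in> {1..n} \<and> j \<in> grid (p n)} \<and>
     (\<exists>\<zeta>\<^sub>0>0. \<forall>n. \<forall>i\<in>{1..n}. \<forall>j\<in>grid (p n).
        sub_gaussian_norm (err n i j) \<le> ennreal (\<zeta>\<^sub>0\<^sup>2 * (\<integral>u. u\<^sup>2 \<partial>err n i j)))"

text \<open>
  All realizations \<open>(M, Zs, eps)\<close>, on some probability space \<open>M\<close>, of \<open>n\<close> independent copies of the
  random field \<open>Z\<close> (given on the space \<open>N\<close>) together with independent errors of distributions
  \<open>err i j\<close> that are independent of the copies. The copies have the law of \<open>Z\<close> on the product
  sigma-algebra.
\<close>

definition fda_model ::
  "nat \<Rightarrow> ('d::finite \<Rightarrow> nat) \<Rightarrow> (nat \<Rightarrow> ('d \<Rightarrow> nat) \<Rightarrow> real measure) \<Rightarrow>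
   'b measure \<times> (real ^ 'd \<Rightarrow> 'b \<Rightarrow> real) \<Rightarrow>
   ('a measure \<times> (nat \<Rightarrow> real ^ 'd \<Rightarrow> 'a \<Rightarrow> real) \<times> (nat \<Rightarrow> ('d \<Rightarrow> nat) \<Rightarrow> 'a \<Rightarrow> real)) set" where
  "fda_model n p err = (\<lambda>(N, Z). {(M, Zs, eps).
     prob_space M \<and>
     prob_space.indep_vars M (\<lambda>_. \<Pi>\<^sub>M x\<in>unit_cube. borel)
       (\<lambda>i \<omega>. \<lambda>x\<in>unit_cube. Zs i x \<omega>) {1..n} \<and>
     (\<forall>i\<in>{1..n}. distr M (\<Pi>\<^sub>M x\<in>unit_cube. borel) (\<lambda>\<omega>. \<lambda>x\<in>unit_cube. Zs i x \<omega>) =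
                 distr N (\<Pi>\<^sub>M x\<in>unit_cube. borel) (\<lambda>\<omega>. \<lambda>x\<in>unit_cube. Z x \<omega>)) \<and>
     prob_space.indep_vars M (\<lambda>_. borel) (\<lambda>(i, j). eps i j) ({1..n} \<times> grid p) \<and>
     (\<forall>i\<in>{1..n}. \<forall>j\<in>grid p. distr M borel (eps i j) = err i j) \<and>
     prob_space.indep_set M
       {(\<lambda>\<omega>. \<lambda>i\<in>{1..n}. \<lambda>x\<in>unit_cube. Zs i x \<omega>) -` A \<inter> space M | A.
          A \<in> sets (\<Pi>\<^sub>M i\<in>{1..n}. \<Pi>\<^sub>M x\<in>unit_cube. borel)}
       {(\<lambda>\<omega>. \<lambda>(i, j)\<in>{1..n} \<times> grid p. eps i j \<omega>) -` B \<inter> space M | B.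
          B \<in> sets (\<Pi>\<^sub>M ij\<in>{1..n} \<times> grid p. borel)}})"

definition observation ::
  "('d::finite \<Rightarrow> nat \<Rightarrow> real) \<Rightarrow> (real ^ 'd \<Rightarrow> real) \<Rightarrow> (nat \<Rightarrow> real ^ 'd \<Rightarrow> 'a \<Rightarrow> real) \<Rightarrow>
   (nat \<Rightarrow> ('d \<Rightarrow> nat) \<Rightarrow> 'a \<Rightarrow> real) \<Rightarrow> nat \<Rightarrow> ('d \<Rightarrow> nat) \<Rightarrow> 'a \<Rightarrow> real" where
  "observation t \<mu> Zs eps i j \<omega> =
     \<mu> (design_point t j) + Zs i (design_point t j) \<omega> + eps i j \<omega>"

definition mean_observation ::
  "nat \<Rightarrow> ('d::finite \<Rightarrow> nat \<Rightarrow> real) \<Rightarrow> (real ^ 'd \<Rightarrow> real) \<Rightarrow>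
   (nat \<Rightarrow> real ^ 'd \<Rightarrow> 'a \<Rightarrow> real) \<Rightarrow> (nat \<Rightarrow> ('d \<Rightarrow> nat) \<Rightarrow> 'a \<Rightarrow> real) \<Rightarrow>
   ('d \<Rightarrow> nat) \<Rightarrow> 'a \<Rightarrow> real" where
  "mean_observation n t \<mu> Zs eps j \<omega> =
     1 / real n * (\<Sum>i = 1..n. observation t \<mu> Zs eps i j \<omega>)"

text \<open>\<open>w j x h\<close> is the weight of the design point with index \<open>j\<close> at \<open>x\<close> for the bandwidth \<open>h\<close>.\<close>

definition weight_conditions ::
  "nat \<Rightarrow> ('d::finite \<Rightarrow> nat) \<Rightarrow> ('d \<Rightarrow> nat \<Rightarrow> real) \<Rightarrow>
   (('d \<Rightarrow> nat) \<Rightarrow> real ^ 'd \<Rightarrow> real \<Rightarrow> real) \<Rightarrow> real \<Rightarrow> real \<Rightarrow> real \<Rightarrow> bool" where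
  "weight_conditions \<zeta> p t w C\<^sub>1 C\<^sub>2 h \<longleftrightarrow>
     (\<forall>x\<in>unit_cube. (\<Sum>j\<in>grid p. w j x h) = 1 \<and>
        (\<forall>r. 1 \<le> multi_degree r \<and> multi_degree r \<le> \<zeta> \<longrightarrow>
           (\<Sum>j\<in>grid p. multi_power (design_point t j - x) r * w j x h) = 0)) \<and>
     (\<forall>x\<in>unit_cube. \<forall>j\<in>grid p. infnorm (design_point t j - x) > h \<longrightarrow> w j x h = 0) \<and>
     (\<forall>x\<in>unit_cube. \<forall>j\<in>grid p. \<bar>w j x h\<bar> \<le> C\<^sub>1 / (p_prod p * h ^ CARD('d))) \<and>
     (\<forall>x\<in>unit_cube. \<forall>y\<in>unit_cube. \<forall>j\<in>grid p.
        \<bar>w j x h - w j y h\<bar> \<le> C\<^sub>2 / (p_prod p * h ^ CARD('d)) * min (infnorm (x - y) / h) 1)"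

text \<open>\<open>H n\<close> is the set of bandwidths for which the conditions are required at sample size \<open>n\<close>.\<close>

definition weights_A2 ::
  "nat \<Rightarrow> (nat \<Rightarrow> 'd::finite \<Rightarrow> nat) \<Rightarrow> (nat \<Rightarrow> 'd \<Rightarrow> nat \<Rightarrow> real) \<Rightarrow>
   (nat \<Rightarrow> ('d \<Rightarrow> nat) \<Rightarrow> real ^ 'd \<Rightarrow> real \<Rightarrow> real) \<Rightarrow> (nat \<Rightarrow> real set) \<Rightarrow> bool" where
  "weights_A2 \<zeta> p t w H \<longleftrightarrow>
     (\<exists>C\<^sub>1>0. \<exists>C\<^sub>2>0. \<exists>P\<^sub>0. \<forall>n. P\<^sub>0 \<le> p_min (p n) \<longrightarrow>
        (\<forall>h\<in>H n. weight_conditions \<zeta> (p n) (t n) (w n) C\<^sub>1 C\<^sub>2 h))"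

text \<open>
  The local number of design points is bounded for \<open>h > c / p_min\<close> only: no bound of this form can
  hold for all \<open>h > 0\<close>, because the cube around a design point always contains at least one design
  point. Changing the constant \<open>c\<close> merely changes \<open>C\<^sub>3\<close>.
\<close>

definition design_A3 ::
  "real \<Rightarrow> (nat \<Rightarrow> 'd::finite \<Rightarrow> nat) \<Rightarrow> (nat \<Rightarrow> 'd \<Rightarrow> nat \<Rightarrow> real) \<Rightarrow> bool" where
  "design_A3 c p t \<longleftrightarrow>
     (\<exists>C\<^sub>3>0. \<forall>n. \<forall>x\<in>unit_cube. \<forall>h > c / real (p_min (p n)).
        real (card {j \<in> grid (p n). \<forall>k. x $ k - h \<le> design_point (t n) j $ k \<and>
                                       design_point (t n) j $ k \<le> x $ k + h})
          \<le> C\<^sub>3 * h ^ CARD('d) * p_prod (p n))"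

definition estimator ::
  "nat \<Rightarrow> ('d::finite \<Rightarrow> nat) \<Rightarrow> ('d \<Rightarrow> nat \<Rightarrow> real) \<Rightarrow>
   (('d \<Rightarrow> nat) \<Rightarrow> real ^ 'd \<Rightarrow> real \<Rightarrow> real) \<Rightarrow> real \<Rightarrow> (real ^ 'd \<Rightarrow> real) \<Rightarrow>
   (nat \<Rightarrow> real ^ 'd \<Rightarrow> 'a \<Rightarrow> real) \<Rightarrow> (nat \<Rightarrow> ('d \<Rightarrow> nat) \<Rightarrow> 'a \<Rightarrow> real) \<Rightarrow>
   real ^ 'd \<Rightarrow> 'a \<Rightarrow> real" where
  "estimator n p t w h \<mu> Zs eps x \<omega> =
     (\<Sum>j\<in>grid p. w j x h * mean_observation n t \<mu> Zs eps j \<omega>)"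

text \<open>The expected sup-norm error; a nonnegative integral, so it is infinite if not integrable.\<close>

definition expected_error ::
  "nat \<Rightarrow> ('d::finite \<Rightarrow> nat) \<Rightarrow> ('d \<Rightarrow> nat \<Rightarrow> real) \<Rightarrow>
   (('d \<Rightarrow> nat) \<Rightarrow> real ^ 'd \<Rightarrow> real \<Rightarrow> real) \<Rightarrow> real \<Rightarrow> (real ^ 'd \<Rightarrow> real) \<Rightarrow>
   'a measure \<times> (nat \<Rightarrow> real ^ 'd \<Rightarrow> 'a \<Rightarrow> real) \<times> (nat \<Rightarrow> ('d \<Rightarrow> nat) \<Rightarrow> 'a \<Rightarrow> real) \<Rightarrow> ennreal" where
  "expected_error n p t w h \<mu> = (\<lambda>(M, Zs, eps).
     \<integral>\<^sup>+\<omega>. sup_norm (\<lambda>x. estimator n p t w h \<mu> Zs eps x \<omega> - \<mu> x) \<partial>M)"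

text \<open>
  If \<open>h > 1\<close> the argument of the square root is negative; then so is the root, and the term does not
  contribute to the maximum.
\<close>

definition rate :: "real \<Rightarrow> nat \<Rightarrow> ('d::finite \<Rightarrow> nat) \<Rightarrow> real \<Rightarrow> real" where
  "rate \<alpha> n p h =
     Max {h powr \<alpha>, sqrt (ln (1 / h) / (real n * p_prod p * h ^ CARD('d))), 1 / sqrt (real n)}"

definition h_star :: "real \<Rightarrow> real \<Rightarrow> nat \<Rightarrow> ('d::finite \<Rightarrow> nat) \<Rightarrow> real" where
  "h_star \<alpha> c n p =
     max (c / real (p_min p))
       ((ln (real n * p_prod p) / (real n * p_prod p)) powr (1 / (2 * \<alpha> + real CARD('d))))"

definition rate_star :: "real \<Rightarrow> nat \<Rightarrow> ('d::finite \<Rightarrow> nat) \<Rightarrow> real" where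
  "rate_star \<alpha> n p =
     Max {real (p_min p) powr (- \<alpha>),
          (ln (real n * p_prod p) / (real n * p_prod p)) powr (\<alpha> / (2 * \<alpha> + real CARD('d))),
          1 / sqrt (real n)}"

end

theory Submission
  imports Defs
begin

text \<open>
  The error of the estimator is the sum of a bias, a weighted average of the mean \<open>Z\<close> of the processes
  and a weighted average of the mean errors. The weights reproduce polynomials and have bounded
  absolute sum, so by Taylor's formula the bias is of order \<open>h powr \<alpha>\<close>, and the second term is at most
  a multiple of the maximum of the mean process over the design points.

  That maximum is of order \<open>1 / sqrt n\<close>, no matter how many design points there are. Only second
  moments of the increments are available; for a soft maximum, whose second-order expansion is
  controlled by the sup-norm of the increment, independence gives
  \<open>E (max over N indices of the sum of n vectors) \<le> 2 sqrt (2 n B ln (2 N))\<close>, where \<open>B\<close> bounds the second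
  moment of the sup-norm of one vector. Applied to the increments between dyadic roundings of
  consecutive levels, where \<open>ln N\<close> grows linearly and \<open>B\<close> decays geometrically in the level, this sums up to
  a constant multiple of \<open>1 / sqrt n\<close>.

  For the error term one net of the cube, of mesh \<open>P powr -(d + 1)\<close> for \<open>P = p_prod p\<close>, suffices: the weights
  are Lipschitz continuous, and the sub-Gaussian maximal inequality yields the order
  \<open>sqrt ((1 + ln P) / (n P h ^ d))\<close>. If \<open>P h ^ d \<ge> sqrt P\<close>, this is at most of order \<open>1 / sqrt n\<close>; otherwise
  \<open>ln P\<close> is at most \<open>2 d ln (1 / h)\<close>.
\<close>

section \<open>Taylor approximation in the cube\<close>

text \<open>The obstacle that shapes the argument is how little is known about the paths of
  \<open>Z\<close>: increments are bounded almost surely for each pair of points only, with a random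
  constant that has just a second moment, and suprema over the cube need not be measurable. The
  estimator sees the processes at finitely many design points alone, so everything about them is
  reduced to finite maxima, for which null sets can be united and laws transferred between
  probability spaces. The supremum over \<open>x\<close> is removed by deterministic properties of
  the weights. Exponential moments of the increments of \<open>Z\<close> need not exist. The soft
  maximum copes with this because its expansion error is quadratic in the increment for increments
  of any size. Processes and errors call for different treatment. Increments of \<open>Z\<close>
  shrink with the distance, so chaining removes the logarithm of the number of points. The errors
  have no continuity; they become small through local averaging over about \<open>P * h ^ d\<close>
  points, and the logarithm of the size of the net remains.\<close>

definition multi_fact :: "('d::finite \<Rightarrow> nat) \<Rightarrow> real" where
  "multi_fact r = (\<Prod>k\<in>UNIV. fact (r k))"

definition multi_taylor ::
  "nat \<Rightarrow> (('d::finite \<Rightarrow> nat) \<Rightarrow> real ^ 'd \<Rightarrow> real) \<Rightarrow> real ^ 'd \<Rightarrow> real ^ 'd \<Rightarrow> real" where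
  "multi_taylor m D x y =
     (\<Sum>\<beta>\<in>{\<beta>. multi_degree \<beta> \<le> m}. D \<beta> x * multi_power (y - x) \<beta> / multi_fact \<beta>)"

lemma multi_degree_upd_Suc: "multi_degree (\<beta>(k := Suc (\<beta> k))) = Suc (multi_degree \<beta>)"
proof -
  have "multi_degree (\<beta>(k := Suc (\<beta> k))) = (\<Sum>i\<in>UNIV. \<beta> i + (if i = k then 1 else 0))"
    unfolding multi_degree_def by (intro sum.cong) auto
  then show ?thesis
    by (simp add: sum.distrib multi_degree_def)
qed

lemma multi_degree_eq_0_iff: "multi_degree \<beta> = 0 \<longleftrightarrow> \<beta> = (\<lambda>_. 0)"
  by (auto simp: multi_degree_def)

lemma finite_multi_degree_le: "finite {\<beta> :: 'd::finite \<Rightarrow> nat. multi_degree \<beta> \<le> m}"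
proof (rule finite_subset)
  have "\<beta> k \<le> multi_degree \<beta>" for \<beta> :: "'d \<Rightarrow> nat" and k
    unfolding multi_degree_def by (intro member_le_sum) auto
  then show "{\<beta> :: 'd \<Rightarrow> nat. multi_degree \<beta> \<le> m} \<subseteq> Pi\<^sub>E UNIV (\<lambda>_. {..m})"
    by (auto intro: order_trans)
qed (auto intro: finite_PiE)

lemma infnorm_cart: "infnorm (x :: real ^ 'd::finite) = Max (range (\<lambda>k. \<bar>x $ k\<bar>))"
proof -
  have "{\<bar>x \<bullet> i\<bar> |i. i \<in> Basis} = range (\<lambda>k. \<bar>x $ k\<bar>)"
    by (auto simp: Basis_vec_def inner_axis) (metis axis_index axis_in_Basis_iff axis_in_Basis_iff inner_axis real_inner_1_right cart_eq_inner_axis Basis_real_def insertI1)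
  then show ?thesis
    by (simp add: infnorm_def cSup_eq_Max)
qed

lemma abs_component_le_infnorm: "\<bar>x $ k\<bar> \<le> infnorm (x :: real ^ 'd::finite)"
  by (simp add: infnorm_cart)

lemma infnorm_le_iff: "infnorm (x :: real ^ 'd::finite) \<le> b \<longleftrightarrow> (\<forall>k. \<bar>x $ k\<bar> \<le> b)"
  by (simp add: infnorm_cart)

text \<open>The index shift of polynomial differentiation: monomials without the \<open>k\<close>-th
  variable contribute nothing, and raising the \<open>k\<close>-th exponent matches the remaining
  multi-indices with those of one degree less.\<close>

lemma sum_multi_degree_Suc:
  fixes F :: "('d::finite \<Rightarrow> nat) \<Rightarrow> real"
  assumes "\<And>\<beta>. \<beta> k = 0 \<Longrightarrow> F \<beta> = 0"
  shows "(\<Sum>\<beta>\<in>{\<beta>. multi_degree \<beta> \<le> Suc m}. F \<beta>)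
       = (\<Sum>\<beta>\<in>{\<beta>. multi_degree \<beta> \<le> m}. F (\<beta>(k := Suc (\<beta> k))))"
proof -
  have "(\<Sum>\<beta>\<in>{\<beta>. multi_degree \<beta> \<le> Suc m}. F \<beta>)
      = (\<Sum>\<beta>\<in>{\<beta>. multi_degree \<beta> \<le> Suc m \<and> \<beta> k \<noteq> 0}. F \<beta>)"
    using assms by (intro sum.mono_neutral_right finite_multi_degree_le) auto
  also have "\<dots> = (\<Sum>\<beta>\<in>{\<beta>. multi_degree \<beta> \<le> m}. F (\<beta>(k := Suc (\<beta> k))))"
  proof (rule sum.reindex_bij_witness[where i = "\<lambda>\<beta>. \<beta>(k := Suc (\<beta> k))" and j = "\<lambda>\<beta>. \<beta>(k := \<beta> k - 1)"])
    fix \<beta> :: "'d \<Rightarrow> nat" assume "\<beta> \<in> {\<beta>. multi_degree \<beta> \<le> Suc m \<and> \<beta> k \<noteq> 0}"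
    moreover from this have *: "(\<beta>(k := \<beta> k - 1))(k := Suc ((\<beta>(k := \<beta> k - 1)) k)) = \<beta>"
      by auto
    ultimately show "\<beta>(k := \<beta> k - 1) \<in> {\<beta>. multi_degree \<beta> \<le> m}"
      using multi_degree_upd_Suc[of "\<beta>(k := \<beta> k - 1)" k] by simp
    show "(\<beta>(k := \<beta> k - 1))(k := Suc ((\<beta>(k := \<beta> k - 1)) k)) = \<beta>" by (rule *)
    then show "F ((\<beta>(k := \<beta> k - 1))(k := Suc ((\<beta>(k := \<beta> k - 1)) k))) = F \<beta>" by simp
  next
    fix \<beta> :: "'d \<Rightarrow> nat" assume "\<beta> \<in> {\<beta>. multi_degree \<beta> \<le> m}"
    then show "\<beta>(k := Suc (\<beta> k)) \<in> {\<beta>. multi_degree \<beta> \<le> Suc m \<and> \<beta> k \<noteq> 0}"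
      using multi_degree_upd_Suc[of \<beta> k] by simp
  qed auto
  finally show ?thesis .
qed

lemma multi_power_split:
  "multi_power (x + t *\<^sub>R axis k 1) \<beta> = (x $ k + t) ^ \<beta> k * (\<Prod>i\<in>UNIV - {k}. (x $ i) ^ \<beta> i)"
proof -
  have "multi_power (x + t *\<^sub>R axis k 1) \<beta>
      = ((x + t *\<^sub>R axis k 1) $ k) ^ \<beta> k * (\<Prod>i\<in>UNIV - {k}. ((x + t *\<^sub>R axis k 1) $ i) ^ \<beta> i)"
    unfolding multi_power_def by (rule prod.remove) auto
  also have "(\<Prod>i\<in>UNIV - {k}. ((x + t *\<^sub>R axis k 1) $ i) ^ \<beta> i) = (\<Prod>i\<in>UNIV - {k}. (x $ i) ^ \<beta> i)"
    by (intro prod.cong) (auto simp: axis_def)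
  finally show ?thesis by (simp add: axis_def)
qed

lemma multi_fact_split: "multi_fact \<beta> = fact (\<beta> k) * (\<Prod>i\<in>UNIV - {k}. fact (\<beta> i))"
  unfolding multi_fact_def by (rule prod.remove) auto

text \<open>For \<open>\<beta> k = 0\<close> the truncated exponent \<open>\<beta> k - 1\<close> is
  harmless, because its coefficient is 0.\<close>

lemma multi_power_deriv:
  "((\<lambda>t. multi_power (x + t *\<^sub>R axis k 1) \<beta>) has_real_derivative
     real (\<beta> k) * multi_power (x + t *\<^sub>R axis k 1) (\<beta>(k := \<beta> k - 1))) (at t within S)"
  unfolding multi_power_split by (auto intro!: derivative_eq_intros)

text \<open>The coefficients stay frozen at \<open>x\<close> while the argument moves. The factor
  from the exponent cancels against the factorial, which leaves the polynomial of one order less for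
  the family shifted by one derivative in direction \<open>k\<close>.\<close>

lemma multi_taylor_deriv:
  "((\<lambda>t. multi_taylor (Suc m) D x (z + t *\<^sub>R axis k 1)) has_real_derivative
     multi_taylor m (\<lambda>\<beta>. D (\<beta>(k := Suc (\<beta> k)))) x (z + t *\<^sub>R axis k 1)) (at t within S)"
proof -
  define F where "F \<beta> = D \<beta> x * (real (\<beta> k) * multi_power (z + t *\<^sub>R axis k 1 - x) (\<beta>(k := \<beta> k - 1)))
                          / multi_fact \<beta>" for \<beta>
  have "((\<lambda>t. multi_taylor (Suc m) D x (z + t *\<^sub>R axis k 1)) has_real_derivative
     (\<Sum>\<beta>\<in>{\<beta>. multi_degree \<beta> \<le> Suc m}. F \<beta>)) (at t within S)"
    unfolding multi_taylor_def F_def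
    using multi_power_deriv[of "z - x" k]
    by (intro DERIV_sum DERIV_cdivide DERIV_cmult) (simp add: algebra_simps)
  also have "(\<Sum>\<beta>\<in>{\<beta>. multi_degree \<beta> \<le> Suc m}. F \<beta>)
      = (\<Sum>\<beta>\<in>{\<beta>. multi_degree \<beta> \<le> m}. F (\<beta>(k := Suc (\<beta> k))))"
    by (rule sum_multi_degree_Suc) (simp add: F_def)
  also have "\<dots> = multi_taylor m (\<lambda>\<beta>. D (\<beta>(k := Suc (\<beta> k)))) x (z + t *\<^sub>R axis k 1)"
    unfolding multi_taylor_def
  proof (intro sum.cong refl)
    fix \<beta> :: "'a \<Rightarrow> nat"
    have "multi_fact (\<beta>(k := Suc (\<beta> k))) = real (Suc (\<beta> k)) * multi_fact \<beta>"
      unfolding multi_fact_split[of _ k] by (simp add: algebra_simps)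
    then show "F (\<beta>(k := Suc (\<beta> k))) = D (\<beta>(k := Suc (\<beta> k))) x * multi_power (z + t *\<^sub>R axis k 1 - x) \<beta> / multi_fact \<beta>"
      unfolding F_def by (simp del: of_nat_Suc) 
  qed
  finally show ?thesis .
qed

lemma multi_taylor_self: "multi_taylor m D x x = D (\<lambda>_. 0) x"
proof -
  have "multi_power 0 \<beta> = (if \<beta> = (\<lambda>_. 0) then 1 else 0)" for \<beta> :: "'a \<Rightarrow> nat"
    by (auto simp: multi_power_def power_0_left)
  then have "multi_taylor m D x x
      = (\<Sum>\<beta>\<in>{\<beta>. multi_degree \<beta> \<le> m}. if \<beta> = (\<lambda>_. 0) then D \<beta> x / multi_fact \<beta> else 0)"
    unfolding multi_taylor_def by (intro sum.cong) auto
  also have "\<dots> = D (\<lambda>_. 0) x"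
    by (subst sum.delta[OF finite_multi_degree_le]) (simp add: multi_degree_def multi_fact_def)
  finally show ?thesis .
qed

lemma unit_cube_line:
  assumes "z \<in> unit_cube" "z + a *\<^sub>R axis k 1 \<in> unit_cube" "t \<in> closed_segment 0 a"
  shows "z + t *\<^sub>R axis k 1 \<in> unit_cube"
proof -
  have "0 \<le> t \<and> t \<le> a \<or> a \<le> t \<and> t \<le> 0" using assms(3) by (auto simp: closed_segment_eq_real_ivl split: if_splits)
  moreover have "0 \<le> z $ k + a" "z $ k + a \<le> 1" "0 \<le> z $ k" "z $ k \<le> 1"
    using assms(1,2) by (auto simp: unit_cube_def dest!: spec[of _ k])
  ultimately have "0 \<le> z $ k + t" "z $ k + t \<le> 1" by linarith+
  then show ?thesis using assms(1) by (auto simp: unit_cube_def axis_def)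
qed

text \<open>A max-norm ball is convex. Together with \<open>unit_cube_line\<close> this keeps the
  induction hypothesis of the Taylor estimate applicable along a whole axis-parallel
  segment.\<close>

lemma infnorm_line:
  fixes z x :: "real ^ 'd::finite"
  assumes "t \<in> closed_segment 0 a" "infnorm (z - x) \<le> b" "infnorm (z + a *\<^sub>R axis k 1 - x) \<le> b"
  shows "infnorm (z + t *\<^sub>R axis k 1 - x) \<le> b"
  unfolding infnorm_le_iff
proof
  fix i
  have "0 \<le> t \<and> t \<le> a \<or> a \<le> t \<and> t \<le> 0" using assms(1) by (auto simp: closed_segment_eq_real_ivl split: if_splits)
  moreover have "\<bar>(z - x) $ i\<bar> \<le> b" "\<bar>(z + a *\<^sub>R axis k 1 - x) $ i\<bar> \<le> b"
    using assms(2,3) unfolding infnorm_le_iff by auto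
  ultimately show "\<bar>(z + t *\<^sub>R axis k 1 - x) $ i\<bar> \<le> b"
    by (auto simp: axis_def split: if_splits)
qed

text \<open>
  By induction on \<open>m\<close>: the partial derivative in direction \<open>k\<close> of the Taylor remainder is the remainder
  of order \<open>m - 1\<close> of the partial derivative, so the mean value theorem can be applied to one
  coordinate at a time.
\<close>

lemma multi_taylor_remainder:
  fixes D :: "('d::finite \<Rightarrow> nat) \<Rightarrow> real ^ 'd \<Rightarrow> real"
  assumes "partial_derivs m f D" and "0 \<le> L"
    and "\<And>\<beta> x y. multi_degree \<beta> = m \<Longrightarrow> x \<in> unit_cube \<Longrightarrow> y \<in> unit_cube \<Longrightarrow>
           \<bar>D \<beta> x - D \<beta> y\<bar> \<le> L * infnorm (x - y) powr \<gamma>"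
    and "\<gamma> \<ge> 0" "x \<in> unit_cube" "y \<in> unit_cube"
  shows "\<bar>f y - multi_taylor m D x y\<bar> \<le> real CARD('d) ^ m * L * infnorm (y - x) ^ m * infnorm (y - x) powr \<gamma>"
  using assms
proof (induction m arbitrary: f D y)
  case 0
  have "multi_taylor 0 D x y = D (\<lambda>_. 0) x"
    unfolding multi_taylor_def by (simp add: multi_degree_eq_0_iff multi_power_def multi_fact_def)
  moreover have "f y = D (\<lambda>_. 0) y" using 0 by (simp add: partial_derivs_def)
  ultimately show ?case using 0 by (simp add: multi_degree_eq_0_iff)
next
  case (Suc m)
  let ?D = "\<lambda>k \<beta>. D (\<beta>(k := Suc (\<beta> k)))"
  define b where "b = infnorm (y - x)"
  have b0: "b \<ge> 0" by (simp add: b_def infnorm_pos_le)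
  define B where "B = real CARD('d) ^ m * L * b ^ m * b powr \<gamma>"
  have B0: "B \<ge> 0" unfolding B_def using Suc.prems b0 by simp
  \<comment> \<open>Increments of a multi-index commute, so a derivative of the shifted family in
    direction \<open>i\<close> is again a member of the shifted family.\<close>
  have pd: "partial_derivs m (?D k (\<lambda>_. 0)) (?D k)" for k
    unfolding partial_derivs_def
  proof (intro conjI allI impI ballI)
    fix \<beta> :: "'d \<Rightarrow> nat" and i and x :: "real ^ 'd" assume *: "multi_degree \<beta> < m" "x \<in> unit_cube"
    have "(\<beta>(i := Suc (\<beta> i)))(k := Suc ((\<beta>(i := Suc (\<beta> i))) k))
        = (\<beta>(k := Suc (\<beta> k)))(i := Suc ((\<beta>(k := Suc (\<beta> k))) i))" by auto
    then show "((\<lambda>t. ?D k \<beta> (x + t *\<^sub>R axis i 1)) has_real_derivative ?D k (\<beta>(i := Suc (\<beta> i))) x)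
             (at 0 within {t. x + t *\<^sub>R axis i 1 \<in> unit_cube})"
      using Suc.prems(1) * multi_degree_upd_Suc[of \<beta> k] unfolding partial_derivs_def
      by (auto simp only: )
  qed simp
  have IH: "\<bar>?D k (\<lambda>_. 0) z - multi_taylor m (?D k) x z\<bar> \<le> B" if "z \<in> unit_cube" "infnorm (z - x) \<le> b" for k z
  proof -
    have "\<bar>?D k (\<lambda>_. 0) z - multi_taylor m (?D k) x z\<bar>
        \<le> real CARD('d) ^ m * L * infnorm (z - x) ^ m * infnorm (z - x) powr \<gamma>"
      using Suc.prems that by (intro Suc.IH[OF pd] Suc.prems(3)) (auto simp: multi_degree_upd_Suc simp del: fun_upd_apply)
    also have "\<dots> \<le> B" unfolding B_def using Suc.prems that
      by (intro mult_mono power_mono powr_mono2 mult_nonneg_nonneg zero_le_power b0)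
         (auto simp: infnorm_pos_le)
    finally show ?thesis .
  qed
  define g where "g z = D (\<lambda>_. 0) z - multi_taylor (Suc m) D x z" for z
  have step: "\<bar>g (z + a *\<^sub>R axis k 1) - g z\<bar> \<le> B * \<bar>a\<bar>"
    if z: "z \<in> unit_cube" "z + a *\<^sub>R axis k 1 \<in> unit_cube"
      "infnorm (z - x) \<le> b" "infnorm (z + a *\<^sub>R axis k 1 - x) \<le> b" for z a k
  proof -
    let ?u = "\<lambda>t. z + t *\<^sub>R axis k 1"
    have "norm (g (?u a) - g (?u 0)) \<le> B * norm (a - 0)"
    proof (rule field_differentiable_bound[of "closed_segment 0 a" "\<lambda>t. g (?u t)"
            "\<lambda>t. ?D k (\<lambda>_. 0) (?u t) - multi_taylor m (?D k) x (?u t)"])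
      fix t assume t: "t \<in> closed_segment 0 a"
      then have ut: "?u t \<in> unit_cube" using unit_cube_line z by blast
      have "((\<lambda>s. D (\<lambda>_. 0) (?u t + s *\<^sub>R axis k 1)) has_real_derivative ?D k (\<lambda>_. 0) (?u t))
             (at 0 within {s. ?u t + s *\<^sub>R axis k 1 \<in> unit_cube})"
        using Suc.prems(1) ut multi_degree_eq_0_iff[of "\<lambda>_::'d. 0"] unfolding partial_derivs_def
        by (auto dest!: spec[of _ "\<lambda>_::'d. 0"])
      \<comment> \<open>\<open>partial_derivs\<close> speaks of the parameter 0 on a line through
        the current point. The translation by \<open>t\<close> turns this into the derivative at
        \<open>t\<close> within the segment, as the mean value bound requires.\<close>
      then have "((\<lambda>s. D (\<lambda>_. 0) (?u t + s *\<^sub>R axis k 1)) has_real_derivative ?D k (\<lambda>_. 0) (?u t))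
             (at (t - t) within (\<lambda>s. s - t) ` closed_segment 0 a)"
        using unit_cube_line z 
        by (auto intro!: DERIV_subset[of _ _ _ "{s. ?u t + s *\<^sub>R axis k 1 \<in> unit_cube}"] simp flip: scaleR_add_left)
          (simp add: algebra_simps)
      then have "((\<lambda>s. D (\<lambda>_. 0) (?u t + s *\<^sub>R axis k 1)) \<circ> (\<lambda>s. s - t) has_real_derivative ?D k (\<lambda>_. 0) (?u t) * 1)
             (at t within closed_segment 0 a)"
        by (rule DERIV_image_chain) (auto intro!: derivative_eq_intros)
      then have "((\<lambda>s. D (\<lambda>_. 0) (?u s)) has_real_derivative ?D k (\<lambda>_. 0) (?u t)) (at t within closed_segment 0 a)"
        by (simp add: o_def algebra_simps)
      then show "((\<lambda>t. g (?u t)) has_field_derivative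
          ?D k (\<lambda>_. 0) (?u t) - multi_taylor m (?D k) x (?u t)) (at t within closed_segment 0 a)"
        unfolding g_def by (intro DERIV_diff multi_taylor_deriv)
      show "norm (?D k (\<lambda>_. 0) (?u t) - multi_taylor m (?D k) x (?u t)) \<le> B"
        using IH[OF ut infnorm_line[OF t]] z by simp
    qed auto
    then show ?thesis by simp
  qed
  \<comment> \<open>A staircase from \<open>x\<close> to \<open>y\<close>: the coordinates in
    \<open>S\<close> are already switched. All corners lie in the cube and within distance
    \<open>b\<close> of \<open>x\<close>, and each switch costs at most \<open>B * b\<close>; hence
    one factor \<open>CARD('d)\<close> per order.\<close>
  define u where "u S = (\<chi> k. if k \<in> S then y $ k else x $ k)" for S
  have u: "u S \<in> unit_cube" "infnorm (u S - x) \<le> b" for S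
    using Suc.prems(5,6) abs_component_le_infnorm[of "y - x"]
    by (auto simp: unit_cube_def u_def infnorm_le_iff b_def infnorm_pos_le)
  have "\<bar>g (u S)\<bar> \<le> real (card S) * (B * b)" if "finite S" for S
    using that
  proof (induction S)
    case empty
    have "u {} = x" by (simp add: u_def vec_eq_iff)
    then show ?case by (simp add: g_def multi_taylor_self)
  next
    case (insert k S)
    have *: "u (insert k S) = u S + (y $ k - x $ k) *\<^sub>R axis k 1"
      using insert by (auto simp: u_def vec_eq_iff axis_def)
    have "\<bar>g (u (insert k S)) - g (u S)\<bar> \<le> B * \<bar>y $ k - x $ k\<bar>"
      unfolding * by (rule step) (use u[of "insert k S"] u[of S] in \<open>simp_all add: * \<close>)
    also have "\<dots> \<le> B * b" using abs_component_le_infnorm[of "y - x" k] B0 by (simp add: b_def mult_left_mono)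
    finally show ?case using insert by (simp add: algebra_simps)
  qed
  from this[of UNIV] have "\<bar>g y\<bar> \<le> real CARD('d) * (B * b)"
    by (simp add: u_def)
  moreover have "f y = D (\<lambda>_. 0) y" using Suc.prems by (simp add: partial_derivs_def)
  ultimately show ?case by (simp add: g_def B_def algebra_simps b_def)
qed

section \<open>Maximal inequalities\<close>

text \<open>Log-sum-exp with inverse temperature \<open>l\<close>: a smooth upper bound of the
  maximum, too large by at most \<open>ln (card K) / l\<close>.\<close>

definition softmax :: "real \<Rightarrow> 'k set \<Rightarrow> ('k \<Rightarrow> real) \<Rightarrow> real" where
  "softmax l K s = ln (\<Sum>k\<in>K. exp (l * s k)) / l"

text \<open>The Gibbs weights, which form the gradient of \<open>softmax\<close> in
  \<open>s\<close>.\<close>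

definition softmax_weight :: "real \<Rightarrow> 'k set \<Rightarrow> ('k \<Rightarrow> real) \<Rightarrow> 'k \<Rightarrow> real" where
  "softmax_weight l K s k = exp (l * s k) / (\<Sum>i\<in>K. exp (l * s i))"

lemma exp_le_quadratic:
  fixes y :: real
  assumes "\<bar>y\<bar> \<le> 1"
  shows "exp y \<le> 1 + y + y\<^sup>2"
proof (cases "0 \<le> y")
  case True
  then show ?thesis using assms exp_bound[of y] by simp
next
  case False
  \<comment> \<open>For negative \<open>y\<close>, multiplication by \<open>1 - y\<close> gives
    \<open>1 - y ^ 3\<close>, which is at least 1, and \<open>1 - y\<close> is at most
    \<open>exp (- y)\<close>.\<close>
  have "(1 + y + y\<^sup>2) * (1 - y) = 1 + y\<^sup>2 * (- y)"
    by (simp add: algebra_simps power2_eq_square)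
  moreover have "0 \<le> y\<^sup>2 * (- y)" using False by (intro mult_nonneg_nonneg) auto
  ultimately have "1 \<le> (1 + y + y\<^sup>2) * (1 - y)" by linarith
  also have "\<dots> \<le> (1 + y + y\<^sup>2) * exp (- y)"
    using exp_ge_add_one_self[of "- y"] assms by (intro mult_left_mono) auto
  finally show ?thesis by (simp add: exp_minus field_simps)
qed

lemma softmax_ge:
  assumes "finite K" "k \<in> K" "l > 0"
  shows "s k \<le> softmax l K s"
proof -
  have "exp (l * s k) \<le> (\<Sum>k\<in>K. exp (l * s k))"
    using assms by (intro member_le_sum) auto
  then have "l * s k \<le> ln (\<Sum>k\<in>K. exp (l * s k))"
    by (subst ln_ge_iff) (auto intro: less_le_trans[OF exp_gt_zero])
  then show ?thesis using assms by (simp add: softmax_def field_simps)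
qed

lemma softmax_le:
  assumes "finite K" "K \<noteq> {}" "l > 0" "\<And>k. k \<in> K \<Longrightarrow> s k \<le> b"
  shows "softmax l K s \<le> ln (real (card K)) / l + b"
proof -
  have "(\<Sum>k\<in>K. exp (l * s k)) \<le> real (card K) * exp (l * b)"
    using assms by (intro sum_bounded_above) auto
  moreover have "(\<Sum>k\<in>K. exp (l * s k)) > 0" using assms by (intro sum_pos) auto
  ultimately have "ln (\<Sum>k\<in>K. exp (l * s k)) \<le> ln (real (card K) * exp (l * b))"
    by (simp add: card_gt_0_iff assms)
  also have "\<dots> = ln (real (card K)) + l * b"
    using assms by (simp add: ln_mult card_gt_0_iff)
  finally show ?thesis using assms by (simp add: softmax_def field_simps)
qed

lemma softmax_weight_sum:
  assumes "finite K" "K \<noteq> {}"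
  shows "(\<Sum>k\<in>K. softmax_weight l K s k) = 1" "0 \<le> softmax_weight l K s k"
proof -
  have "(\<Sum>k\<in>K. exp (l * s k)) > 0" using assms by (intro sum_pos) auto
  then show "(\<Sum>k\<in>K. softmax_weight l K s k) = 1" "0 \<le> softmax_weight l K s k"
    by (auto simp: softmax_weight_def simp flip: sum_divide_distrib)
qed

lemma softmax_weight_le_1:
  assumes "finite K" "k \<in> K"
  shows "softmax_weight l K s k \<le> 1"
proof -
  have "exp (l * s k) \<le> (\<Sum>i\<in>K. exp (l * s i))"
    using assms by (intro member_le_sum) auto
  then show ?thesis by (simp add: softmax_weight_def divide_le_eq_1 less_le_trans[OF exp_gt_zero])
qed

text \<open>The increment of the soft maximum is \<open>ln W / l\<close>, where \<open>W\<close> is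
  the Gibbs average of \<open>exp (l * x k)\<close>. The bound holds without any restriction on
  \<open>l * b\<close>, so it can be applied with a random, unbounded \<open>b\<close> and no
  truncation.\<close>

lemma softmax_add_le:
  assumes K: "finite K" "K \<noteq> {}" and l: "l > 0" and b: "\<And>k. k \<in> K \<Longrightarrow> \<bar>x k\<bar> \<le> b"
  shows "softmax l K (\<lambda>k. s k + x k)
           \<le> softmax l K s + (\<Sum>k\<in>K. softmax_weight l K s k * x k) + 2 * l * b\<^sup>2"
proof -
  define S where "S = (\<Sum>k\<in>K. exp (l * s k))"
  define p where "p = softmax_weight l K s"
  define m where "m = (\<Sum>k\<in>K. p k * x k)"
  define W where "W = (\<Sum>k\<in>K. p k * exp (l * x k))"
  have S: "S > 0" unfolding S_def using K by (intro sum_pos) auto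
  have p: "(\<Sum>k\<in>K. p k) = 1" "\<And>k. p k \<ge> 0" using softmax_weight_sum[OF K] by (auto simp: p_def)
  have "(\<Sum>k\<in>K. exp (l * (s k + x k))) = S * W"
    using S by (simp add: W_def p_def softmax_weight_def sum_distrib_left S_def[symmetric] distrib_left exp_add)
  moreover have "(\<Sum>k\<in>K. exp (l * (s k + x k))) > 0" using K by (intro sum_pos) auto
  ultimately have W: "W > 0" and eq: "ln (\<Sum>k\<in>K. exp (l * (s k + x k))) = ln S + ln W"
    using S by (auto simp: ln_mult zero_less_mult_iff)
  have b0: "b \<ge> 0" using K b by fastforce
  have "\<bar>m\<bar> \<le> (\<Sum>k\<in>K. p k * b)"
    unfolding m_def using p(2) b by (intro order_trans[OF sum_abs] sum_mono) (auto simp: abs_mult intro!: mult_left_mono)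
  then have mb: "\<bar>m\<bar> \<le> b" using p by (simp flip: sum_distrib_right)
  have "ln W \<le> l * m + 2 * (l * b)\<^sup>2"
  proof (cases "l * b \<le> 1")
    case True
    have "W \<le> (\<Sum>k\<in>K. p k * (1 + l * x k + (l * b)\<^sup>2))" unfolding W_def
    proof (intro sum_mono mult_left_mono p(2))
      fix k assume k: "k \<in> K"
      have *: "\<bar>l * x k\<bar> \<le> l * b" using b[OF k] l by (simp add: abs_mult)
      then have "exp (l * x k) \<le> 1 + l * x k + (l * x k)\<^sup>2" using True by (intro exp_le_quadratic) auto
      also have "(l * x k)\<^sup>2 \<le> (l * b)\<^sup>2" using * b0 l by (intro abs_le_square_iff[THEN iffD1]) simp
      finally show "exp (l * x k) \<le> 1 + l * x k + (l * b)\<^sup>2" by simp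
    qed
    also have "\<dots> = (\<Sum>k\<in>K. p k) * (1 + (l * b)\<^sup>2) + l * m"
      by (simp add: m_def sum_distrib_left sum_distrib_right sum.distrib algebra_simps)
    finally have "W \<le> 1 + (l * b)\<^sup>2 + l * m" using p by simp
    then have "ln W \<le> (l * b)\<^sup>2 + l * m" using ln_le_minus_one[OF W] by linarith
    then show ?thesis using zero_le_power2[of "l * b"] by linarith
  \<comment> \<open>Outside the range of the quadratic bound, \<open>ln W\<close> and
    \<open>- l * m\<close> are each at most \<open>l * b\<close>, and \<open>l * b\<close> is below
    its square; this is the source of the factor 2.\<close>
  next
    case False
    have "W \<le> (\<Sum>k\<in>K. p k * exp (l * b))" unfolding W_def
      using b l by (intro sum_mono mult_left_mono p(2)) (auto dest!: b intro!: mult_left_mono)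
    then have "W \<le> exp (l * b)" using p by (simp flip: sum_distrib_right)
    then have "ln W \<le> l * b" using W by (metis ln_exp ln_le_cancel_iff exp_gt_zero)
    moreover have "- (l * b) \<le> l * m" using mb l by (metis abs_le_iff mult_le_cancel_left_pos mult_minus_right minus_le_iff)
    moreover have "l * b \<le> (l * b)\<^sup>2" using False by (intro self_le_power) auto
    ultimately show ?thesis by linarith
  qed
  then have "ln W / l \<le> (l * m + 2 * (l * b)\<^sup>2) / l" using l by (intro divide_right_mono) auto
  also have "\<dots> = m + 2 * l * b\<^sup>2" using l by (simp add: field_simps power2_eq_square)
  finally show ?thesis unfolding softmax_def eq
    by (simp add: S_def m_def p_def add_divide_distrib)
qed

text \<open>Supplies the integrable majorant for \<open>integrable_softmax\<close>.\<close>

lemma abs_softmax_le: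
  assumes "finite K" "K \<noteq> {}" "l > 0"
  shows "\<bar>softmax l K s\<bar> \<le> ln (real (card K)) / l + (\<Sum>k\<in>K. \<bar>s k\<bar>)"
proof -
  have 1: "\<bar>s k\<bar> \<le> (\<Sum>k\<in>K. \<bar>s k\<bar>)" if "k \<in> K" for k
    using assms that by (intro member_le_sum) auto
  then have "softmax l K s \<le> ln (real (card K)) / l + (\<Sum>k\<in>K. \<bar>s k\<bar>)"
    using assms by (intro softmax_le) (force dest!: 1)+
  moreover obtain k where k: "k \<in> K" using assms by auto
  moreover have "- \<bar>s k\<bar> \<le> softmax l K s" using softmax_ge[OF assms(1) k assms(3), of s] by linarith
  moreover have "0 \<le> ln (real (card K)) / l"
    using assms by (auto intro!: divide_nonneg_pos simp: Suc_le_eq card_gt_0_iff ln_ge_zero)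
  ultimately show ?thesis using 1[OF k] by linarith
qed

lemma (in finite_measure) integrable_softmax:
  assumes "finite K" "K \<noteq> {}" "l > 0" "\<And>k. k \<in> K \<Longrightarrow> integrable M (S k)"
  shows "integrable M (\<lambda>\<omega>. softmax l K (\<lambda>k. S k \<omega>))"
proof (rule Bochner_Integration.integrable_bound)
  show "integrable M (\<lambda>\<omega>. ln (real (card K)) / l + (\<Sum>k\<in>K. \<bar>S k \<omega>\<bar>))"
    using assms(4) by auto
  show "AE \<omega> in M. norm (softmax l K (\<lambda>k. S k \<omega>)) \<le> norm (ln (real (card K)) / l + (\<Sum>k\<in>K. \<bar>S k \<omega>\<bar>))"
    using abs_softmax_le[OF assms(1-3)] by (auto intro!: AE_I2 order_trans[OF _ abs_ge_self])
  note [measurable] = borel_measurable_integrable[OF assms(4)]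
  show "(\<lambda>\<omega>. softmax l K (\<lambda>k. S k \<omega>)) \<in> borel_measurable M"
    unfolding softmax_def by measurable
qed

text \<open>
  The linear term in the expansion of the soft maximum has mean zero, by independence. Hence second
  moments of the increments suffice, and no symmetrization is needed.
\<close>

lemma (in prob_space) expectation_softmax_sum_le:
  fixes X :: "'i \<Rightarrow> 'k \<Rightarrow> 'a \<Rightarrow> real"
  assumes K: "finite K" "K \<noteq> {}" and l: "l > 0" and I: "finite I"
    and ind: "indep_vars (\<lambda>_. PiM K (\<lambda>_. borel)) (\<lambda>i \<omega>. \<lambda>k\<in>K. X i k \<omega>) I"
    and int: "\<And>i k. i \<in> I \<Longrightarrow> k \<in> K \<Longrightarrow> integrable M (X i k)"
    and mean: "\<And>i k. i \<in> I \<Longrightarrow> k \<in> K \<Longrightarrow> expectation (X i k) = 0"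
    and b: "\<And>i. i \<in> I \<Longrightarrow> integrable M (b i)" "\<And>i. i \<in> I \<Longrightarrow> expectation (b i) \<le> B"
    and X: "\<And>i k \<omega>. i \<in> I \<Longrightarrow> k \<in> K \<Longrightarrow> (X i k \<omega>)\<^sup>2 \<le> b i \<omega>"
  shows "expectation (\<lambda>\<omega>. softmax l K (\<lambda>k. \<Sum>i\<in>I. X i k \<omega>))
           \<le> ln (real (card K)) / l + 2 * l * real (card I) * B"
  using I ind int mean b X
proof (induction I)
  \<comment> \<open>The soft maximum of the zero vector is exactly \<open>ln (card K) / l\<close>.
    This start value is the whole price paid for the number of indices.\<close>
  case empty
  then show ?case using l by (simp add: softmax_def prob_space)
next
  case (insert i I)
  define S where "S = (\<lambda>k \<omega>. \<Sum>i\<in>I. X i k \<omega>)"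
  note [measurable] = borel_measurable_integrable[OF insert.prems(2)]
  have S[measurable]: "integrable M (S k)" if "k \<in> K" for k
    unfolding S_def using that insert.prems(2) by auto
  have zero: "integrable M (\<lambda>\<omega>. softmax_weight l K (\<lambda>k. S k \<omega>) k * X i k \<omega>)"
       "expectation (\<lambda>\<omega>. softmax_weight l K (\<lambda>k. S k \<omega>) k * X i k \<omega>) = 0" if k: "k \<in> K" for k
  proof -
    \<comment> \<open>The Gibbs weights are functions of the earlier vectors, hence independent of
      the new one.\<close>
    have *: "indep_var
        (PiM I (\<lambda>_. PiM K (\<lambda>_. borel))) (\<lambda>\<omega>. \<lambda>i\<in>I. \<lambda>k\<in>K. X i k \<omega>)
        (PiM {i} (\<lambda>_. PiM K (\<lambda>_. borel))) (\<lambda>\<omega>. \<lambda>i\<in>{i}. \<lambda>k\<in>K. X i k \<omega>)"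
      using insert by (intro indep_var_restrict[OF insert.prems(1)]) auto
    have "indep_var
        borel ((\<lambda>z. softmax_weight l K (\<lambda>k. \<Sum>i\<in>I. z i k) k) \<circ> (\<lambda>\<omega>. \<lambda>i\<in>I. \<lambda>k\<in>K. X i k \<omega>))
        borel ((\<lambda>z. z i k) \<circ> (\<lambda>\<omega>. \<lambda>i\<in>{i}. \<lambda>k\<in>K. X i k \<omega>))"
    proof (rule indep_var_compose[OF *])
      have [measurable]: "(\<lambda>z. z i k) \<in> borel_measurable (PiM J (\<lambda>_. PiM K (\<lambda>_. borel)))"
        if "i \<in> J" "k \<in> K" for i k J
        by (rule measurable_compose[OF measurable_component_singleton[OF that(1), where M = "\<lambda>_. PiM K (\<lambda>_. borel)"]
              measurable_component_singleton[OF that(2)]])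
      show "(\<lambda>z. softmax_weight l K (\<lambda>k. \<Sum>i\<in>I. z i k) k) \<in> borel_measurable (PiM I (\<lambda>_. PiM K (\<lambda>_. borel)))"
        unfolding softmax_weight_def using k by measurable
      show "(\<lambda>z. z i k) \<in> borel_measurable (PiM {i} (\<lambda>_. PiM K (\<lambda>_. borel)))"
        using k by measurable
    qed
    also have "(\<lambda>z. softmax_weight l K (\<lambda>k. \<Sum>i\<in>I. z i k) k) \<circ> (\<lambda>\<omega>. \<lambda>i\<in>I. \<lambda>k\<in>K. X i k \<omega>)
        = (\<lambda>\<omega>. softmax_weight l K (\<lambda>k. S k \<omega>) k)"
      using k by (auto simp: fun_eq_iff softmax_weight_def S_def)
    also have "(\<lambda>z. z i k) \<circ> (\<lambda>\<omega>. \<lambda>i\<in>{i}. \<lambda>k\<in>K. X i k \<omega>) = X i k"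
      using k by (auto simp: fun_eq_iff)
    finally have iv: "indep_var borel (\<lambda>\<omega>. softmax_weight l K (\<lambda>k. S k \<omega>) k) borel (X i k)" .
    have "integrable M (\<lambda>\<omega>. softmax_weight l K (\<lambda>k. S k \<omega>) k)"
    proof (rule integrable_const_bound)
      show "(\<lambda>\<omega>. softmax_weight l K (\<lambda>k. S k \<omega>) k) \<in> borel_measurable M"
        using k S unfolding softmax_weight_def by measurable
      show "AE \<omega> in M. norm (softmax_weight l K (\<lambda>k. S k \<omega>) k) \<le> 1"
        using softmax_weight_le_1[OF K(1) k] softmax_weight_sum(2)[OF K] by (auto intro!: AE_I2)
    qed
    from this insert.prems(2)[of i k] k show
      "integrable M (\<lambda>\<omega>. softmax_weight l K (\<lambda>k. S k \<omega>) k * X i k \<omega>)"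
      "expectation (\<lambda>\<omega>. softmax_weight l K (\<lambda>k. S k \<omega>) k * X i k \<omega>) = 0"
      using indep_var_integrable[OF iv] indep_var_lebesgue_integral[OF iv] insert.prems(3)[of i k] by auto
  qed
  have "expectation (\<lambda>\<omega>. softmax l K (\<lambda>k. \<Sum>i\<in>insert i I. X i k \<omega>))
      \<le> expectation (\<lambda>\<omega>. softmax l K (\<lambda>k. S k \<omega>)
           + (\<Sum>k\<in>K. softmax_weight l K (\<lambda>k. S k \<omega>) k * X i k \<omega>) + 2 * l * b i \<omega>)"
  proof (rule integral_mono)
    show "integrable M (\<lambda>\<omega>. softmax l K (\<lambda>k. \<Sum>i\<in>insert i I. X i k \<omega>))"
      using insert.prems(2) by (intro integrable_softmax K l Bochner_Integration.integrable_sum) auto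
    show "integrable M (\<lambda>\<omega>. softmax l K (\<lambda>k. S k \<omega>)
           + (\<Sum>k\<in>K. softmax_weight l K (\<lambda>k. S k \<omega>) k * X i k \<omega>) + 2 * l * b i \<omega>)"
      using zero(1) S insert.prems(4) 
      by (intro Bochner_Integration.integrable_add integrable_softmax K l Bochner_Integration.integrable_sum) auto
    fix \<omega> assume "\<omega> \<in> space M"
    obtain k where k: "k \<in> K" using K by auto
    have "b i \<omega> \<ge> 0" using insert.prems(6)[of i k \<omega>] k by (intro order_trans[OF zero_le_power2]) auto
    \<comment> \<open>With the random bound \<open>sqrt (b i \<omega>)\<close> on the increment, the
      quadratic error becomes a multiple of \<open>b i\<close>, whose mean is controlled.\<close>
    moreover have "\<bar>X i k \<omega>\<bar> \<le> sqrt (b i \<omega>)" if "k \<in> K" for k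
      using insert.prems(6)[of i k \<omega>] that by (simp add: real_le_rsqrt)
    ultimately show "softmax l K (\<lambda>k. \<Sum>i\<in>insert i I. X i k \<omega>) \<le> softmax l K (\<lambda>k. S k \<omega>)
           + (\<Sum>k\<in>K. softmax_weight l K (\<lambda>k. S k \<omega>) k * X i k \<omega>) + 2 * l * b i \<omega>"
      using softmax_add_le[OF K l, of "\<lambda>k. X i k \<omega>" "sqrt (b i \<omega>)" "\<lambda>k. S k \<omega>"] insert.hyps
      by (simp add: S_def add.commute)
  qed
  also have "\<dots> = expectation (\<lambda>\<omega>. softmax l K (\<lambda>k. S k \<omega>))
           + (\<Sum>k\<in>K. expectation (\<lambda>\<omega>. softmax_weight l K (\<lambda>k. S k \<omega>) k * X i k \<omega>)) + 2 * l * expectation (b i)"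
    using zero(1) S insert.prems(4) by (simp add: integrable_softmax K l)
  also have "\<dots> \<le> (ln (real (card K)) / l + 2 * l * real (card I) * B) + 0 + 2 * l * B"
  proof (intro add_mono)
    show "expectation (\<lambda>\<omega>. softmax l K (\<lambda>k. S k \<omega>)) \<le> ln (real (card K)) / l + 2 * l * real (card I) * B"
      unfolding S_def using insert.prems indep_vars_subset[OF insert.prems(1) subset_insertI]
      by (intro insert.IH) auto
  qed (use zero(2) insert.prems(5) l in auto)
  also have "\<dots> = ln (real (card K)) / l + 2 * l * real (card (insert i I)) * B"
    using insert.hyps by (simp add: algebra_simps)
  finally show ?case .
qed

text \<open>The moment condition is put on an envelope \<open>b i\<close> that dominates the squares
  of all coordinates of one vector at once. The number of coordinates then enters through a
  logarithm, as it does for sub-Gaussian variables.\<close>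

lemma (in prob_space) maximal_inequality:
  fixes X :: "'i \<Rightarrow> 'k \<Rightarrow> 'a \<Rightarrow> real"
  assumes K: "finite K" "K \<noteq> {}" and I: "finite I" "I \<noteq> {}" and B: "B > 0"
    and ind: "indep_vars (\<lambda>_. PiM K (\<lambda>_. borel)) (\<lambda>i \<omega>. \<lambda>k\<in>K. X i k \<omega>) I"
    and int: "\<And>i k. i \<in> I \<Longrightarrow> k \<in> K \<Longrightarrow> integrable M (X i k)"
    and mean: "\<And>i k. i \<in> I \<Longrightarrow> k \<in> K \<Longrightarrow> expectation (X i k) = 0"
    and b: "\<And>i. i \<in> I \<Longrightarrow> integrable M (b i)" "\<And>i. i \<in> I \<Longrightarrow> expectation (b i) \<le> B"
    and X: "\<And>i k \<omega>. i \<in> I \<Longrightarrow> k \<in> K \<Longrightarrow> (X i k \<omega>)\<^sup>2 \<le> b i \<omega>"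
  shows "(\<integral>\<^sup>+\<omega>. ennreal (Max ((\<lambda>k. \<bar>\<Sum>i\<in>I. X i k \<omega>\<bar>) ` K)) \<partial>M)
           \<le> ennreal (2 * sqrt (2 * ln (2 * real (card K)) * real (card I) * B))"
proof -
  \<comment> \<open>Both signs are indexed, so that the soft maximum controls absolute values. This
    causes the 2 in the logarithm, which also keeps the logarithm positive for a single
    index.\<close>
  define K' where "K' = K \<times> (UNIV :: bool set)"
  define Y where "Y i = (\<lambda>(k, s) \<omega>. if s then X i k \<omega> else - X i k \<omega>)" for i
  define c where "c = ln (real (card K'))"
  define n where "n = real (card I)"
  \<comment> \<open>The minimizer of \<open>c / l + 2 * l * n * B\<close>, at which both terms
    coincide.\<close>
  define l where "l = sqrt (c / (2 * n * B))"
  define F where "F \<omega> = softmax l K' (\<lambda>k. \<Sum>i\<in>I. Y i k \<omega>)" for \<omega>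
  have K': "finite K'" "K' \<noteq> {}" "card K' = 2 * card K" using K by (auto simp: K'_def card_cartesian_product)
  have "card K > 0" using K by (simp add: card_gt_0_iff)
  then have c: "c > 0" unfolding c_def by (subst ln_gt_zero_iff) (auto simp: K')
  have n: "n > 0" using I by (simp add: n_def card_gt_0_iff)
  have l: "l > 0" using c n B by (simp add: l_def)
  have intY: "integrable M (Y i k)" if "i \<in> I" "k \<in> K'" for i k
    using int[of i "fst k"] that by (cases k; cases "snd k") (auto simp: Y_def K'_def)
  have indY: "indep_vars (\<lambda>_. PiM K' (\<lambda>_. borel)) (\<lambda>i \<omega>. \<lambda>k\<in>K'. Y i k \<omega>) I"
  proof -
    have "indep_vars (\<lambda>_. PiM K' (\<lambda>_. borel))
       (\<lambda>i \<omega>. (\<lambda>z. \<lambda>(k, s)\<in>K'. if s then z k else - z k) (\<lambda>k\<in>K. X i k \<omega>)) I"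
    proof (rule indep_vars_compose2[OF ind])
      show "(\<lambda>z. \<lambda>(k, s)\<in>K'. if s then z k else - z k) \<in> PiM K (\<lambda>_. borel) \<rightarrow>\<^sub>M PiM K' (\<lambda>_. borel :: real measure)"
      proof (rule measurable_restrict)
        fix ks assume "ks \<in> K'"
        then have k: "fst ks \<in> K" by (auto simp: K'_def)
        show "(\<lambda>z. case ks of (k, s) \<Rightarrow> if s then z k else - z k) \<in> borel_measurable (PiM K (\<lambda>_. borel :: real measure))"
          using k by (cases ks; cases "snd ks") auto
      qed
    qed
    also have "(\<lambda>i \<omega>. (\<lambda>z. \<lambda>(k, s)\<in>K'. if s then z k else - z k) (\<lambda>k\<in>K. X i k \<omega>)) = (\<lambda>i \<omega>. \<lambda>k\<in>K'. Y i k \<omega>)"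
      by (auto simp: fun_eq_iff Y_def K'_def restrict_def)
    finally show ?thesis .
  qed
  have E: "expectation F \<le> c / l + 2 * l * n * B"
    unfolding F_def c_def n_def
  proof (rule expectation_softmax_sum_le[OF K'(1,2) l I(1) indY intY _ b])
    show "expectation (Y i k) = 0" if "i \<in> I" "k \<in> K'" for i k
      using mean[of i "fst k"] that by (cases k; cases "snd k") (auto simp: Y_def K'_def)
    show "(Y i k \<omega>)\<^sup>2 \<le> b i \<omega>" if "i \<in> I" "k \<in> K'" for i k \<omega>
      using X[of i "fst k" \<omega>] that by (cases k) (auto simp: Y_def K'_def)
  qed
  have F: "\<bar>\<Sum>i\<in>I. X i k \<omega>\<bar> \<le> F \<omega>" if "k \<in> K" for k \<omega>
    using softmax_ge[OF K'(1) _ l, of "(k, True)" "\<lambda>k. \<Sum>i\<in>I. Y i k \<omega>"]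
      softmax_ge[OF K'(1) _ l, of "(k, False)" "\<lambda>k. \<Sum>i\<in>I. Y i k \<omega>"] that
    by (simp add: K'_def F_def Y_def sum_negf)
  obtain k where "k \<in> K" using K by auto
  then have F0: "F \<omega> \<ge> 0" for \<omega> using F[of k \<omega>] by linarith
  have "integrable M F"
    unfolding F_def by (intro integrable_softmax K' l Bochner_Integration.integrable_sum intY)
  then have "(\<integral>\<^sup>+\<omega>. ennreal (F \<omega>) \<partial>M) = ennreal (expectation F)"
    using F0 by (intro nn_integral_eq_integral) auto
  also have "\<dots> \<le> ennreal (c / l + 2 * l * n * B)" by (intro ennreal_leI E)
  also have "c / l + 2 * l * n * B = 2 * sqrt (2 * c * n * B)"
  proof -
    have q: "l * l = c / (2 * n * B)" using c n B by (simp add: l_def)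
    have "c / l = 2 * l * n * B"
      using q l n B by (simp add: field_simps)
    moreover have "sqrt (2 * c * n * B) = 2 * l * n * B"
      using q l n B by (intro real_sqrt_unique) (auto simp: power2_eq_square field_simps)
    ultimately show ?thesis by simp
  qed
  finally have "(\<integral>\<^sup>+\<omega>. ennreal (F \<omega>) \<partial>M) \<le> ennreal (2 * sqrt (2 * c * n * B))" .
  moreover have "(\<integral>\<^sup>+\<omega>. ennreal (Max ((\<lambda>k. \<bar>\<Sum>i\<in>I. X i k \<omega>\<bar>) ` K)) \<partial>M) \<le> (\<integral>\<^sup>+\<omega>. ennreal (F \<omega>) \<partial>M)"
    using K F by (intro nn_integral_mono ennreal_leI) auto
  ultimately show ?thesis by (simp add: c_def n_def K')
qed

section \<open>Sub-Gaussian variables\<close>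

lemma sub_gaussian_norm_mgf:
  assumes "sub_gaussian_norm P \<le> ennreal b" "0 \<le> b" "b < s"
  shows "(\<integral>\<^sup>+u. ennreal (exp (v * u)) \<partial>P) \<le> ennreal (exp (v\<^sup>2 * s / 2))"
proof -
  \<comment> \<open>The strict gap between \<open>b\<close> and \<open>s\<close> yields an
    admissible proxy below \<open>s\<close> even if the infimum is not attained.\<close>
  have "sub_gaussian_norm P < ennreal s"
    using assms by (auto intro: le_less_trans simp: ennreal_less_iff)
  then obtain r where r: "0 \<le> r" "\<And>v. (\<integral>\<^sup>+u. ennreal (exp (v * u)) \<partial>P) \<le> ennreal (exp (v\<^sup>2 * r / 2))"
      "ennreal r < ennreal s"
    unfolding sub_gaussian_norm_def INF_less_iff by auto
  have "r \<le> s" using r(1,3) by (simp add: ennreal_less_iff)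
  then have "ennreal (exp (v\<^sup>2 * r / 2)) \<le> ennreal (exp (v\<^sup>2 * s / 2))"
    by (intro ennreal_leI) (simp add: mult_left_mono)
  then show ?thesis using r(2)[of v] by (rule order_trans[rotated])
qed

text \<open>
  The logarithm in the usual argument is replaced by one of its tangents, so that no Jensen
  inequality is needed.
\<close>

lemma (in prob_space) maximal_inequality_sub_gaussian:
  fixes X :: "'i \<Rightarrow> 'a \<Rightarrow> real" and a :: "'k \<Rightarrow> 'i \<Rightarrow> real"
  assumes K: "finite K" "K \<noteq> {}" and I: "finite I"
    and ind: "indep_vars (\<lambda>_. borel) X I"
    and mgf: "\<And>i v. i \<in> I \<Longrightarrow> (\<integral>\<^sup>+\<omega>. ennreal (exp (v * X i \<omega>)) \<partial>M) \<le> ennreal (exp (v\<^sup>2 * s / 2))"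
    and V: "\<And>k. k \<in> K \<Longrightarrow> (\<Sum>i\<in>I. (a k i)\<^sup>2) \<le> V" and pos: "0 < V" "0 < s"
  shows "(\<integral>\<^sup>+\<omega>. ennreal (Max ((\<lambda>k. \<bar>\<Sum>i\<in>I. a k i * X i \<omega>\<bar>) ` K)) \<partial>M)
           \<le> ennreal (4 * sqrt (s * V * ln (2 * real (card K))))"
proof -
  have X [measurable]: "X i \<in> borel_measurable M" if "i \<in> I" for i
    using ind that by (auto simp: indep_vars_def)
  define N where "N = 2 * real (card K)"
  have "card K > 0" using K by (simp add: card_gt_0_iff)
  then have N: "N \<ge> 2" by (simp add: N_def)
  have "ln N \<ge> ln 2" using N by simp
  \<comment> \<open>This lets the summand \<open>1 / l\<close> be absorbed at the end:
    \<open>1 + 3 / 2 * ln N\<close> is at most \<open>4 * ln N\<close>.\<close>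
  then have lnN: "ln N \<ge> 1 / 2" using ln2_ge_two_thirds by linarith
  define l where "l = sqrt (ln N / (s * V))"
  have l: "l > 0" using lnN pos by (simp add: l_def)
  have l2: "l\<^sup>2 * (s * V) = ln N" using lnN pos by (simp add: l_def)
  define S where "S k \<omega> = (\<Sum>i\<in>I. a k i * X i \<omega>)" for k \<omega>
  have S [measurable]: "S k \<in> borel_measurable M" for k unfolding S_def by measurable
  \<comment> \<open>\<open>C\<close> bounds the mean of the exponential sum \<open>U\<close> below,
    and it is the point at which the logarithm is linearized. With this \<open>l\<close> it equals
    \<open>N powr (3 / 2)\<close>.\<close>
  define C where "C = N * exp (l\<^sup>2 * (s * V) / 2)"
  have C: "C > 0" "ln C = 3 / 2 * ln N" using N by (auto simp: C_def ln_mult l2)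
  have mgfS: "(\<integral>\<^sup>+\<omega>. ennreal (exp (v * S k \<omega>)) \<partial>M) \<le> ennreal (exp (v\<^sup>2 * (s * V) / 2))" if k: "k \<in> K" for k v
  proof -
    have "(\<integral>\<^sup>+\<omega>. ennreal (exp (v * S k \<omega>)) \<partial>M) = (\<integral>\<^sup>+\<omega>. (\<Prod>i\<in>I. ennreal (exp (v * a k i * X i \<omega>))) \<partial>M)"
      using I by (simp add: S_def sum_distrib_left exp_sum prod_ennreal mult.assoc)
    also have "\<dots> = (\<Prod>i\<in>I. \<integral>\<^sup>+\<omega>. ennreal (exp (v * a k i * X i \<omega>)) \<partial>M)"
    proof (rule indep_vars_nn_integral[OF I])
      show "indep_vars (\<lambda>_. borel) (\<lambda>i \<omega>. ennreal (exp (v * a k i * X i \<omega>))) I"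
        by (rule indep_vars_compose2[OF ind, where Y = "\<lambda>i x. ennreal (exp (v * a k i * x))"]) measurable
    qed simp
    also have "\<dots> \<le> (\<Prod>i\<in>I. ennreal (exp ((v * a k i)\<^sup>2 * s / 2)))"
      by (intro prod_mono_ennreal mgf)
    also have "\<dots> = ennreal (exp (v\<^sup>2 * (s * (\<Sum>i\<in>I. (a k i)\<^sup>2)) / 2))"
      using I by (simp add: prod_ennreal exp_sum[symmetric] sum_distrib_left sum_divide_distrib power_mult_distrib mult_ac)
    also have "\<dots> \<le> ennreal (exp (v\<^sup>2 * (s * V) / 2))"
      using V[OF k] pos by (intro ennreal_leI) (simp add: mult_left_mono divide_right_mono)
    finally show ?thesis .
  qed
  define U where "U \<omega> = (\<Sum>k\<in>K. ennreal (exp (l * S k \<omega>)) + ennreal (exp (- l * S k \<omega>)))" for \<omega>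
  have "(\<integral>\<^sup>+\<omega>. U \<omega> \<partial>M) = (\<Sum>k\<in>K. (\<integral>\<^sup>+\<omega>. ennreal (exp (l * S k \<omega>)) \<partial>M) + (\<integral>\<^sup>+\<omega>. ennreal (exp (- l * S k \<omega>)) \<partial>M))"
    unfolding U_def by (simp add: nn_integral_sum nn_integral_add)
  also have "\<dots> \<le> (\<Sum>k\<in>K. ennreal (exp (l\<^sup>2 * (s * V) / 2)) + ennreal (exp ((- l)\<^sup>2 * (s * V) / 2)))"
    by (intro sum_mono add_mono mgfS)
  also have "\<dots> = ennreal C"
    by (simp add: C_def N_def ennreal_of_nat_eq_real_of_nat flip: ennreal_plus ennreal_mult)
  finally have U: "(\<integral>\<^sup>+\<omega>. U \<omega> \<partial>M) \<le> ennreal C" .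
  have pointwise: "ennreal \<bar>S k \<omega>\<bar> \<le> ennreal (1 / (l * C)) * U \<omega> + ennreal (ln C / l)" if k: "k \<in> K" for k \<omega>
  proof -
    define u where "u = (\<Sum>k\<in>K. exp (l * S k \<omega>) + exp (- l * S k \<omega>))"
    have "exp (l * S k \<omega>) + exp (- l * S k \<omega>) \<le> u"
      unfolding u_def using K k by (intro member_le_sum) (auto intro: add_nonneg_nonneg)
    moreover have "exp (l * \<bar>S k \<omega>\<bar>) \<le> exp (l * S k \<omega>) + exp (- l * S k \<omega>)" by (cases "S k \<omega> \<ge> 0") auto
    ultimately have e: "exp (l * \<bar>S k \<omega>\<bar>) \<le> u" by linarith
    then have u: "u > 0" using exp_gt_zero by (rule less_le_trans[rotated])
    have "l * \<bar>S k \<omega>\<bar> \<le> ln u" using e u by (simp add: ln_ge_iff)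
    also have "ln u = ln (u / C) + ln C" using u C by (simp add: ln_div)
    also have "\<dots> \<le> u / C + ln C" using ln_le_minus_one[of "u / C"] u C by simp
    finally have "\<bar>S k \<omega>\<bar> \<le> 1 / (l * C) * u + ln C / l" using l C(1) by (simp add: field_simps)
    then have "ennreal \<bar>S k \<omega>\<bar> \<le> ennreal (1 / (l * C) * u + ln C / l)" by (rule ennreal_leI)
    also have "\<dots> = ennreal (1 / (l * C)) * ennreal u + ennreal (ln C / l)"
    proof -
      have "0 \<le> ln C / l" "0 \<le> 1 / (l * C) * u" "0 \<le> 1 / (l * C)" using l C(1) lnN u by (auto simp: C(2))
      then show ?thesis by (simp only: ennreal_plus ennreal_mult')
    qed
    also have "ennreal u = U \<omega>" unfolding u_def U_def by (simp add: add_nonneg_nonneg flip: ennreal_plus)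
    finally show ?thesis .
  qed
  have "(\<integral>\<^sup>+\<omega>. ennreal (Max ((\<lambda>k. \<bar>S k \<omega>\<bar>) ` K)) \<partial>M) \<le> (\<integral>\<^sup>+\<omega>. ennreal (1 / (l * C)) * U \<omega> + ennreal (ln C / l) \<partial>M)"
  proof (rule nn_integral_mono)
    fix \<omega>
    have "Max ((\<lambda>k. \<bar>S k \<omega>\<bar>) ` K) \<in> (\<lambda>k. \<bar>S k \<omega>\<bar>) ` K" using K by (intro Max_in) auto
    then show "ennreal (Max ((\<lambda>k. \<bar>S k \<omega>\<bar>) ` K)) \<le> ennreal (1 / (l * C)) * U \<omega> + ennreal (ln C / l)"
      using pointwise by auto
  qed
  also have "\<dots> = ennreal (1 / (l * C)) * (\<integral>\<^sup>+\<omega>. U \<omega> \<partial>M) + ennreal (ln C / l)"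
    unfolding U_def by (simp add: nn_integral_add nn_integral_cmult emeasure_space_1)
  also have "\<dots> \<le> ennreal (1 / (l * C)) * ennreal C + ennreal (ln C / l)"
    by (intro add_mono mult_left_mono U) auto
  also have "\<dots> = ennreal (1 / l + 3 / 2 * ln N / l)"
    using l C(1) lnN by (simp add: C(2) ennreal_mult'[symmetric] ennreal_plus[symmetric] del: ennreal_plus)
  also have "\<dots> \<le> ennreal (4 * sqrt (s * V * ln N))"
  proof (rule ennreal_leI)
    have "1 / l + 3 / 2 * ln N / l \<le> 4 * ln N / l"
      using lnN l by (simp add: field_simps)
    also have "ln N / l = sqrt (s * V * ln N)"
    proof -
      have "sqrt (s * V * ln N) = l * (s * V)"
        using l pos by (intro real_sqrt_unique) (auto simp: power2_eq_square l2[symmetric])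
      also have "\<dots> = ln N / l" using l l2 by (simp add: field_simps power2_eq_square)
      finally show ?thesis by simp
    qed
    then have "4 * ln N / l = 4 * sqrt (s * V * ln N)" by simp
    finally show "1 / l + 3 / 2 * ln N / l \<le> 4 * sqrt (s * V * ln N)" .
  qed
  finally show ?thesis by (simp add: S_def N_def)
qed

section \<open>Averages of independent copies of a Hoelder continuous field\<close>

text \<open>Copies and original live on different spaces and share only their law on the product
  sigma-algebra. Therefore all statements are transferred through functionals that are measurable
  there; finite maxima are, whereas suprema over an uncountable \<open>T\<close> in general are
  not.\<close>

locale field_copies = prob_space M + N: prob_space N
  for M :: "'a measure" and N :: "'b measure" +
  fixes T :: "'x set" and n :: nat and Zs :: "nat \<Rightarrow> 'x \<Rightarrow> 'a \<Rightarrow> real" and Z :: "'x \<Rightarrow> 'b \<Rightarrow> real"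
  assumes n: "1 \<le> n"
    and ind: "indep_vars (\<lambda>_. \<Pi>\<^sub>M x\<in>T. borel) (\<lambda>i \<omega>. \<lambda>x\<in>T. Zs i x \<omega>) {1..n}"
    and distr: "\<And>i. i \<in> {1..n} \<Longrightarrow> distr M (\<Pi>\<^sub>M x\<in>T. borel) (\<lambda>\<omega>. \<lambda>x\<in>T. Zs i x \<omega>) =
                 distr N (\<Pi>\<^sub>M x\<in>T. borel) (\<lambda>\<omega>. \<lambda>x\<in>T. Z x \<omega>)"
    and measurable_field: "\<And>x. x \<in> T \<Longrightarrow> Z x \<in> borel_measurable N"
begin

abbreviation paths :: "('x \<Rightarrow> real) measure" where
  "paths \<equiv> \<Pi>\<^sub>M x\<in>T. borel"

lemma measurable_paths: "(\<lambda>\<omega>. \<lambda>x\<in>T. Z x \<omega>) \<in> N \<rightarrow>\<^sub>M paths"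
  using measurable_field by (intro measurable_restrict)

lemma measurable_copies: "i \<in> {1..n} \<Longrightarrow> (\<lambda>\<omega>. \<lambda>x\<in>T. Zs i x \<omega>) \<in> M \<rightarrow>\<^sub>M paths"
  using ind by (auto simp: indep_vars_def)

lemma measurable_copy:
  assumes "i \<in> {1..n}" "x \<in> T"
  shows "Zs i x \<in> borel_measurable M"
proof -
  have "(\<lambda>\<omega>. (\<lambda>x\<in>T. Zs i x \<omega>) x) \<in> borel_measurable M"
    using measurable_compose[OF measurable_copies[OF assms(1)] measurable_component_singleton[OF assms(2)]] .
  then show ?thesis using assms by simp
qed

text \<open>Both sides are integrals of \<open>G\<close> with respect to the common law of the
  paths.\<close>

lemma integral_copy:
  fixes G :: "('x \<Rightarrow> real) \<Rightarrow> real"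
  assumes "i \<in> {1..n}" "G \<in> borel_measurable paths"
  shows "integrable M (\<lambda>\<omega>. G (\<lambda>x\<in>T. Zs i x \<omega>)) \<longleftrightarrow> integrable N (\<lambda>\<omega>. G (\<lambda>x\<in>T. Z x \<omega>))"
    and "(\<integral>\<omega>. G (\<lambda>x\<in>T. Zs i x \<omega>) \<partial>M) = (\<integral>\<omega>. G (\<lambda>x\<in>T. Z x \<omega>) \<partial>N)"
  using integrable_distr_eq[OF measurable_copies[OF assms(1)] assms(2)]
    integrable_distr_eq[OF measurable_paths assms(2)]
    integral_distr[OF measurable_copies[OF assms(1)] assms(2)]
    integral_distr[OF measurable_paths assms(2)] distr[OF assms(1)] by auto

text \<open>The envelope is the maximum of the squares, again a functional of the path. All copies
  thus share the moment that is computed for \<open>Z\<close>.\<close>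

lemma maximal_inequality_copies:
  fixes G :: "'k \<Rightarrow> ('x \<Rightarrow> real) \<Rightarrow> real"
  assumes K: "finite K" "K \<noteq> {}" and B: "B > 0"
    and G: "\<And>k. k \<in> K \<Longrightarrow> G k \<in> borel_measurable paths"
    and int: "\<And>k. k \<in> K \<Longrightarrow> integrable N (\<lambda>\<omega>. G k (\<lambda>x\<in>T. Z x \<omega>))"
    and mean: "\<And>k. k \<in> K \<Longrightarrow> (\<integral>\<omega>. G k (\<lambda>x\<in>T. Z x \<omega>) \<partial>N) = 0"
    and bound: "(\<integral>\<^sup>+\<omega>. ennreal (Max ((\<lambda>k. (G k (\<lambda>x\<in>T. Z x \<omega>))\<^sup>2) ` K)) \<partial>N) \<le> ennreal B"
  shows "(\<integral>\<^sup>+\<omega>. ennreal (Max ((\<lambda>k. \<bar>\<Sum>i\<in>{1..n}. G k (\<lambda>x\<in>T. Zs i x \<omega>)\<bar>) ` K)) \<partial>M)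
           \<le> ennreal (2 * sqrt (2 * ln (2 * real (card K)) * real n * B))"
proof -
  define b where "b z = Max ((\<lambda>k. (G k z)\<^sup>2) ` K)" for z
  have b: "b \<in> borel_measurable paths"
    unfolding b_def using K G by (intro borel_measurable_Max borel_measurable_power) auto
  obtain k where k: "k \<in> K" using K by auto
  have Gb: "(G k z)\<^sup>2 \<le> b z" if "k \<in> K" for k z
    unfolding b_def using K that by simp
  then have b0: "0 \<le> b z" for z using k by (meson zero_le_power2 order_trans)
  have bN: "(\<integral>\<^sup>+\<omega>. ennreal (b (\<lambda>x\<in>T. Z x \<omega>)) \<partial>N) \<le> ennreal B"
    using bound by (simp add: b_def)
  have intb: "integrable N (\<lambda>\<omega>. b (\<lambda>x\<in>T. Z x \<omega>))"
  proof (rule integrableI_nonneg)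
    show "(\<lambda>\<omega>. b (\<lambda>x\<in>T. Z x \<omega>)) \<in> borel_measurable N"
      by (rule measurable_compose[OF measurable_paths, where g = b]) (simp add: b)
    show "(\<integral>\<^sup>+\<omega>. ennreal (b (\<lambda>x\<in>T. Z x \<omega>)) \<partial>N) < \<infinity>"
      using bN by (auto intro: le_less_trans)
  qed (use b0 in auto)
  have Eb: "(\<integral>\<omega>. b (\<lambda>x\<in>T. Z x \<omega>) \<partial>N) \<le> B"
    using bN B b0 by (subst (asm) nn_integral_eq_integral[OF intb]) auto
  have *: "(\<integral>\<^sup>+\<omega>. ennreal (Max ((\<lambda>k. \<bar>\<Sum>i\<in>{1..n}. G k (\<lambda>x\<in>T. Zs i x \<omega>)\<bar>) ` K)) \<partial>M)
           \<le> ennreal (2 * sqrt (2 * ln (2 * real (card K)) * real (card {1..n}) * B))"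
  proof (rule maximal_inequality[OF K _ _ B])
    have "(\<lambda>z. \<lambda>k\<in>K. G k z) \<in> paths \<rightarrow>\<^sub>M PiM K (\<lambda>_. borel)"
      by (rule measurable_restrict) (rule G)
    then have "indep_vars (\<lambda>_. PiM K (\<lambda>_. borel)) (\<lambda>i \<omega>. (\<lambda>_ z. \<lambda>k\<in>K. G k z) i (\<lambda>x\<in>T. Zs i x \<omega>)) {1..n}"
      by (rule indep_vars_compose2[OF ind])
    then show "indep_vars (\<lambda>_. PiM K (\<lambda>_. borel)) (\<lambda>i \<omega>. \<lambda>k\<in>K. G k (\<lambda>x\<in>T. Zs i x \<omega>)) {1..n}" .
    fix i assume i: "i \<in> {1..n}"
    show "integrable M (\<lambda>\<omega>. b (\<lambda>x\<in>T. Zs i x \<omega>))" "expectation (\<lambda>\<omega>. b (\<lambda>x\<in>T. Zs i x \<omega>)) \<le> B"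
      using integral_copy[OF i b] intb Eb by auto
    fix k assume k: "k \<in> K"
    show "integrable M (\<lambda>\<omega>. G k (\<lambda>x\<in>T. Zs i x \<omega>))" "expectation (\<lambda>\<omega>. G k (\<lambda>x\<in>T. Zs i x \<omega>)) = 0"
      using integral_copy[OF i G[OF k]] int[OF k] mean[OF k] by auto
  qed (use n Gb in auto)
  then show ?thesis by simp
qed

end

section \<open>Dyadic rounding and chaining\<close>

definition dyadic_round :: "nat \<Rightarrow> real ^ 'd::finite \<Rightarrow> real ^ 'd" where
  "dyadic_round l x = (\<chi> k. of_int \<lfloor>2 ^ l * x $ k\<rfloor> / 2 ^ l)"

lemma dyadic_round_in_cube:
  assumes "x \<in> unit_cube"
  shows "dyadic_round l x \<in> unit_cube"
  unfolding unit_cube_def mem_Collect_eq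
proof
  fix k
  have x: "0 \<le> x $ k" "x $ k \<le> 1" using assms by (auto simp: unit_cube_def)
  have "of_int \<lfloor>2 ^ l * x $ k\<rfloor> \<le> 2 ^ l * x $ k" by (rule of_int_floor_le)
  also have "\<dots> \<le> 2 ^ l" using x by simp
  finally have "of_int \<lfloor>2 ^ l * x $ k\<rfloor> / 2 ^ l \<le> (1 :: real)" by simp
  moreover have "0 \<le> \<lfloor>2 ^ l * x $ k\<rfloor>" using x by simp
  ultimately show "0 \<le> dyadic_round l x $ k \<and> dyadic_round l x $ k \<le> 1"
    by (simp add: dyadic_round_def)
qed

lemma dyadic_round_dist: "infnorm (x - dyadic_round l x) \<le> (1 / 2) ^ l"
  unfolding infnorm_le_iff
proof
  fix k
  have "2 ^ l * (x - dyadic_round l x) $ k = 2 ^ l * x $ k - of_int \<lfloor>2 ^ l * x $ k\<rfloor>"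
    by (simp add: dyadic_round_def algebra_simps)
  then have "0 \<le> 2 ^ l * (x - dyadic_round l x) $ k" "2 ^ l * (x - dyadic_round l x) $ k \<le> 1"
    by linarith+
  then show "\<bar>(x - dyadic_round l x) $ k\<bar> \<le> (1 / 2) ^ l"
    by (simp add: zero_le_mult_iff field_simps)
qed

text \<open>A coordinate takes \<open>2 ^ l + 1\<close> values, since 1 is its own rounding; this is
  at most \<open>2 ^ Suc l\<close>.\<close>

lemma card_dyadic_round:
  "finite (dyadic_round l ` (unit_cube :: (real ^ 'd::finite) set))" (is "finite ?D")
  "card (dyadic_round l ` (unit_cube :: (real ^ 'd::finite) set)) \<le> 2 ^ (Suc l * CARD('d))"
proof -
  define P where "P = Pi\<^sub>E (UNIV :: 'd set) (\<lambda>_. {0..2 ^ l :: int})"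
  have P: "finite P" unfolding P_def by (intro finite_PiE) auto
  have sub: "?D \<subseteq> (\<lambda>f. \<chi> k. of_int (f k) / 2 ^ l) ` P"
  proof
    fix y assume "y \<in> ?D"
    then obtain x where x: "y = dyadic_round l x" "x \<in> unit_cube" by auto
    have "\<lfloor>2 ^ l * x $ k\<rfloor> \<in> {0..2 ^ l}" for k
    proof -
      have "0 \<le> x $ k" "x $ k \<le> 1" using x by (auto simp: unit_cube_def)
      then show ?thesis by (auto simp: floor_le_iff intro: le_less_trans[of _ "2 ^ l"])
    qed
    then have "(\<lambda>k. \<lfloor>2 ^ l * x $ k\<rfloor>) \<in> P" by (auto simp: P_def)
    then show "y \<in> (\<lambda>f. \<chi> k. of_int (f k) / 2 ^ l) ` P"
      unfolding x(1) dyadic_round_def by (rule image_eqI[rotated]) simp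
  qed
  then show "finite ?D" using P finite_surj by blast
  have "card ?D \<le> card P" by (rule surj_card_le[OF P sub])
  also have "card P = (2 ^ l + 1) ^ CARD('d)"
    unfolding P_def by (subst card_PiE) (auto simp: nat_add_distrib nat_power_eq)
  also have "\<dots> \<le> (2 ^ Suc l) ^ CARD('d)" by (intro power_mono) auto
  also have "\<dots> = 2 ^ (Suc l * CARD('d))" by (rule power_mult[symmetric])
  finally show "card ?D \<le> 2 ^ (Suc l * CARD('d))" .
qed

text \<open>Rounding down is consistent between levels. A link from level \<open>Suc l\<close> to
  level \<open>l\<close> is therefore determined by its finer end, and there are no more links than
  points of level \<open>Suc l\<close>.\<close>

lemma dyadic_round_Suc: "dyadic_round l (dyadic_round (Suc l) x) = dyadic_round l x"
proof -
  have "\<lfloor>2 ^ l * (of_int \<lfloor>2 ^ Suc l * y\<rfloor> / 2 ^ Suc l) :: real\<rfloor> = \<lfloor>2 ^ l * y\<rfloor>" for y :: real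
  proof -
    have "\<lfloor>2 ^ l * (of_int \<lfloor>2 ^ Suc l * y\<rfloor> / 2 ^ Suc l) :: real\<rfloor> = \<lfloor>of_int \<lfloor>2 ^ Suc l * y\<rfloor> / (of_int 2 :: real)\<rfloor>"
      by (intro arg_cong[where f = floor]) simp
    also have "\<dots> = \<lfloor>2 ^ Suc l * y\<rfloor> div 2" by (rule floor_divide_of_int_eq)
    also have "\<dots> = \<lfloor>2 ^ Suc l * y / of_int 2\<rfloor>" by (rule floor_divide_real_eq_div[symmetric]) simp
    finally show ?thesis by simp
  qed
  then show ?thesis by (simp add: dyadic_round_def)
qed

text \<open>In \<open>d + 3\<close>, the value at the origin and the last link contribute 1 each and
  the link from level 0 to the origin contributes \<open>d + 1\<close>. The series collects the
  links between consecutive levels, and \<open>2 * sqrt 2\<close> stems from the maximal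
  inequality.\<close>

definition chaining_constant :: "nat \<Rightarrow> real \<Rightarrow> real" where
  "chaining_constant d \<beta> =
     2 * sqrt 2 * (real d + 3 + 3 * real d * (\<Sum>l. real (Suc l) * ((1 / 2) powr \<beta>) ^ l))"

text \<open>This is the derivative of the geometric series at a ratio below 1.\<close>

lemma summable_chaining:
  assumes "0 < \<beta>"
  shows "summable (\<lambda>l. real (Suc l) * ((1 / 2) powr \<beta>) ^ l)"
  using powr_less_mono2[of \<beta> "1 / 2" 1] assms geometric_deriv_sums[of "(1 / 2) powr \<beta>"]
  by (auto simp: sums_iff)

lemma chaining_constant_nonneg: "0 < \<beta> \<Longrightarrow> 0 \<le> chaining_constant d \<beta>"
  unfolding chaining_constant_def
  by (intro mult_nonneg_nonneg add_nonneg_nonneg suminf_nonneg summable_chaining) auto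

locale holder_field_copies =
  field_copies M N "unit_cube :: (real ^ 'd::finite) set" n Zs Z
  for M :: "'a measure" and N :: "'b measure" and n Zs and Z :: "real ^ 'd \<Rightarrow> 'b \<Rightarrow> real" +
  fixes \<beta> C\<^sub>Z :: real and A :: "'b \<Rightarrow> real"
  assumes beta: "0 < \<beta>" and C_Z: "0 < C\<^sub>Z"
    and centered: "\<And>x. x \<in> unit_cube \<Longrightarrow> integrable N (Z x)" "\<And>x. x \<in> unit_cube \<Longrightarrow> (\<integral>\<omega>. Z x \<omega> \<partial>N) = 0"
    and A: "A \<in> borel_measurable N"
    and moments: "(\<integral>\<^sup>+\<omega>. ennreal ((A \<omega>)\<^sup>2) \<partial>N) \<le> ennreal C\<^sub>Z" "(\<integral>\<^sup>+\<omega>. ennreal ((Z 0 \<omega>)\<^sup>2) \<partial>N) \<le> ennreal C\<^sub>Z"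
    and increments: "\<And>x y. x \<in> unit_cube \<Longrightarrow> y \<in> unit_cube \<Longrightarrow>
       AE \<omega> in N. \<bar>Z x \<omega> - Z y \<omega>\<bar> \<le> A \<omega> * infnorm (x - y) powr \<beta>"
begin

text \<open>One random Hoelder constant \<open>A\<close> bounds all increments in \<open>Q\<close>
  at once. Hence the envelope has mean at most \<open>C\<^sub>Z * (r powr \<beta>)\<^sup>2\<close>,
  independently of the size of \<open>Q\<close>.\<close>

lemma maximal_increment:
  assumes Q: "finite Q" "Q \<noteq> {}" and r: "0 < r"
    and dist: "\<And>a b. (a, b) \<in> Q \<Longrightarrow> a \<in> unit_cube \<and> b \<in> unit_cube \<and> infnorm (a - b) \<le> r"
  shows "(\<integral>\<^sup>+\<omega>. ennreal (Max ((\<lambda>(a, b). \<bar>\<Sum>i\<in>{1..n}. Zs i a \<omega> - Zs i b \<omega>\<bar>) ` Q)) \<partial>M)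
           \<le> ennreal (2 * sqrt (2 * ln (2 * real (card Q)) * real n * C\<^sub>Z) * r powr \<beta>)"
proof -
  define G :: "(real ^ 'd) \<times> (real ^ 'd) \<Rightarrow> (real ^ 'd \<Rightarrow> real) \<Rightarrow> real"
    where "G = (\<lambda>(a, b) z. z a - z b)"
  have G: "G k \<in> borel_measurable paths" if "k \<in> Q" for k
  proof (cases k)
    case (Pair a b)
    then have "a \<in> unit_cube" "b \<in> unit_cube" using dist that by auto
    then show ?thesis by (simp add: G_def Pair)
  qed
  have GZ: "G (a, b) (\<lambda>x\<in>unit_cube. z x) = z a - z b" if "(a, b) \<in> Q" for a b z
    using dist[OF that] by (simp add: G_def)
  \<comment> \<open>As \<open>Q\<close> is finite, the exceptional null sets of the single pairs can
    be united.\<close>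
  have inc: "AE \<omega> in N. \<forall>k\<in>Q. \<bar>G k (\<lambda>x\<in>unit_cube. Z x \<omega>)\<bar> \<le> \<bar>A \<omega>\<bar> * r powr \<beta>"
  proof (rule AE_finite_allI[OF Q(1)])
    fix k assume k: "k \<in> Q"
    obtain a b where ab: "k = (a, b)" by (cases k)
    then have ab': "a \<in> unit_cube" "b \<in> unit_cube" "infnorm (a - b) \<le> r" using dist k by auto
    show "AE \<omega> in N. \<bar>G k (\<lambda>x\<in>unit_cube. Z x \<omega>)\<bar> \<le> \<bar>A \<omega>\<bar> * r powr \<beta>"
      using increments[OF ab'(1,2)]
    proof eventually_elim
      case (elim \<omega>)
      have "A \<omega> * infnorm (a - b) powr \<beta> \<le> \<bar>A \<omega>\<bar> * r powr \<beta>"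
        using ab' beta by (intro mult_mono powr_mono2) (auto simp: infnorm_pos_le)
      then show ?case using elim k by (simp add: ab GZ)
    qed
  qed
  have "(\<integral>\<^sup>+\<omega>. ennreal (Max ((\<lambda>k. (G k (\<lambda>x\<in>unit_cube. Z x \<omega>))\<^sup>2) ` Q)) \<partial>N)
      \<le> (\<integral>\<^sup>+\<omega>. ennreal ((A \<omega>)\<^sup>2) * ennreal ((r powr \<beta>)\<^sup>2) \<partial>N)"
  proof (rule nn_integral_mono_AE)
    show "AE \<omega> in N. ennreal (Max ((\<lambda>k. (G k (\<lambda>x\<in>unit_cube. Z x \<omega>))\<^sup>2) ` Q))
        \<le> ennreal ((A \<omega>)\<^sup>2) * ennreal ((r powr \<beta>)\<^sup>2)"
      using inc
    proof eventually_elim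
      case (elim \<omega>)
      have "(G k (\<lambda>x\<in>unit_cube. Z x \<omega>))\<^sup>2 \<le> (A \<omega>)\<^sup>2 * (r powr \<beta>)\<^sup>2" if "k \<in> Q" for k
        using power_mono[OF elim[rule_format, OF that], of 2] by (simp add: power_mult_distrib)
      then have "Max ((\<lambda>k. (G k (\<lambda>x\<in>unit_cube. Z x \<omega>))\<^sup>2) ` Q) \<le> (A \<omega>)\<^sup>2 * (r powr \<beta>)\<^sup>2"
        using Q by simp
      then show ?case by (simp add: ennreal_leI flip: ennreal_mult')
    qed
  qed
  also have "\<dots> = (\<integral>\<^sup>+\<omega>. ennreal ((A \<omega>)\<^sup>2) \<partial>N) * ennreal ((r powr \<beta>)\<^sup>2)"
    using A by (intro nn_integral_multc) auto
  also have "\<dots> \<le> ennreal C\<^sub>Z * ennreal ((r powr \<beta>)\<^sup>2)"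
    by (intro mult_right_mono moments) auto
  also have "\<dots> = ennreal (C\<^sub>Z * (r powr \<beta>)\<^sup>2)"
    using C_Z by (simp add: ennreal_mult')
  finally have bound: "(\<integral>\<^sup>+\<omega>. ennreal (Max ((\<lambda>k. (G k (\<lambda>x\<in>unit_cube. Z x \<omega>))\<^sup>2) ` Q)) \<partial>N)
      \<le> ennreal (C\<^sub>Z * (r powr \<beta>)\<^sup>2)" .
  have "(\<integral>\<^sup>+\<omega>. ennreal (Max ((\<lambda>k. \<bar>\<Sum>i\<in>{1..n}. G k (\<lambda>x\<in>unit_cube. Zs i x \<omega>)\<bar>) ` Q)) \<partial>M)
           \<le> ennreal (2 * sqrt (2 * ln (2 * real (card Q)) * real n * (C\<^sub>Z * (r powr \<beta>)\<^sup>2)))"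
  proof (rule maximal_inequality_copies[OF Q _ G _ _ bound])
    fix k assume k: "k \<in> Q"
    obtain a b where ab: "k = (a, b)" by (cases k)
    then have ab': "a \<in> unit_cube" "b \<in> unit_cube" using dist k by auto
    show "integrable N (\<lambda>\<omega>. G k (\<lambda>x\<in>unit_cube. Z x \<omega>))"
      using centered ab' k by (simp add: ab GZ)
    show "(\<integral>\<omega>. G k (\<lambda>x\<in>unit_cube. Z x \<omega>) \<partial>N) = 0"
      using centered ab' k by (simp add: ab GZ)
  qed (use C_Z r in auto)
  also have "(\<lambda>\<omega>. Max ((\<lambda>k. \<bar>\<Sum>i\<in>{1..n}. G k (\<lambda>x\<in>unit_cube. Zs i x \<omega>)\<bar>) ` Q))
      = (\<lambda>\<omega>. Max ((\<lambda>(a, b). \<bar>\<Sum>i\<in>{1..n}. Zs i a \<omega> - Zs i b \<omega>\<bar>) ` Q))"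
    by (intro ext arg_cong[where f = Max] image_cong) (auto simp: GZ)
  also have "2 * sqrt (2 * ln (2 * real (card Q)) * real n * (C\<^sub>Z * (r powr \<beta>)\<^sup>2))
      = 2 * sqrt (2 * ln (2 * real (card Q)) * real n * C\<^sub>Z) * r powr \<beta>"
    by (simp add: real_sqrt_mult)
  finally show ?thesis .
qed

lemma mean_at_origin:
  "(\<integral>\<^sup>+\<omega>. ennreal \<bar>\<Sum>i\<in>{1..n}. Zs i 0 \<omega>\<bar> \<partial>M) \<le> ennreal (2 * sqrt (2 * ln 2 * real n * C\<^sub>Z))"
proof -
  have 0: "(0 :: real ^ 'd) \<in> unit_cube" by (simp add: unit_cube_def)
  \<comment> \<open>A one-point index set turns the maximal inequality into a first moment bound for
    a single sum.\<close>
  have "(\<integral>\<^sup>+\<omega>. ennreal (Max ((\<lambda>k. \<bar>\<Sum>i\<in>{1..n}. (\<lambda>_ z. z 0) k (\<lambda>x\<in>unit_cube. Zs i x \<omega>)\<bar>) ` {()})) \<partial>M)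
           \<le> ennreal (2 * sqrt (2 * ln (2 * real (card {()})) * real n * C\<^sub>Z))"
    by (rule maximal_inequality_copies[of "{()}" "C\<^sub>Z" "\<lambda>_ z. z 0"])
      (use 0 C_Z centered moments in auto)
  then show ?thesis using 0 by simp
qed

lemma chaining_step:
  assumes Q: "finite Q" "Q \<noteq> {}" "card Q \<le> m" and r: "0 < r"
    and dist: "\<And>a b. (a, b) \<in> Q \<Longrightarrow> a \<in> unit_cube \<and> b \<in> unit_cube \<and> infnorm (a - b) \<le> r"
  shows "(\<integral>\<^sup>+\<omega>. ennreal (Max ((\<lambda>(a, b). \<bar>\<Sum>i\<in>{1..n}. Zs i a \<omega> - Zs i b \<omega>\<bar>) ` Q)) \<partial>M)
           \<le> ennreal (2 * sqrt 2 * sqrt (C\<^sub>Z * real n) * (sqrt (ln (2 * real m)) * r powr \<beta>))"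
proof -
  have "0 < card Q" using Q by (simp add: card_gt_0_iff)
  then have "ln (2 * real (card Q)) \<le> ln (2 * real m)" using Q(3) by simp
  then have "2 * sqrt (2 * ln (2 * real (card Q)) * real n * C\<^sub>Z) * r powr \<beta>
      \<le> 2 * sqrt (2 * ln (2 * real m) * real n * C\<^sub>Z) * r powr \<beta>"
    using C_Z by (intro mult_right_mono mult_left_mono real_sqrt_le_mono) auto
  also have "\<dots> = 2 * sqrt 2 * sqrt (C\<^sub>Z * real n) * (sqrt (ln (2 * real m)) * r powr \<beta>)"
    by (simp add: real_sqrt_mult)
  finally show ?thesis
    using maximal_increment[OF Q(1,2) r dist] by (meson ennreal_leI order_trans)
qed

lemma maximal_inequality_holder:
  assumes F: "finite F" "F \<noteq> {}" "F \<subseteq> unit_cube"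
  shows "(\<integral>\<^sup>+\<omega>. ennreal (Max ((\<lambda>x. \<bar>\<Sum>i\<in>{1..n}. Zs i x \<omega>\<bar>) ` F)) \<partial>M)
           \<le> ennreal (chaining_constant CARD('d) \<beta> * sqrt (C\<^sub>Z * real n))"
proof -
  let ?S = "\<lambda>x \<omega>. \<Sum>i\<in>{1..n}. Zs i x \<omega>"
  let ?W = "\<lambda>Q \<omega>. Max ((\<lambda>(a, b). \<bar>\<Sum>i\<in>{1..n}. Zs i a \<omega> - Zs i b \<omega>\<bar>) ` Q)"
  define d where "d = real CARD('d)"
  define \<rho> where "\<rho> = (1 / 2 :: real) powr \<beta>"
  define c where "c = 2 * sqrt 2 * sqrt (C\<^sub>Z * real n)"
  have d: "d \<ge> 1" by (simp add: d_def Suc_le_eq)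
  have \<rho>: "0 < \<rho>" "\<rho> < 1" unfolding \<rho>_def using beta powr_less_mono2[of \<beta> "1/2" 1] by auto
  have c: "c \<ge> 0" unfolding c_def using C_Z by simp
  \<comment> \<open>The depth \<open>L\<close> depends on \<open>F\<close>: it is so large that the
    last link, from \<open>F\<close> to level \<open>L\<close>, costs at most a constant. The levels
    below \<open>L\<close> are bounded by the full series, so the size of \<open>F\<close>
    disappears from the result.\<close>
  have "(\<lambda>L. sqrt (ln (2 * real (card F))) * \<rho> ^ L) \<longlonglongrightarrow> sqrt (ln (2 * real (card F))) * 0"
    using \<rho> by (intro tendsto_intros LIMSEQ_realpow_zero) auto
  then have "eventually (\<lambda>L. sqrt (ln (2 * real (card F))) * \<rho> ^ L < 1) sequentially"
    by (rule order_tendstoD) simp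
  then obtain L where L: "sqrt (ln (2 * real (card F))) * \<rho> ^ L < 1"
    by (auto simp: eventually_sequentially)
  define D where "D l = dyadic_round l ` (unit_cube :: (real ^ 'd) set)" for l
  \<comment> \<open>The links of the chain: \<open>Q\<close> joins level 0, the corners of the cube,
    to the origin; \<open>R l\<close> joins consecutive levels; \<open>E\<close> joins
    \<open>F\<close> to level \<open>L\<close>.\<close>
  define Q where "Q = (\<lambda>v :: real ^ 'd. (v, 0 :: real ^ 'd)) ` D 0"
  define R where "R l = (\<lambda>v :: real ^ 'd. (v, dyadic_round l v)) ` D (Suc l)" for l
  define E where "E = (\<lambda>v :: real ^ 'd. (v, dyadic_round L v)) ` F"
  have 0: "(0 :: real ^ 'd) \<in> unit_cube" by (simp add: unit_cube_def)
  have D: "finite (D l)" "D l \<noteq> {}" "card (D l) \<le> 2 ^ (Suc l * CARD('d))" "D l \<subseteq> unit_cube" for l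
    using card_dyadic_round[where ?'d = 'd, of l] 0 dyadic_round_in_cube[of _ l] by (auto simp: D_def)
  have fin: "finite Q" "Q \<noteq> {}" "finite (R l)" "R l \<noteq> {}" "finite E" "E \<noteq> {}" for l
    using D F by (auto simp: Q_def R_def E_def)
  have Q: "(\<integral>\<^sup>+\<omega>. ennreal (?W Q \<omega>) \<partial>M) \<le> ennreal (c * (d + 1))"
  proof -
    have "(\<integral>\<^sup>+\<omega>. ennreal (?W Q \<omega>) \<partial>M) \<le> ennreal (c * (sqrt (ln (2 * real (2 ^ CARD('d)))) * 1 powr \<beta>))"
      unfolding c_def
    proof (rule chaining_step[OF fin(1,2)])
      show "card Q \<le> 2 ^ CARD('d)"
        unfolding Q_def using card_image_le[OF D(1)[of 0]] D(3)[of 0] by (auto intro: order_trans)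
      fix a b assume "(a, b) \<in> Q"
      then have a: "a \<in> unit_cube" "b = 0" using D(4)[of 0] by (auto simp: Q_def)
      then have "0 \<le> a $ k" "a $ k \<le> 1" for k by (auto simp: unit_cube_def)
      then show "a \<in> unit_cube \<and> b \<in> unit_cube \<and> infnorm (a - b) \<le> 1"
        using a 0 by (auto simp: infnorm_le_iff)
    qed simp
    also have "\<dots> \<le> ennreal (c * (d + 1))"
    proof (intro ennreal_leI mult_left_mono c)
      have "ln (2 * real (2 ^ CARD('d))) = (d + 1) * ln 2"
        by (simp add: ln_mult ln_realpow d_def algebra_simps)
      also have "\<dots> \<le> (d + 1) * 1" using d ln_2_less_1 by (intro mult_left_mono) auto
      also have "\<dots> \<le> (d + 1)\<^sup>2" using d by (simp add: self_le_power)
      finally show "sqrt (ln (2 * real (2 ^ CARD('d)))) * 1 powr \<beta> \<le> d + 1"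
        using d by (simp add: real_le_lsqrt)
    qed
    finally show ?thesis .
  qed
  have R: "(\<integral>\<^sup>+\<omega>. ennreal (?W (R l) \<omega>) \<partial>M) \<le> ennreal (c * (3 * d * (real (Suc l) * \<rho> ^ l)))" for l
  proof -
    have "(\<integral>\<^sup>+\<omega>. ennreal (?W (R l) \<omega>) \<partial>M)
        \<le> ennreal (c * (sqrt (ln (2 * real (2 ^ (Suc (Suc l) * CARD('d))))) * ((1 / 2) ^ l) powr \<beta>))"
      unfolding c_def
    proof (rule chaining_step[OF fin(3,4)])
      show "card (R l) \<le> 2 ^ (Suc (Suc l) * CARD('d))"
        unfolding R_def using card_image_le[OF D(1)[of "Suc l"]] D(3)[of "Suc l"] by (rule order_trans)
      fix a b assume "(a, b) \<in> R l"
      then show "a \<in> unit_cube \<and> b \<in> unit_cube \<and> infnorm (a - b) \<le> (1 / 2) ^ l"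
        using D(4)[of "Suc l"] by (auto simp: R_def intro!: dyadic_round_dist dyadic_round_in_cube)
    qed simp
    also have "\<dots> \<le> ennreal (c * (3 * d * (real (Suc l) * \<rho> ^ l)))"
    proof (intro ennreal_leI mult_left_mono c)
      have "ln (2 * real (2 ^ (Suc (Suc l) * CARD('d)))) = (real (Suc (Suc l)) * d + 1) * ln 2"
        by (simp add: ln_mult ln_realpow d_def algebra_simps)
      also have "\<dots> \<le> (real (Suc (Suc l)) * d + 1) * 1" using d ln_2_less_1 by (intro mult_left_mono) auto
      also have "\<dots> \<le> 3 * d * real (Suc l)"
      proof -
        have "3 * d * real (Suc l) = (real (Suc (Suc l)) * d + 1) * 1 + (d - 1) + 2 * (d * real l)"
          by (simp add: algebra_simps)
        moreover have "0 \<le> d * real l" using d by simp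
        ultimately show ?thesis using d by linarith
      qed
      \<comment> \<open>The root is bounded by its argument, which is at least 1. The loss is
        polynomial in the level and is absorbed by the geometric factor
        \<open>\<rho> ^ l\<close>.\<close>
      also have "\<dots> \<le> (3 * d * real (Suc l))\<^sup>2"
      proof (rule self_le_power)
        have "1 * 1 \<le> (3 * d) * real (Suc l)" using d by (intro mult_mono) auto
        then show "1 \<le> 3 * d * real (Suc l)" by simp
      qed simp
      finally have "sqrt (ln (2 * real (2 ^ (Suc (Suc l) * CARD('d))))) \<le> 3 * d * real (Suc l)"
        using d by (intro real_le_lsqrt) auto
      moreover have "((1 / 2 :: real) ^ l) powr \<beta> = \<rho> ^ l"
        unfolding \<rho>_def by (simp add: powr_realpow[symmetric] powr_powr mult.commute)
      ultimately show "sqrt (ln (2 * real (2 ^ (Suc (Suc l) * CARD('d))))) * ((1 / 2) ^ l) powr \<beta>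
          \<le> 3 * d * (real (Suc l) * \<rho> ^ l)"
        using \<rho> by (simp add: mult.assoc[symmetric])
    qed
    finally show ?thesis .
  qed
  have E: "(\<integral>\<^sup>+\<omega>. ennreal (?W E \<omega>) \<partial>M) \<le> ennreal (c * 1)"
  proof -
    have "(\<integral>\<^sup>+\<omega>. ennreal (?W E \<omega>) \<partial>M)
        \<le> ennreal (c * (sqrt (ln (2 * real (card F))) * ((1 / 2) ^ L) powr \<beta>))"
      unfolding c_def
    proof (rule chaining_step[OF fin(5,6)])
      show "card E \<le> card F" unfolding E_def using F by (intro card_image_le)
      fix a b assume "(a, b) \<in> E"
      then show "a \<in> unit_cube \<and> b \<in> unit_cube \<and> infnorm (a - b) \<le> (1 / 2) ^ L"
        using F by (auto simp: E_def intro!: dyadic_round_dist dyadic_round_in_cube)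
    qed simp
    also have "\<dots> \<le> ennreal (c * 1)"
    proof (intro ennreal_leI mult_left_mono c)
      have "((1 / 2 :: real) ^ L) powr \<beta> = \<rho> ^ L"
        unfolding \<rho>_def by (simp add: powr_realpow[symmetric] powr_powr mult.commute)
      then show "sqrt (ln (2 * real (card F))) * ((1 / 2) ^ L) powr \<beta> \<le> 1" using L by simp
    qed
    finally show ?thesis .
  qed
  have S0: "(\<integral>\<^sup>+\<omega>. ennreal \<bar>?S 0 \<omega>\<bar> \<partial>M) \<le> ennreal (c * 1)"
  proof -
    have "2 * sqrt (2 * ln 2 * real n * C\<^sub>Z) \<le> 2 * sqrt (2 * 1 * real n * C\<^sub>Z)"
      using C_Z ln_2_less_1 by (intro mult_left_mono mult_right_mono real_sqrt_le_mono) auto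
    then have "2 * sqrt (2 * ln 2 * real n * C\<^sub>Z) \<le> c * 1"
      by (simp add: c_def real_sqrt_mult mult_ac)
    then show ?thesis using mean_at_origin by (meson ennreal_leI order_trans)
  qed
  have W: "\<bar>?S a \<omega> - ?S b \<omega>\<bar> \<le> ?W B \<omega>" if "(a, b) \<in> B" "finite B" for a b B \<omega>
  proof -
    have "\<bar>?S a \<omega> - ?S b \<omega>\<bar> = (\<lambda>(a, b). \<bar>\<Sum>i\<in>{1..n}. Zs i a \<omega> - Zs i b \<omega>\<bar>) (a, b)"
      by (simp add: sum_subtractf)
    then show ?thesis using that by (intro Max_ge) (auto intro!: image_eqI)
  qed
  have W0: "0 \<le> ?W B \<omega>" if "finite B" "B \<noteq> {}" for B \<omega>
  proof -
    obtain a b where "(a, b) \<in> B" using \<open>B \<noteq> {}\<close> by auto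
    from W[OF this that(1), of \<omega>] show ?thesis by linarith
  qed
  have pointwise: "\<bar>?S x \<omega>\<bar> \<le> \<bar>?S 0 \<omega>\<bar> + ?W Q \<omega> + (\<Sum>l<L. ?W (R l) \<omega>) + ?W E \<omega>" if x: "x \<in> F" for x \<omega>
  proof -
    let ?x = "\<lambda>l. dyadic_round l x"
    let ?T = "\<lambda>l. ?S (?x (Suc l)) \<omega> - ?S (?x l) \<omega>"
    have "\<bar>\<Sum>l<L. ?T l\<bar> \<le> (\<Sum>l<L. ?W (R l) \<omega>)"
    proof (intro order_trans[OF sum_abs] sum_mono)
      fix l
      have "(?x (Suc l), dyadic_round l (?x (Suc l))) \<in> R l"
        unfolding R_def D_def using x F(3) by (intro imageI) auto
      then have "(?x (Suc l), ?x l) \<in> R l" by (simp only: dyadic_round_Suc)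
      then show "\<bar>?T l\<bar> \<le> ?W (R l) \<omega>" using fin(3) by (rule W)
    qed
    moreover have "(?x 0, 0) \<in> Q"
      unfolding Q_def D_def using x F(3) by (intro imageI) auto
    then have "\<bar>?S (?x 0) \<omega> - ?S 0 \<omega>\<bar> \<le> ?W Q \<omega>" using fin(1) by (rule W)
    moreover have "(x, ?x L) \<in> E"
      unfolding E_def using x by (intro imageI)
    then have "\<bar>?S x \<omega> - ?S (?x L) \<omega>\<bar> \<le> ?W E \<omega>" using fin(5) by (rule W)
    moreover have "(\<Sum>l<L. ?T l) = ?S (?x L) \<omega> - ?S (?x 0) \<omega>"
      by (rule sum_lessThan_telescope[of "\<lambda>l. ?S (?x l) \<omega>" L])
    ultimately show ?thesis by linarith
  qed
  have [measurable]: "Zs i x \<in> borel_measurable M" if "i \<in> {1..n}" "x \<in> unit_cube" for i x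
    using measurable_copy that by blast
  have Wm: "?W B \<in> borel_measurable M" if "finite B" "\<And>a b. (a, b) \<in> B \<Longrightarrow> a \<in> unit_cube \<and> b \<in> unit_cube" for B
  proof (rule borel_measurable_Max[OF that(1)])
    fix k assume "k \<in> B"
    then show "(\<lambda>\<omega>. case k of (a, b) \<Rightarrow> \<bar>\<Sum>i\<in>{1..n}. Zs i a \<omega> - Zs i b \<omega>\<bar>) \<in> borel_measurable M"
      using that(2) by (cases k) auto
  qed
  have meas: "?W Q \<in> borel_measurable M" "?W (R l) \<in> borel_measurable M" "?W E \<in> borel_measurable M" for l
  proof -
    show "?W Q \<in> borel_measurable M"
      using fin(1) by (rule Wm) (use 0 D(4)[of 0] in \<open>auto simp: Q_def\<close>)
    show "?W (R l) \<in> borel_measurable M"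
      using fin(3) by (rule Wm) (use D(4)[of "Suc l"] in \<open>auto simp: R_def intro!: dyadic_round_in_cube\<close>)
    show "?W E \<in> borel_measurable M"
      using fin(5) by (rule Wm) (use F(3) in \<open>auto simp: E_def intro!: dyadic_round_in_cube\<close>)
  qed
  have m0: "(\<lambda>\<omega>. \<bar>?S 0 \<omega>\<bar>) \<in> borel_measurable M" using 0 by measurable
  have split: "ennreal (a + b + (\<Sum>l<L. f l) + e) = ennreal a + ennreal b + (\<Sum>l<L. ennreal (f l)) + ennreal e"
    if "0 \<le> a" "0 \<le> b" "\<And>l. 0 \<le> f l" "0 \<le> e" for a b e f
    using that by (simp add: sum_nonneg)
  have "(\<integral>\<^sup>+\<omega>. ennreal (Max ((\<lambda>x. \<bar>?S x \<omega>\<bar>) ` F)) \<partial>M)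
      \<le> (\<integral>\<^sup>+\<omega>. ennreal \<bar>?S 0 \<omega>\<bar> + ennreal (?W Q \<omega>) + (\<Sum>l<L. ennreal (?W (R l) \<omega>)) + ennreal (?W E \<omega>) \<partial>M)"
  proof (intro nn_integral_mono)
    fix \<omega>
    have "Max ((\<lambda>x. \<bar>?S x \<omega>\<bar>) ` F) \<le> \<bar>?S 0 \<omega>\<bar> + ?W Q \<omega> + (\<Sum>l<L. ?W (R l) \<omega>) + ?W E \<omega>"
      using F pointwise by (intro Max.boundedI) auto
    then have "ennreal (Max ((\<lambda>x. \<bar>?S x \<omega>\<bar>) ` F))
       \<le> ennreal (\<bar>?S 0 \<omega>\<bar> + ?W Q \<omega> + (\<Sum>l<L. ?W (R l) \<omega>) + ?W E \<omega>)"
      by (rule ennreal_leI)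
    then show "ennreal (Max ((\<lambda>x. \<bar>?S x \<omega>\<bar>) ` F))
       \<le> ennreal \<bar>?S 0 \<omega>\<bar> + ennreal (?W Q \<omega>) + (\<Sum>l<L. ennreal (?W (R l) \<omega>)) + ennreal (?W E \<omega>)"
      unfolding split[OF abs_ge_zero W0[OF fin(1,2)] W0[OF fin(3,4)] W0[OF fin(5,6)]] .
  qed
  also have "\<dots> = (\<integral>\<^sup>+\<omega>. ennreal \<bar>?S 0 \<omega>\<bar> \<partial>M) + (\<integral>\<^sup>+\<omega>. ennreal (?W Q \<omega>) \<partial>M)
      + (\<Sum>l<L. \<integral>\<^sup>+\<omega>. ennreal (?W (R l) \<omega>) \<partial>M) + (\<integral>\<^sup>+\<omega>. ennreal (?W E \<omega>) \<partial>M)"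
    using meas m0 by (simp add: nn_integral_add nn_integral_sum)
  also have "\<dots> \<le> ennreal (c * 1) + ennreal (c * (d + 1))
      + (\<Sum>l<L. ennreal (c * (3 * d * (real (Suc l) * \<rho> ^ l)))) + ennreal (c * 1)"
    using S0 Q R E by (intro add_mono sum_mono)
  also have "\<dots> = ennreal (c * 1 + c * (d + 1) + (\<Sum>l<L. c * (3 * d * (real (Suc l) * \<rho> ^ l))) + c * 1)"
    using c d \<rho> by (intro split[symmetric]) auto
  also have "\<dots> \<le> ennreal (chaining_constant CARD('d) \<beta> * sqrt (C\<^sub>Z * real n))"
  proof (intro ennreal_leI)
    have "summable (\<lambda>l. real (Suc l) * \<rho> ^ l)"
      unfolding \<rho>_def using beta by (rule summable_chaining)
    then have "(\<Sum>l<L. real (Suc l) * \<rho> ^ l) \<le> (\<Sum>l. real (Suc l) * \<rho> ^ l)"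
      using \<rho> by (intro sum_le_suminf) auto
    then have "c * (d + 3 + 3 * d * (\<Sum>l<L. real (Suc l) * \<rho> ^ l)) \<le> c * (d + 3 + 3 * d * (\<Sum>l. real (Suc l) * \<rho> ^ l))"
      using c d by (intro mult_left_mono add_left_mono) auto
    moreover have "c * (d + 3 + 3 * d * (\<Sum>l. real (Suc l) * \<rho> ^ l)) = chaining_constant CARD('d) \<beta> * sqrt (C\<^sub>Z * real n)"
      unfolding chaining_constant_def c_def d_def \<rho>_def by (simp only: mult_ac)
    moreover have "(\<Sum>l<L. c * (3 * d * (real (Suc l) * \<rho> ^ l))) = c * (3 * d * (\<Sum>l<L. real (Suc l) * \<rho> ^ l))"
      by (simp only: sum_distrib_left[symmetric])
    ultimately show "c * 1 + c * (d + 1) + (\<Sum>l<L. c * (3 * d * (real (Suc l) * \<rho> ^ l))) + c * 1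
       \<le> chaining_constant CARD('d) \<beta> * sqrt (C\<^sub>Z * real n)"
      by (simp only: distrib_left)
  qed
  finally show ?thesis .
qed

end

text \<open>Distances in the cube are at most 1, so a Hoelder bound with exponent
  \<open>\<beta>\<close> implies one with \<open>\<beta>\<^sub>0\<close> and the same random
  constant. This makes the chaining constant uniform over the class.\<close>

lemma maximal_inequality_process_class:
  assumes NZ: "(N, Z) \<in> process_class \<beta>\<^sub>0 C\<^sub>Z"
    and R: "(M, Zs, eps) \<in> fda_model n (p :: 'd::finite \<Rightarrow> nat) err (N, Z)"
    and pos: "0 < \<beta>\<^sub>0" "0 < C\<^sub>Z" "1 \<le> n"
    and F: "finite F" "F \<noteq> {}" "F \<subseteq> (unit_cube :: (real ^ 'd) set)"
  shows "(\<integral>\<^sup>+\<omega>. ennreal (Max ((\<lambda>x. \<bar>\<Sum>i\<in>{1..n}. Zs i x \<omega>\<bar>) ` F)) \<partial>M)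
           \<le> ennreal (chaining_constant CARD('d) \<beta>\<^sub>0 * sqrt (C\<^sub>Z * real n))"
    and "\<And>i x. i \<in> {1..n} \<Longrightarrow> x \<in> unit_cube \<Longrightarrow> Zs i x \<in> borel_measurable M"
proof -
  obtain \<beta> A where A: "\<beta>\<^sub>0 \<le> \<beta>" "\<beta> \<le> 1" "A \<in> borel_measurable N" "AE \<omega> in N. 0 < A \<omega>"
      "(\<integral>\<^sup>+\<omega>. ennreal ((A \<omega>)\<^sup>2) \<partial>N) + (\<integral>\<^sup>+\<omega>. ennreal ((Z 0 \<omega>)\<^sup>2) \<partial>N) \<le> ennreal C\<^sub>Z"
      "\<And>x y. x \<in> unit_cube \<Longrightarrow> y \<in> unit_cube \<Longrightarrow> AE \<omega> in N. \<bar>Z x \<omega> - Z y \<omega>\<bar> \<le> A \<omega> * infnorm (x - y) powr \<beta>"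
    using NZ unfolding process_class_def by auto
  interpret M: prob_space M using R by (simp add: fda_model_def)
  interpret N: prob_space N using NZ by (simp add: process_class_def)
  interpret holder_field_copies M N n Zs Z \<beta>\<^sub>0 C\<^sub>Z A
  proof
    fix x y :: "real ^ 'd" assume xy: "x \<in> unit_cube" "y \<in> unit_cube"
    have "\<bar>(x - y) $ k\<bar> \<le> 1" for k
      using xy by (auto simp: unit_cube_def abs_le_iff dest!: spec[of _ k])
    then have le1: "infnorm (x - y) \<le> 1" by (simp add: infnorm_le_iff)
    show "AE \<omega> in N. \<bar>Z x \<omega> - Z y \<omega>\<bar> \<le> A \<omega> * infnorm (x - y) powr \<beta>\<^sub>0"
      using A(4) A(6)[OF xy]
    proof eventually_elim
      case (elim \<omega>)
      have "infnorm (x - y) powr \<beta> \<le> infnorm (x - y) powr \<beta>\<^sub>0"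
        using A(1) le1 by (intro powr_mono') (auto simp: infnorm_pos_le)
      then have "A \<omega> * infnorm (x - y) powr \<beta> \<le> A \<omega> * infnorm (x - y) powr \<beta>\<^sub>0"
        using elim by (intro mult_left_mono) auto
      then show ?case using elim by linarith
    qed
  next
    show "(\<integral>\<^sup>+\<omega>. ennreal ((A \<omega>)\<^sup>2) \<partial>N) \<le> ennreal C\<^sub>Z" "(\<integral>\<^sup>+\<omega>. ennreal ((Z 0 \<omega>)\<^sup>2) \<partial>N) \<le> ennreal C\<^sub>Z"
      using A(5) by (meson add_increasing add_increasing2 order_trans zero_le order_refl)+
  qed (use NZ R pos A in \<open>auto simp: process_class_def fda_model_def\<close>)
  show "(\<integral>\<^sup>+\<omega>. ennreal (Max ((\<lambda>x. \<bar>\<Sum>i\<in>{1..n}. Zs i x \<omega>\<bar>) ` F)) \<partial>M)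
           \<le> ennreal (chaining_constant CARD('d) \<beta>\<^sub>0 * sqrt (C\<^sub>Z * real n))"
    using F by (rule maximal_inequality_holder)
  show "Zs i x \<in> borel_measurable M" if "i \<in> {1..n}" "x \<in> unit_cube" for i x
    using that by (rule measurable_copy)
qed

section \<open>Weights at a fixed bandwidth\<close>

lemma grid_conv_PiE: "grid p = Pi\<^sub>E UNIV (\<lambda>k. {1..p k})"
  by (auto simp: grid_def PiE_def Pi_def)

lemma finite_grid: "finite (grid (p :: 'd::finite \<Rightarrow> nat))"
  unfolding grid_conv_PiE by (intro finite_PiE) auto

lemma card_grid: "real (card (grid p)) = p_prod (p :: 'd::finite \<Rightarrow> nat)"
  unfolding grid_conv_PiE p_prod_def by (subst card_PiE) auto

lemma p_min_le: "p_min p \<le> p (k :: 'd::finite)"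
  unfolding p_min_def by (intro Min_le) auto

lemma p_min_power_le_p_prod: "real (p_min p) ^ CARD('d) \<le> p_prod (p :: 'd::finite \<Rightarrow> nat)"
proof -
  have "(\<Prod>k\<in>(UNIV :: 'd set). real (p_min p)) \<le> (\<Prod>k\<in>UNIV. real (p k))"
    by (intro prod_mono) (auto simp: p_min_le)
  then show ?thesis by (simp add: p_prod_def)
qed

lemma holder_class_taylor:
  fixes f :: "real ^ 'd::finite \<Rightarrow> real"
  assumes "f \<in> holder_class \<alpha> L" "0 < \<alpha>" "0 \<le> L"
  obtains D where "\<And>x y. x \<in> unit_cube \<Longrightarrow> y \<in> unit_cube \<Longrightarrow>
    \<bar>f y - multi_taylor (strict_floor \<alpha>) D x y\<bar> \<le> real CARD('d) ^ strict_floor \<alpha> * L * infnorm (y - x) powr \<alpha>"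
    "\<And>x. x \<in> unit_cube \<Longrightarrow> D (\<lambda>_. 0) x = f x"
proof -
  define m where "m = strict_floor \<alpha>"
  \<comment> \<open>Finiteness and nonemptiness make the \<open>Max\<close> in
    \<open>strict_floor\<close> a member of the set, which gives
    \<open>m < \<alpha>\<close>.\<close>
  have "finite {k::nat. real k < \<alpha>}"
    by (rule finite_subset[of _ "{..nat \<lceil>\<alpha>\<rceil>}"]) (auto, linarith)
  moreover have "{k::nat. real k < \<alpha>} \<noteq> {}" using assms(2) by (auto intro!: exI[of _ 0])
  ultimately have m: "real m < \<alpha>" unfolding m_def strict_floor_def using Max_in[of "{k::nat. real k < \<alpha>}"] by auto
  obtain D where D: "partial_derivs m f D" "holder_norm \<alpha> D \<le> ennreal L"
    using assms(1) by (auto simp: holder_class_def m_def)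
  have holder: "\<bar>D \<beta> x - D \<beta> y\<bar> \<le> L * infnorm (x - y) powr (\<alpha> - real m)"
    if "multi_degree \<beta> = m" "x \<in> unit_cube" "y \<in> unit_cube" for \<beta> x y
  proof (cases "x = y")
    case False
    let ?q = "\<lambda>\<beta> x y. \<bar>D \<beta> x - D \<beta> y\<bar> / infnorm (x - y) powr (\<alpha> - real m)"
    have "ennreal (?q \<beta> x y) \<le> (SUP (x, y)\<in>{(x, y). x \<in> unit_cube \<and> y \<in> unit_cube \<and> x \<noteq> y}. ennreal (?q \<beta> x y))"
      using that False by (intro SUP_upper2[of "(x, y)"]) auto
    also have "\<dots> \<le> (SUP \<beta>\<in>{\<beta>. multi_degree \<beta> = m}.
        SUP (x, y)\<in>{(x, y). x \<in> unit_cube \<and> y \<in> unit_cube \<and> x \<noteq> y}. ennreal (?q \<beta> x y))"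
      using that(1) by (intro SUP_upper) auto
    also have "\<dots> \<le> holder_norm \<alpha> D" unfolding holder_norm_def m_def by (rule add_increasing) auto
    also have "\<dots> \<le> ennreal L" by (rule D)
    finally have "?q \<beta> x y \<le> L" using assms(3) by simp
    moreover have "infnorm (x - y) > 0" using False by (simp add: infnorm_pos_lt)
    ultimately show ?thesis by (simp add: divide_le_eq)
  qed (use assms(3) in simp)
  have "\<bar>f y - multi_taylor m D x y\<bar> \<le> real CARD('d) ^ m * L * infnorm (y - x) powr \<alpha>"
    if "x \<in> unit_cube" "y \<in> unit_cube" for x y
  proof -
    have "\<bar>f y - multi_taylor m D x y\<bar>
        \<le> real CARD('d) ^ m * L * infnorm (y - x) ^ m * infnorm (y - x) powr (\<alpha> - real m)"
      using holder that m assms(3) by (intro multi_taylor_remainder[OF D(1)]) auto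
    also have "\<dots> = real CARD('d) ^ m * L * infnorm (y - x) powr \<alpha>"
    \<comment> \<open>At distance 0 both sides vanish, since \<open>0 powr a = 0\<close>; otherwise
      the exponents \<open>m\<close> and \<open>\<alpha> - m\<close> add up.\<close>
    proof (cases "infnorm (y - x) = 0")
      case False
      then have "0 < infnorm (y - x)" using infnorm_pos_le[of "y - x"] by linarith
      then show ?thesis by (simp add: powr_diff powr_realpow)
    qed simp
    finally show ?thesis .
  qed
  moreover have "\<And>x. x \<in> unit_cube \<Longrightarrow> D (\<lambda>_. 0) x = f x" using D(1) by (simp add: partial_derivs_def)
  ultimately show ?thesis using that unfolding m_def by blast
qed

text \<open>The situation at one sample size and one bandwidth. The left endpoint
  \<open>c / p_min\<close> is included because \<open>h_star\<close> may attain it. \<open>A\<close>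
  is the constant of the local count of design points.\<close>

locale local_weights =
  fixes \<zeta> :: nat and p :: "'d::finite \<Rightarrow> nat" and t :: "'d \<Rightarrow> nat \<Rightarrow> real"
    and w :: "('d \<Rightarrow> nat) \<Rightarrow> real ^ 'd \<Rightarrow> real \<Rightarrow> real" and C\<^sub>1 C\<^sub>2 A c h :: real
  assumes weights: "weight_conditions \<zeta> p t w C\<^sub>1 C\<^sub>2 h"
    and design: "design p t"
    and p_min: "1 \<le> p_min p"
    and pos: "0 < C\<^sub>1" "0 < C\<^sub>2" "0 < A" "0 < c"
    and h_ge: "c / real (p_min p) \<le> h"
    and active: "\<And>x. x \<in> unit_cube \<Longrightarrow>
      real (card {j \<in> grid p. infnorm (design_point t j - x) \<le> h}) \<le> A * (h ^ CARD('d) * p_prod p)"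
begin

lemma h_pos: "0 < h"
proof -
  have "0 < c / real (p_min p)" using pos p_min by simp
  then show ?thesis using h_ge by linarith
qed

lemma p_min_h: "c \<le> real (p_min p) * h"
  using h_ge p_min by (simp add: field_simps)

text \<open>All of this follows from \<open>p_min * h \<ge> c\<close>. The second bound controls the
  discretization error of the noise, the third the number of points averaged locally.\<close>

lemma p_prod_ge: "1 \<le> p_prod p" "c \<le> p_prod p * h" "c ^ CARD('d) \<le> p_prod p * h ^ CARD('d)"
proof -
  have "1 \<le> real (p_min p) ^ CARD('d)" using p_min by simp
  then show "1 \<le> p_prod p" using p_min_power_le_p_prod[of p] by linarith
  have "real (p_min p) \<le> real (p_min p) ^ CARD('d)" using p_min by (intro self_le_power) (auto simp: Suc_le_eq)
  then have "real (p_min p) \<le> p_prod p" using p_min_power_le_p_prod[of p] by (rule order_trans)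
  then have "real (p_min p) * h \<le> p_prod p * h" using h_pos by (intro mult_right_mono) auto
  then show "c \<le> p_prod p * h" using p_min_h by linarith
  have "c ^ CARD('d) \<le> (real (p_min p) * h) ^ CARD('d)"
    using p_min_h pos by (intro power_mono) auto
  also have "\<dots> \<le> p_prod p * h ^ CARD('d)"
    unfolding power_mult_distrib using p_min_power_le_p_prod[of p] h_pos by (intro mult_right_mono) auto
  finally show "c ^ CARD('d) \<le> p_prod p * h ^ CARD('d)" .
qed

lemma design_point_in_cube: "j \<in> grid p \<Longrightarrow> design_point t j \<in> unit_cube"
  using design by (simp add: design_def)

lemma grid_nonempty: "grid p \<noteq> {}"
  using card_grid[of p] p_prod_ge(1) by auto

lemma weight_support:
  "x \<in> unit_cube \<Longrightarrow> j \<in> grid p \<Longrightarrow> h < infnorm (design_point t j - x) \<Longrightarrow> w j x h = 0"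
  using weights by (auto simp: weight_conditions_def)

lemma weight_bound:
  "x \<in> unit_cube \<Longrightarrow> j \<in> grid p \<Longrightarrow> \<bar>w j x h\<bar> \<le> C\<^sub>1 / (p_prod p * h ^ CARD('d))"
  using weights by (auto simp: weight_conditions_def)

text \<open>Only the design points within distance \<open>h\<close> contribute: their number times a
  uniform bound.\<close>

lemma sum_weights_le:
  assumes x: "x \<in> unit_cube" and g: "\<And>j. j \<in> grid p \<Longrightarrow> w j x h = 0 \<Longrightarrow> g j = 0" "\<And>j. j \<in> grid p \<Longrightarrow> g j \<le> b" and b: "0 \<le> b"
  shows "(\<Sum>j\<in>grid p. g j) \<le> A * (h ^ CARD('d) * p_prod p) * b"
proof -
  have "(\<Sum>j\<in>grid p. g j) = (\<Sum>j\<in>{j \<in> grid p. infnorm (design_point t j - x) \<le> h}. g j)"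
    using g(1) weight_support[OF x] by (intro sum.mono_neutral_right finite_grid) force+
  also have "\<dots> \<le> real (card {j \<in> grid p. infnorm (design_point t j - x) \<le> h}) * b"
    using g(2) by (intro sum_bounded_above) auto
  also have "\<dots> \<le> A * (h ^ CARD('d) * p_prod p) * b"
    using active[OF x] b by (intro mult_right_mono)
  finally show ?thesis .
qed

lemma sum_abs_weights_le: "x \<in> unit_cube \<Longrightarrow> (\<Sum>j\<in>grid p. \<bar>w j x h\<bar>) \<le> C\<^sub>1 * A"
proof -
  assume x: "x \<in> unit_cube"
  have "(\<Sum>j\<in>grid p. \<bar>w j x h\<bar>) \<le> A * (h ^ CARD('d) * p_prod p) * (C\<^sub>1 / (p_prod p * h ^ CARD('d)))"
    using weight_bound[OF x] h_pos p_prod_ge(1) pos by (intro sum_weights_le[OF x]) auto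
  then show ?thesis using h_pos p_prod_ge(1) by (simp add: field_simps)
qed

lemma sum_square_weights_le:
  "x \<in> unit_cube \<Longrightarrow> (\<Sum>j\<in>grid p. (w j x h)\<^sup>2) \<le> C\<^sub>1\<^sup>2 * A / (p_prod p * h ^ CARD('d))"
proof -
  assume x: "x \<in> unit_cube"
  have "(\<Sum>j\<in>grid p. (w j x h)\<^sup>2) \<le> A * (h ^ CARD('d) * p_prod p) * (C\<^sub>1 / (p_prod p * h ^ CARD('d)))\<^sup>2"
  proof (intro sum_weights_le[OF x])
    fix j assume "j \<in> grid p"
    then show "(w j x h)\<^sup>2 \<le> (C\<^sub>1 / (p_prod p * h ^ CARD('d)))\<^sup>2"
      using power_mono[OF weight_bound[OF x, of j], of 2] by simp
  qed auto
  then show ?thesis using h_pos p_prod_ge(1) by (simp add: field_simps power2_eq_square)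
qed

lemma bias_le:
  assumes f: "f \<in> holder_class \<alpha> L" and \<alpha>: "0 < \<alpha>" "0 \<le> L" "\<zeta> = strict_floor \<alpha>" and x: "x \<in> unit_cube"
  shows "\<bar>(\<Sum>j\<in>grid p. w j x h * f (design_point t j)) - f x\<bar> \<le> real CARD('d) ^ \<zeta> * L * C\<^sub>1 * A * h powr \<alpha>"
proof -
  obtain D where D: "\<And>x y. x \<in> unit_cube \<Longrightarrow> y \<in> unit_cube \<Longrightarrow>
      \<bar>f y - multi_taylor \<zeta> D x y\<bar> \<le> real CARD('d) ^ \<zeta> * L * infnorm (y - x) powr \<alpha>"
    "\<And>x. x \<in> unit_cube \<Longrightarrow> D (\<lambda>_. 0) x = f x"
    using holder_class_taylor[OF f \<alpha>(1,2)] unfolding \<alpha>(3) by blast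
  have moments: "(\<Sum>j\<in>grid p. w j x h * multi_power (design_point t j - x) \<beta>) = (if \<beta> = (\<lambda>_. 0) then 1 else 0)"
    if \<beta>: "multi_degree \<beta> \<le> \<zeta>" for \<beta>
  proof (cases "\<beta> = (\<lambda>_. 0)")
    case True
    then show ?thesis using weights x by (simp add: weight_conditions_def multi_power_def)
  next
    case False
    then have "1 \<le> multi_degree \<beta>" using multi_degree_eq_0_iff[of \<beta>] by linarith
    then show ?thesis using weights x \<beta> False by (simp add: weight_conditions_def mult.commute)
  qed
  \<comment> \<open>All terms of the Taylor polynomial but the constant one are annihilated by the
    weights, so the bias is the weighted sum of the remainders.\<close>
  have "(\<Sum>j\<in>grid p. w j x h * multi_taylor \<zeta> D x (design_point t j))
      = (\<Sum>\<beta>\<in>{\<beta>. multi_degree \<beta> \<le> \<zeta>}. D \<beta> x / multi_fact \<beta> * (\<Sum>j\<in>grid p. w j x h * multi_power (design_point t j - x) \<beta>))"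
    unfolding multi_taylor_def sum_distrib_left by (subst sum.swap) (simp add: mult_ac)
  also have "\<dots> = (\<Sum>\<beta>\<in>{\<beta>. multi_degree \<beta> \<le> \<zeta>}. if \<beta> = (\<lambda>_. 0) then D \<beta> x / multi_fact \<beta> else 0)"
    by (intro sum.cong) (auto simp: moments)
  also have "\<dots> = f x"
    by (subst sum.delta[OF finite_multi_degree_le]) (simp add: multi_degree_def multi_fact_def D(2) x)
  finally have "(\<Sum>j\<in>grid p. w j x h * f (design_point t j)) - f x
      = (\<Sum>j\<in>grid p. w j x h * (f (design_point t j) - multi_taylor \<zeta> D x (design_point t j)))"
    by (simp add: right_diff_distrib sum_subtractf)
  also have "\<bar>\<dots>\<bar> \<le> (\<Sum>j\<in>grid p. \<bar>w j x h\<bar> * (real CARD('d) ^ \<zeta> * L * h powr \<alpha>))"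
  proof (intro order_trans[OF sum_abs] sum_mono)
    fix j assume j: "j \<in> grid p"
    show "\<bar>w j x h * (f (design_point t j) - multi_taylor \<zeta> D x (design_point t j))\<bar>
        \<le> \<bar>w j x h\<bar> * (real CARD('d) ^ \<zeta> * L * h powr \<alpha>)"
    proof (cases "h < infnorm (design_point t j - x)")
      case False
      have "\<bar>f (design_point t j) - multi_taylor \<zeta> D x (design_point t j)\<bar>
          \<le> real CARD('d) ^ \<zeta> * L * infnorm (design_point t j - x) powr \<alpha>"
        using D(1)[OF x design_point_in_cube[OF j]] .
      also have "\<dots> \<le> real CARD('d) ^ \<zeta> * L * h powr \<alpha>"
        using False \<alpha> by (intro mult_left_mono powr_mono2) (auto simp: infnorm_pos_le)
      finally show ?thesis unfolding abs_mult by (intro mult_left_mono) auto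
    qed (simp add: weight_support[OF x j])
  qed
  also have "\<dots> = (\<Sum>j\<in>grid p. \<bar>w j x h\<bar>) * (real CARD('d) ^ \<zeta> * L * h powr \<alpha>)"
    by (rule sum_distrib_right[symmetric])
  also have "\<dots> \<le> C\<^sub>1 * A * (real CARD('d) ^ \<zeta> * L * h powr \<alpha>)"
    using \<alpha> by (intro mult_right_mono sum_abs_weights_le x) auto
  finally show ?thesis by (simp add: mult_ac)
qed

text \<open>This is why the mesh is \<open>P powr -(d + 1)\<close>: the Lipschitz constant of a
  weight is \<open>C\<^sub>2 / (P * h ^ (d + 1))\<close>, so rounding changes it by at most
  \<open>C\<^sub>2 / (P * (P * h) ^ (d + 1))\<close>, and \<open>P * h\<close> is at least
  \<open>c\<close>. The remaining factor \<open>1 / P\<close> turns the sum of the errors into an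
  average.\<close>

lemma weighted_sum_le:
  assumes x: "x \<in> unit_cube" and l: "p_prod p ^ Suc CARD('d) \<le> 2 ^ l"
  shows "\<bar>\<Sum>j\<in>grid p. w j x h * e j\<bar>
    \<le> Max ((\<lambda>v. \<bar>\<Sum>j\<in>grid p. w j v h * e j\<bar>) ` dyadic_round l ` unit_cube)
      + C\<^sub>2 / c ^ Suc CARD('d) / p_prod p * (\<Sum>j\<in>grid p. \<bar>e j\<bar>)"
proof -
  let ?v = "dyadic_round l x" and ?P = "p_prod p" and ?d = "CARD('d)"
  have v: "?v \<in> unit_cube" using x by (rule dyadic_round_in_cube)
  have P: "?P > 0" using p_prod_ge(1) by linarith
  have fin: "finite (dyadic_round l ` (unit_cube :: (real ^ 'd) set))" by (rule card_dyadic_round)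
  have "\<bar>\<Sum>j\<in>grid p. w j ?v h * e j\<bar>
      \<le> Max ((\<lambda>v. \<bar>\<Sum>j\<in>grid p. w j v h * e j\<bar>) ` dyadic_round l ` unit_cube)"
    using fin x by (intro Max_ge) auto
  moreover have "\<bar>(\<Sum>j\<in>grid p. w j x h * e j) - (\<Sum>j\<in>grid p. w j ?v h * e j)\<bar>
      \<le> C\<^sub>2 / c ^ Suc ?d / ?P * (\<Sum>j\<in>grid p. \<bar>e j\<bar>)"
  proof -
    have K: "\<bar>w j x h - w j ?v h\<bar> \<le> C\<^sub>2 / c ^ Suc ?d / ?P" if j: "j \<in> grid p" for j
    proof -
      have "\<bar>w j x h - w j ?v h\<bar> \<le> C\<^sub>2 / (?P * h ^ ?d) * min (infnorm (x - ?v) / h) 1"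
        using weights x v j by (simp add: weight_conditions_def)
      also have "\<dots> \<le> C\<^sub>2 / (?P * h ^ ?d) * (1 / ?P ^ Suc ?d / h)"
      proof (intro mult_left_mono)
        have "infnorm (x - ?v) \<le> (1 / 2) ^ l" by (rule dyadic_round_dist)
        also have "\<dots> \<le> 1 / ?P ^ Suc ?d" using l P by (simp add: power_one_over field_simps del: power_Suc)
        finally have "infnorm (x - ?v) / h \<le> 1 / ?P ^ Suc ?d / h" using h_pos by (intro divide_right_mono) auto
        then show "min (infnorm (x - ?v) / h) 1 \<le> 1 / ?P ^ Suc ?d / h" by linarith
      qed (use pos P h_pos in auto)
      also have "\<dots> = C\<^sub>2 / ?P / (?P * h) ^ Suc ?d"
        using P h_pos by (simp add: field_simps power_mult_distrib)
      also have "\<dots> \<le> C\<^sub>2 / ?P / c ^ Suc ?d"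
        using pos P p_prod_ge(2) h_pos by (intro divide_left_mono power_mono mult_pos_pos zero_less_power) auto
      finally show ?thesis by (simp add: field_simps)
    qed
    have "(\<Sum>j\<in>grid p. w j x h * e j) - (\<Sum>j\<in>grid p. w j ?v h * e j) = (\<Sum>j\<in>grid p. (w j x h - w j ?v h) * e j)"
      by (simp add: left_diff_distrib sum_subtractf)
    also have "\<bar>\<dots>\<bar> \<le> (\<Sum>j\<in>grid p. C\<^sub>2 / c ^ Suc ?d / ?P * \<bar>e j\<bar>)"
      unfolding abs_mult[symmetric] using K
      by (intro order_trans[OF sum_abs] sum_mono) (auto simp only: abs_mult intro!: mult_right_mono)
    finally show ?thesis by (simp add: sum_distrib_left)
  qed
  ultimately show ?thesis by linarith
qed

end

section \<open>The risk bound at a fixed bandwidth\<close>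

lemma dyadic_level_exists:
  fixes P :: real
  assumes "1 \<le> P"
  obtains l :: nat where "P ^ Suc d \<le> 2 ^ l"
    "ln (2 * real (2 ^ (Suc l * d))) \<le> 4 * (real d + 1)\<^sup>2 * (1 + ln P)"
proof
  \<comment> \<open>The smallest admissible level. The net then has polynomially many points in
    \<open>P\<close>, so that its logarithm is of order \<open>1 + ln P\<close>.\<close>
  define l where "l = nat \<lceil>real (Suc d) * log 2 P\<rceil>"
  have log: "0 \<le> log 2 P" using assms by simp
  then have l: "real (Suc d) * log 2 P \<le> real l" "real l \<le> real (Suc d) * log 2 P + 1"
    unfolding l_def using zero_le_mult_iff[of "real (Suc d)" "log 2 P"] by linarith+
  have "P ^ Suc d = 2 powr (real (Suc d) * log 2 P)"
    using assms by (simp add: powr_powr[symmetric] mult.commute[of _ "log 2 P"] powr_realpow del: of_nat_Suc power_Suc)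
  also have "\<dots> \<le> 2 powr real l" using l(1) by (intro powr_mono) auto
  also have "\<dots> = 2 ^ l" by (simp add: powr_realpow)
  finally show "P ^ Suc d \<le> 2 ^ l" .
  have lnP: "0 \<le> ln P" using assms by simp
  have "ln P / ln 2 \<le> ln P / (1 / 2)"
    using lnP ln2_ge_two_thirds by (intro divide_left_mono) auto
  then have "real (Suc d) * log 2 P \<le> real (Suc d) * (2 * ln P)"
    by (intro mult_left_mono) (auto simp: log_def)
  then have l': "real l \<le> real (Suc d) * (2 * ln P) + 1" using l(2) by linarith
  have "ln (2 * real (2 ^ (Suc l * d))) = (1 + real (Suc l) * real d) * ln 2"
    by (simp add: ln_mult ln_realpow algebra_simps)
  also have "\<dots> \<le> (1 + real (Suc l) * real d) * 1" using ln_2_less_1 by (intro mult_left_mono) auto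
  also have "\<dots> \<le> 1 + (real (Suc d) * (2 * ln P) + 2) * real d"
    using l' by (simp add: mult_right_mono)
  also have "\<dots> \<le> 4 * (real d + 1)\<^sup>2 * (1 + ln P)"
  proof -
    have "4 * (real d + 1)\<^sup>2 * (1 + ln P) - (1 + (real (Suc d) * (2 * ln P) + 2) * real d)
        = 4 * (real d)\<^sup>2 + 6 * real d + 3 + 2 * ((real d)\<^sup>2 * ln P) + 6 * (real d * ln P) + 4 * ln P"
      by (simp add: algebra_simps power2_eq_square)
    also have "\<dots> \<ge> 0" using lnP by (intro add_nonneg_nonneg mult_nonneg_nonneg) auto
    finally show ?thesis by linarith
  qed
  finally show "ln (2 * real (2 ^ (Suc l * d))) \<le> 4 * (real d + 1)\<^sup>2 * (1 + ln P)" .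
qed

text \<open>The summands belong to the bias, the averaged processes, the noise on the net and the
  discretization of the noise. None involves the sample size, the grid or the bandwidth.\<close>

definition risk_constant :: "nat \<Rightarrow> nat \<Rightarrow> real \<Rightarrow> real \<Rightarrow> real \<Rightarrow> real \<Rightarrow> real \<Rightarrow> real \<Rightarrow> real \<Rightarrow> real \<Rightarrow> real" where
  "risk_constant d \<zeta> C\<^sub>1 C\<^sub>2 A c L \<beta> C\<^sub>Z s =
     real d ^ \<zeta> * L * C\<^sub>1 * A + C\<^sub>1 * A * (chaining_constant d \<beta> * sqrt C\<^sub>Z)
     + 8 * (real d + 1) * C\<^sub>1 * sqrt (s * A) * sqrt (2 + 1 / c ^ d + 2 * real d)
     + C\<^sub>2 / c ^ Suc d * (4 * sqrt s)"

context local_weights begin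

text \<open>Here \<open>r\<close> stands for the square of the rate. A bandwidth above 1, where
  \<open>ln (1 / h)\<close> is negative, always falls into the first case, since then
  \<open>Q \<ge> P \<ge> sqrt P\<close>.\<close>

lemma log_grid_le:
  assumes n: "1 \<le> n" and r: "1 / real n \<le> r" "ln (1 / h) / (real n * p_prod p * h ^ CARD('d)) \<le> r"
  shows "(1 + ln (p_prod p)) / (real n * p_prod p * h ^ CARD('d)) \<le> (2 + 1 / c ^ CARD('d) + 2 * real CARD('d)) * r"
proof -
  define P d Q where "P = p_prod p" and "d = CARD('d)" and "Q = P * h ^ d"
  have P: "1 \<le> P" and Q: "c ^ d \<le> Q" using p_prod_ge by (auto simp: P_def d_def Q_def)
  have cd: "0 < c ^ d" using pos by simp
  have Q0: "0 < Q" using P h_pos by (simp add: Q_def)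
  have n0: "0 < real n" using n by simp
  have "0 < 1 / real n" using n0 by simp
  then have r0: "0 \<le> r" using r(1) by linarith
  have r2: "ln (1 / h) / (real n * Q) \<le> r" using r(2) by (simp add: P_def d_def Q_def mult.assoc)
  have "(1 + ln P) / (real n * Q) \<le> (2 + 1 / c ^ d + 2 * real d) * r"
  proof (cases "sqrt P \<le> Q")
    case True
    have "ln P = 2 * ln (sqrt P)" using P by (simp add: ln_sqrt)
    also have "\<dots> \<le> 2 * (sqrt P - 1)" using P by (intro mult_left_mono ln_le_minus_one) auto
    finally have "1 + ln P \<le> 2 * Q" using True by simp
    then have "(1 + ln P) / (real n * Q) \<le> 2 * Q / (real n * Q)"
      using Q0 n0 by (intro divide_right_mono) auto
    also have "\<dots> = 2 * (1 / real n)" using Q0 n0 by simp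
    also have "\<dots> \<le> 2 * r" using r by simp
    also have "\<dots> \<le> (2 + 1 / c ^ d + 2 * real d) * r"
      using r0 cd by (intro mult_right_mono) auto
    finally show ?thesis .
  next
    case False
    then have "ln Q \<le> ln (sqrt P)" using Q0 P by (subst ln_le_cancel_iff) auto
    then have "2 * (ln P + real d * ln h) \<le> ln P"
      using P h_pos by (simp add: Q_def ln_mult ln_realpow ln_sqrt)
    then have "1 + ln P \<le> 1 + 2 * real d * ln (1 / h)" using h_pos by (simp add: ln_div)
    then have "(1 + ln P) / (real n * Q) \<le> (1 + 2 * real d * ln (1 / h)) / (real n * Q)"
      using Q0 n0 by (intro divide_right_mono) auto
    \<comment> \<open>The summand 1 needs the lower bound \<open>c ^ d\<close> for \<open>Q\<close>;
      hence \<open>1 / c ^ d\<close> in the constant.\<close>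
    also have "\<dots> = 1 / Q * (1 / real n) + 2 * real d * (ln (1 / h) / (real n * Q))"
      by (simp add: add_divide_distrib)
    also have "\<dots> \<le> 1 / c ^ d * r + 2 * real d * r"
      using r r2 Q Q0 cd n0 by (intro add_mono mult_mono mult_left_mono divide_left_mono) auto
    also have "\<dots> \<le> (2 + 1 / c ^ d + 2 * real d) * r"
      using r0 by (simp add: algebra_simps)
    finally show ?thesis .
  qed
  then show ?thesis by (simp add: P_def d_def Q_def mult.assoc)
qed

text \<open>Both parts apply the sub-Gaussian inequality to the errors indexed by pairs
  \<open>(i, j)\<close>. The coefficients are \<open>w j v h / n\<close> for the net, and
  \<open>1 / n\<close> at a single \<open>j\<close> for one averaged error.\<close>

lemma noise_le:
  fixes M :: "'a measure"
  assumes "prob_space M" and ind: "prob_space.indep_vars M (\<lambda>_. borel) (\<lambda>(i, j). eps i j) ({1..n} \<times> grid p)"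
    and mgf: "\<And>i j v. i \<in> {1..n} \<Longrightarrow> j \<in> grid p \<Longrightarrow>
      (\<integral>\<^sup>+\<omega>. ennreal (exp (v * eps i j \<omega>)) \<partial>M) \<le> ennreal (exp (v\<^sup>2 * s / 2))"
    and n: "1 \<le> n" and s: "0 < s"
  shows "finite V \<Longrightarrow> V \<noteq> {} \<Longrightarrow> V \<subseteq> unit_cube \<Longrightarrow>
      (\<integral>\<^sup>+\<omega>. ennreal (Max ((\<lambda>v. \<bar>\<Sum>j\<in>grid p. w j v h * ((\<Sum>i\<in>{1..n}. eps i j \<omega>) / real n)\<bar>) ` V)) \<partial>M)
        \<le> ennreal (4 * sqrt (s * (C\<^sub>1\<^sup>2 * A / (real n * p_prod p * h ^ CARD('d))) * ln (2 * real (card V))))"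
    and "j \<in> grid p \<Longrightarrow>
      (\<integral>\<^sup>+\<omega>. ennreal \<bar>(\<Sum>i\<in>{1..n}. eps i j \<omega>) / real n\<bar> \<partial>M) \<le> ennreal (4 * sqrt s * (1 / sqrt (real n)))"
proof -
  interpret prob_space M by fact
  define I where "I = {1..n} \<times> grid p"
  define X where "X = (\<lambda>(i, j). eps i j)"
  have I: "finite I" unfolding I_def by (intro finite_cartesian_product finite_grid) auto
  have indX: "indep_vars (\<lambda>_. borel) X I" using ind by (simp add: X_def I_def)
  have mgfX: "(\<integral>\<^sup>+\<omega>. ennreal (exp (v * X i \<omega>)) \<partial>M) \<le> ennreal (exp (v\<^sup>2 * s / 2))" if "i \<in> I" for i v
    using mgf that by (cases i) (simp add: X_def I_def)
  have n0: "0 < real n" using n by simp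
  have Q0: "0 < p_prod p * h ^ CARD('d)" using p_prod_ge(1) h_pos by simp
  {
    assume V: "finite V" "V \<noteq> {}" "V \<subseteq> unit_cube"
    define a where "a v = (\<lambda>(i :: nat, j). w j v h / real n)" for v
    have "(\<integral>\<^sup>+\<omega>. ennreal (Max ((\<lambda>v. \<bar>\<Sum>i\<in>I. a v i * X i \<omega>\<bar>) ` V)) \<partial>M)
        \<le> ennreal (4 * sqrt (s * (C\<^sub>1\<^sup>2 * A / (real n * p_prod p * h ^ CARD('d))) * ln (2 * real (card V))))"
    proof (rule maximal_inequality_sub_gaussian[OF V(1,2) I indX mgfX])
      fix v assume "v \<in> V"
      then have v: "v \<in> unit_cube" using V by auto
      have "(\<Sum>i\<in>I. (a v i)\<^sup>2) = (\<Sum>i\<in>{1..n}. \<Sum>j\<in>grid p. (w j v h / real n)\<^sup>2)"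
        unfolding I_def a_def sum.cartesian_product by (intro sum.cong) auto
      also have "\<dots> = (\<Sum>j\<in>grid p. (w j v h)\<^sup>2) / real n"
        using n0 by (simp add: power_divide sum_divide_distrib[symmetric] power2_eq_square)
      also have "\<dots> \<le> C\<^sub>1\<^sup>2 * A / (p_prod p * h ^ CARD('d)) / real n"
        using n0 by (intro divide_right_mono sum_square_weights_le v) auto
      finally show "(\<Sum>i\<in>I. (a v i)\<^sup>2) \<le> C\<^sub>1\<^sup>2 * A / (real n * p_prod p * h ^ CARD('d))"
        by (simp add: mult_ac)
    qed (use pos Q0 n0 s in \<open>auto simp: mult.assoc\<close>)
    moreover have "(\<Sum>i\<in>I. a v i * X i \<omega>) = (\<Sum>j\<in>grid p. w j v h * ((\<Sum>i\<in>{1..n}. eps i j \<omega>) / real n))" for v \<omega>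
    proof -
      have "(\<Sum>i\<in>I. a v i * X i \<omega>) = (\<Sum>i\<in>{1..n}. \<Sum>j\<in>grid p. w j v h / real n * eps i j \<omega>)"
        unfolding I_def a_def X_def by (simp add: sum.cartesian_product split_def)
      also have "\<dots> = (\<Sum>j\<in>grid p. \<Sum>i\<in>{1..n}. w j v h / real n * eps i j \<omega>)" by (rule sum.swap)
      also have "\<dots> = (\<Sum>j\<in>grid p. w j v h * ((\<Sum>i\<in>{1..n}. eps i j \<omega>) / real n))"
        by (simp add: sum_distrib_left sum_divide_distrib)
      finally show ?thesis .
    qed
    ultimately show "(\<integral>\<^sup>+\<omega>. ennreal (Max ((\<lambda>v. \<bar>\<Sum>j\<in>grid p. w j v h * ((\<Sum>i\<in>{1..n}. eps i j \<omega>) / real n)\<bar>) ` V)) \<partial>M)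
        \<le> ennreal (4 * sqrt (s * (C\<^sub>1\<^sup>2 * A / (real n * p_prod p * h ^ CARD('d))) * ln (2 * real (card V))))"
      by simp
  next
    assume j: "j \<in> grid p"
    define a :: "unit \<Rightarrow> nat \<times> ('d \<Rightarrow> nat) \<Rightarrow> real"
      where "a u = (\<lambda>(i, j'). if j' = j then 1 / real n else 0)" for u
    have le: "(\<integral>\<^sup>+\<omega>. ennreal (Max ((\<lambda>v. \<bar>\<Sum>i\<in>I. a v i * X i \<omega>\<bar>) ` {()})) \<partial>M)
        \<le> ennreal (4 * sqrt (s * (1 / real n) * ln (2 * real (card {()}))))"
    proof (rule maximal_inequality_sub_gaussian[OF _ _ I indX mgfX])
      fix u :: unit
      have "(\<Sum>i\<in>I. (a u i)\<^sup>2) = (\<Sum>i\<in>{1..n}. \<Sum>j'\<in>grid p. if j' = j then (1 / real n)\<^sup>2 else 0)"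
        unfolding I_def a_def sum.cartesian_product by (intro sum.cong) auto
      also have "\<dots> = 1 / real n" using j n0 by (simp add: finite_grid power2_eq_square)
      finally show "(\<Sum>i\<in>I. (a u i)\<^sup>2) \<le> 1 / real n" by simp
    qed (use n0 s in auto)
    have eq: "(\<Sum>i\<in>I. a u i * X i \<omega>) = (\<Sum>i\<in>{1..n}. eps i j \<omega>) / real n" for u \<omega>
    proof -
      have "(\<Sum>i\<in>I. a u i * X i \<omega>) = (\<Sum>i\<in>{1..n}. \<Sum>j'\<in>grid p. if j' = j then eps i j \<omega> / real n else 0)"
        unfolding I_def a_def X_def sum.cartesian_product by (intro sum.cong) auto
      then show ?thesis using j by (simp add: finite_grid sum_divide_distrib)
    qed
    note le
    also have "ennreal (4 * sqrt (s * (1 / real n) * ln (2 * real (card {()})))) \<le> ennreal (4 * sqrt s * (1 / sqrt (real n)))"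
    proof (rule ennreal_leI)
      have "sqrt (s * (1 / real n) * ln 2) \<le> sqrt (s * (1 / real n) * 1)"
        using ln_2_less_1 s n0 by (intro real_sqrt_le_mono mult_left_mono) auto
      then show "4 * sqrt (s * (1 / real n) * ln (2 * real (card {()}))) \<le> 4 * sqrt s * (1 / sqrt (real n))"
        by (simp add: real_sqrt_divide)
    qed
    finally show "(\<integral>\<^sup>+\<omega>. ennreal \<bar>(\<Sum>i\<in>{1..n}. eps i j \<omega>) / real n\<bar> \<partial>M) \<le> ennreal (4 * sqrt s * (1 / sqrt (real n)))"
      by (simp add: eq)
  }
qed

text \<open>The constant is the same for all realizations, random fields and mean functions, so the
  suprema of the theorem can be taken afterwards.\<close>

lemma expected_error_le:
  assumes NZ: "(N, Z) \<in> process_class \<beta>\<^sub>0 C\<^sub>Z" and R: "(M, Zs, eps) \<in> fda_model n p err (N, Z)"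
    and f: "f \<in> holder_class \<alpha> L" "0 < \<alpha>" "0 \<le> L" "\<zeta> = strict_floor \<alpha>"
    and beta: "0 < \<beta>\<^sub>0" "0 < C\<^sub>Z" and n: "1 \<le> n" and s: "0 < s"
    and err: "\<And>i j v. i \<in> {1..n} \<Longrightarrow> j \<in> grid p \<Longrightarrow>
      (\<integral>\<^sup>+u. ennreal (exp (v * u)) \<partial>err i j) \<le> ennreal (exp (v\<^sup>2 * s / 2))"
  shows "expected_error n p t w h f (M, Zs, eps) \<le> ennreal (risk_constant CARD('d) \<zeta> C\<^sub>1 C\<^sub>2 A c L \<beta>\<^sub>0 C\<^sub>Z s * rate \<alpha> n p h)"
proof -
  define r where "r = rate \<alpha> n p h"
  have r: "h powr \<alpha> \<le> r" "sqrt (ln (1 / h) / (real n * p_prod p * h ^ CARD('d))) \<le> r" "1 / sqrt (real n) \<le> r"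
    by (auto simp: r_def rate_def)
  have n0: "0 < real n" using n by simp
  have P: "1 \<le> p_prod p" by (rule p_prod_ge)
  have Q0: "0 < real n * p_prod p * h ^ CARD('d)" using P h_pos n0 by simp
  have r0: "0 \<le> r" using r(3) n0 by (meson divide_nonneg_nonneg order_trans real_sqrt_ge_zero zero_le_one less_imp_le)
  obtain l where l: "p_prod p ^ Suc CARD('d) \<le> 2 ^ l"
    "ln (2 * real (2 ^ (Suc l * CARD('d)))) \<le> 4 * (real CARD('d) + 1)\<^sup>2 * (1 + ln (p_prod p))"
    using dyadic_level_exists[OF P] by blast
  interpret M: prob_space M using R by (simp add: fda_model_def)
  have ind: "M.indep_vars (\<lambda>_. borel) (\<lambda>(i, j). eps i j) ({1..n} \<times> grid p)"
    using R by (simp add: fda_model_def)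
  have eps [measurable]: "eps i j \<in> borel_measurable M" if "i \<in> {1..n}" "j \<in> grid p" for i j
  proof -
    have "(\<lambda>(i, j). eps i j) (i, j) \<in> borel_measurable M"
      using ind that unfolding M.indep_vars_def by blast
    then show ?thesis by simp
  qed
  have mgf: "(\<integral>\<^sup>+\<omega>. ennreal (exp (v * eps i j \<omega>)) \<partial>M) \<le> ennreal (exp (v\<^sup>2 * s / 2))"
    if ij: "i \<in> {1..n}" "j \<in> grid p" for i j v
  proof -
    have "(\<integral>\<^sup>+\<omega>. ennreal (exp (v * eps i j \<omega>)) \<partial>M) = (\<integral>\<^sup>+u. ennreal (exp (v * u)) \<partial>distr M borel (eps i j))"
      by (rule nn_integral_distr[OF eps[OF ij], symmetric]) simp
    also have "distr M borel (eps i j) = err i j" using R ij by (simp add: fda_model_def)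
    finally show ?thesis using err[OF ij, of v] by simp
  qed
  note noise = noise_le[OF M.prob_space_axioms ind mgf n s]
  define F where "F = design_point t ` grid p"
  have F: "finite F" "F \<noteq> {}" "F \<subseteq> unit_cube"
    using finite_grid grid_nonempty design_point_in_cube by (auto simp: F_def)
  note Zm = maximal_inequality_process_class(2)[OF NZ R beta n F]
  define D where "D = dyadic_round l ` (unit_cube :: (real ^ 'd) set)"
  have "(0 :: real ^ 'd) \<in> unit_cube" by (simp add: unit_cube_def)
  then have D: "finite D" "D \<noteq> {}" "D \<subseteq> unit_cube"
    using card_dyadic_round(1)[where ?'d = 'd, of l] by (auto simp: D_def intro: dyadic_round_in_cube)
  define b where "b = real CARD('d) ^ \<zeta> * L * C\<^sub>1 * A * h powr \<alpha>"
  define ZM where "ZM \<omega> = Max ((\<lambda>x. \<bar>\<Sum>i\<in>{1..n}. Zs i x \<omega>\<bar>) ` F)" for \<omega>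
  define e where "e j \<omega> = (\<Sum>i\<in>{1..n}. eps i j \<omega>) / real n" for j \<omega>
  define EM where "EM \<omega> = Max ((\<lambda>v. \<bar>\<Sum>j\<in>grid p. w j v h * e j \<omega>\<bar>) ` D)" for \<omega>
  define k where "k = C\<^sub>1 * A / real n"
  define K where "K = C\<^sub>2 / c ^ Suc CARD('d) / p_prod p"
  have nonneg: "0 \<le> b" "0 \<le> k" "0 \<le> K" using pos f n0 P by (auto simp: b_def k_def K_def)
  have ZM0: "\<bar>\<Sum>i\<in>{1..n}. Zs i x \<omega>\<bar> \<le> ZM \<omega>" if "x \<in> F" for x \<omega>
    unfolding ZM_def using F that by (intro Max_ge) auto
  have ZM_nonneg: "0 \<le> ZM \<omega>" for \<omega>
  proof -
    obtain x where "x \<in> F" using F by auto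
    from ZM0[OF this, of \<omega>] show ?thesis by linarith
  qed
  have EM_nonneg: "0 \<le> EM \<omega>" for \<omega>
  proof -
    obtain v where "v \<in> D" using D by auto
    then have "\<bar>\<Sum>j\<in>grid p. w j v h * e j \<omega>\<bar> \<le> EM \<omega>"
      unfolding EM_def using D by (intro Max_ge) auto
    then show ?thesis by linarith
  qed
  have pointwise: "\<bar>estimator n p t w h f Zs eps x \<omega> - f x\<bar> \<le> b + k * ZM \<omega> + EM \<omega> + K * (\<Sum>j\<in>grid p. \<bar>e j \<omega>\<bar>)"
    if x: "x \<in> unit_cube" for x \<omega>
  proof -
    let ?z = "\<lambda>j. (\<Sum>i\<in>{1..n}. Zs i (design_point t j) \<omega>) / real n"
    have "mean_observation n t f Zs eps j \<omega> = f (design_point t j) + ?z j + e j \<omega>" for j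
      using n0 by (simp add: mean_observation_def observation_def e_def sum.distrib field_simps)
    then have "estimator n p t w h f Zs eps x \<omega> - f x
        = ((\<Sum>j\<in>grid p. w j x h * f (design_point t j)) - f x) + (\<Sum>j\<in>grid p. w j x h * ?z j) + (\<Sum>j\<in>grid p. w j x h * e j \<omega>)"
      by (simp add: estimator_def distrib_left sum.distrib)
    moreover have "\<bar>(\<Sum>j\<in>grid p. w j x h * f (design_point t j)) - f x\<bar> \<le> b"
      unfolding b_def by (rule bias_le[OF f x])
    moreover have "\<bar>\<Sum>j\<in>grid p. w j x h * e j \<omega>\<bar> \<le> EM \<omega> + K * (\<Sum>j\<in>grid p. \<bar>e j \<omega>\<bar>)"
      unfolding EM_def D_def K_def by (rule weighted_sum_le[OF x l(1)])
    moreover have "\<bar>\<Sum>j\<in>grid p. w j x h * ?z j\<bar> \<le> k * ZM \<omega>"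
    proof -
      have "\<bar>\<Sum>j\<in>grid p. w j x h * ?z j\<bar> \<le> (\<Sum>j\<in>grid p. \<bar>w j x h\<bar> * (ZM \<omega> / real n))"
        using n0 ZM0 by (intro order_trans[OF sum_abs] sum_mono)
          (auto simp: abs_mult F_def intro!: mult_left_mono divide_right_mono)
      also have "\<dots> = (\<Sum>j\<in>grid p. \<bar>w j x h\<bar>) * (ZM \<omega> / real n)" by (rule sum_distrib_right[symmetric])
      also have "\<dots> \<le> C\<^sub>1 * A * (ZM \<omega> / real n)"
        using ZM_nonneg n0 by (intro mult_right_mono sum_abs_weights_le x) auto
      finally show ?thesis by (simp add: k_def)
    qed
    ultimately show ?thesis by linarith
  qed
  have [measurable]: "e j \<in> borel_measurable M" if "j \<in> grid p" for j
    unfolding e_def using eps that by measurable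
  have ZMm: "ZM \<in> borel_measurable M"
    unfolding ZM_def using F Zm by (intro borel_measurable_Max) (auto intro!: borel_measurable_abs borel_measurable_sum)
  have EMm: "EM \<in> borel_measurable M"
    unfolding EM_def using D by (intro borel_measurable_Max) auto
  \<comment> \<open>The supremum over \<open>x\<close> need not be measurable. Monotonicity of the
    nonnegative integral holds nevertheless, and the majorant, built from finite maxima and sums, is
    measurable and can be integrated term by term.\<close>
  have "expected_error n p t w h f (M, Zs, eps)
      \<le> (\<integral>\<^sup>+\<omega>. ennreal b + ennreal k * ennreal (ZM \<omega>) + ennreal (EM \<omega>) + ennreal K * (\<Sum>j\<in>grid p. ennreal \<bar>e j \<omega>\<bar>) \<partial>M)"
    unfolding expected_error_def split
  proof (rule nn_integral_mono)
    fix \<omega>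
    have "ennreal \<bar>estimator n p t w h f Zs eps x \<omega> - f x\<bar>
        \<le> ennreal b + ennreal k * ennreal (ZM \<omega>) + ennreal (EM \<omega>) + ennreal K * (\<Sum>j\<in>grid p. ennreal \<bar>e j \<omega>\<bar>)"
      if "x \<in> unit_cube" for x
    proof -
      have "ennreal (b + k * ZM \<omega> + EM \<omega> + K * (\<Sum>j\<in>grid p. \<bar>e j \<omega>\<bar>))
          = ennreal b + ennreal k * ennreal (ZM \<omega>) + ennreal (EM \<omega>) + ennreal K * (\<Sum>j\<in>grid p. ennreal \<bar>e j \<omega>\<bar>)"
        using nonneg ZM_nonneg EM_nonneg by (simp add: ennreal_mult' sum_nonneg)
      then show ?thesis by (rule ord_le_eq_trans[OF ennreal_leI[OF pointwise[OF that]]])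
    qed
    then show "sup_norm (\<lambda>x. estimator n p t w h f Zs eps x \<omega> - f x)
       \<le> ennreal b + ennreal k * ennreal (ZM \<omega>) + ennreal (EM \<omega>) + ennreal K * (\<Sum>j\<in>grid p. ennreal \<bar>e j \<omega>\<bar>)"
      unfolding sup_norm_def by (rule SUP_least)
  qed
  also have "\<dots> = ennreal b + ennreal k * (\<integral>\<^sup>+\<omega>. ennreal (ZM \<omega>) \<partial>M) + (\<integral>\<^sup>+\<omega>. ennreal (EM \<omega>) \<partial>M)
      + ennreal K * (\<Sum>j\<in>grid p. \<integral>\<^sup>+\<omega>. ennreal \<bar>e j \<omega>\<bar> \<partial>M)"
    using ZMm EMm by (simp add: nn_integral_add nn_integral_cmult nn_integral_sum M.emeasure_space_1 del: sum_ennreal)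
  also have "\<dots> \<le> ennreal b + ennreal k * ennreal (chaining_constant CARD('d) \<beta>\<^sub>0 * sqrt (C\<^sub>Z * real n))
      + ennreal (4 * sqrt (s * (C\<^sub>1\<^sup>2 * A / (real n * p_prod p * h ^ CARD('d))) * ln (2 * real (card D))))
      + ennreal K * (\<Sum>j\<in>grid p. ennreal (4 * sqrt s * (1 / sqrt (real n))))"
    unfolding ZM_def EM_def e_def
    by (intro add_mono mult_left_mono order_refl sum_mono maximal_inequality_process_class(1)[OF NZ R beta n F] noise D) auto
  also have "\<dots> \<le> ennreal (risk_constant CARD('d) \<zeta> C\<^sub>1 C\<^sub>2 A c L \<beta>\<^sub>0 C\<^sub>Z s * r)"
  proof -
    define c1 where "c1 = real CARD('d) ^ \<zeta> * L * C\<^sub>1 * A"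
    define c2 where "c2 = C\<^sub>1 * A * (chaining_constant CARD('d) \<beta>\<^sub>0 * sqrt C\<^sub>Z)"
    define c3 where "c3 = 8 * (real CARD('d) + 1) * C\<^sub>1 * sqrt (s * A) * sqrt (2 + 1 / c ^ CARD('d) + 2 * real CARD('d))"
    define c4 where "c4 = C\<^sub>2 / c ^ Suc CARD('d) * (4 * sqrt s)"
    have cs: "0 \<le> c1" "0 \<le> c2" "0 \<le> c3" "0 \<le> c4"
      using chaining_constant_nonneg[OF beta(1)] f pos s beta by (auto simp: c1_def c2_def c3_def c4_def)
    have 1: "ennreal b \<le> ennreal (c1 * r)"
      using r cs by (auto simp: b_def c1_def[symmetric] intro!: ennreal_leI mult_left_mono)
    have 2: "ennreal k * ennreal (chaining_constant CARD('d) \<beta>\<^sub>0 * sqrt (C\<^sub>Z * real n)) \<le> ennreal (c2 * r)"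
    proof -
      have "k * (chaining_constant CARD('d) \<beta>\<^sub>0 * sqrt (C\<^sub>Z * real n)) = c2 * (sqrt (real n) / real n)"
        by (simp add: k_def c2_def real_sqrt_mult)
      also have "sqrt (real n) / real n = 1 / sqrt (real n)" using n0 by (simp add: real_div_sqrt field_simps)
      finally have "k * (chaining_constant CARD('d) \<beta>\<^sub>0 * sqrt (C\<^sub>Z * real n)) \<le> c2 * r"
        using mult_left_mono[OF r(3) cs(2)] by simp
      then show ?thesis using nonneg by (simp add: ennreal_leI ennreal_mult'[symmetric])
    qed
    have 3: "ennreal (4 * sqrt (s * (C\<^sub>1\<^sup>2 * A / (real n * p_prod p * h ^ CARD('d))) * ln (2 * real (card D)))) \<le> ennreal (c3 * r)"
    proof (rule ennreal_leI)
      let ?Q = "real n * p_prod p * h ^ CARD('d)" and ?d = "real CARD('d)"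
      have "0 < card D" using D by (simp add: card_gt_0_iff)
      moreover have "real (card D) \<le> real (2 ^ (Suc l * CARD('d)))"
        unfolding D_def using card_dyadic_round(2)[where ?'d = 'd, of l] by (rule of_nat_mono)
      ultimately have "ln (2 * real (card D)) \<le> ln (2 * real (2 ^ (Suc l * CARD('d))))" by simp
      then have ln: "ln (2 * real (card D)) \<le> 4 * (?d + 1)\<^sup>2 * (1 + ln (p_prod p))" using l(2) by linarith
      \<comment> \<open>Squaring the bounds on the rate via \<open>sqrt_le_D\<close> is also correct
        for \<open>h > 1\<close>, where the argument of the root is negative.\<close>
      have rr: "(1 + ln (p_prod p)) / ?Q \<le> (2 + 1 / c ^ CARD('d) + 2 * ?d) * r\<^sup>2"
      proof (rule log_grid_le[OF n])
        show "1 / real n \<le> r\<^sup>2" using sqrt_le_D[of "1 / real n" r] r(3) by (simp add: real_sqrt_divide)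
        show "ln (1 / h) / ?Q \<le> r\<^sup>2" using sqrt_le_D r(2) by blast
      qed
      have "s * (C\<^sub>1\<^sup>2 * A / ?Q) * ln (2 * real (card D)) \<le> s * (C\<^sub>1\<^sup>2 * A / ?Q) * (4 * (?d + 1)\<^sup>2 * (1 + ln (p_prod p)))"
        using ln s pos Q0 by (intro mult_left_mono) auto
      also have "\<dots> = 4 * (?d + 1)\<^sup>2 * C\<^sub>1\<^sup>2 * (s * A) * ((1 + ln (p_prod p)) / ?Q)" by simp
      also have "\<dots> \<le> 4 * (?d + 1)\<^sup>2 * C\<^sub>1\<^sup>2 * (s * A) * ((2 + 1 / c ^ CARD('d) + 2 * ?d) * r\<^sup>2)"
        using rr s pos by (intro mult_left_mono) auto
      also have "\<dots> = (2 * (?d + 1) * C\<^sub>1 * sqrt (s * A) * sqrt (2 + 1 / c ^ CARD('d) + 2 * ?d) * r)\<^sup>2"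
        using s pos by (simp add: power_mult_distrib) (simp add: power2_eq_square algebra_simps)
      finally have "sqrt (s * (C\<^sub>1\<^sup>2 * A / ?Q) * ln (2 * real (card D)))
          \<le> 2 * (?d + 1) * C\<^sub>1 * sqrt (s * A) * sqrt (2 + 1 / c ^ CARD('d) + 2 * ?d) * r"
        using s pos r0 by (intro real_le_lsqrt) auto
      moreover have "c3 * r = 4 * (2 * (?d + 1) * C\<^sub>1 * sqrt (s * A) * sqrt (2 + 1 / c ^ CARD('d) + 2 * ?d) * r)"
        by (simp add: c3_def algebra_simps)
      ultimately show "4 * sqrt (s * (C\<^sub>1\<^sup>2 * A / ?Q) * ln (2 * real (card D))) \<le> c3 * r"
        by linarith
    qed
    \<comment> \<open>The \<open>P\<close> averaged errors, each of mean size at most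
      \<open>4 * sqrt s / sqrt n\<close>, cancel the factor \<open>1 / P\<close> in
      \<open>K\<close>.\<close>
    have 4: "ennreal K * (\<Sum>j\<in>grid p. ennreal (4 * sqrt s * (1 / sqrt (real n)))) \<le> ennreal (c4 * r)"
    proof -
      have "ennreal K * (\<Sum>j\<in>grid p. ennreal (4 * sqrt s * (1 / sqrt (real n))))
          = ennreal (K * (p_prod p * (4 * sqrt s * (1 / sqrt (real n)))))"
        using nonneg s by (subst sum_ennreal) (auto simp: card_grid ennreal_mult'[symmetric])
      also have "K * (p_prod p * (4 * sqrt s * (1 / sqrt (real n)))) = c4 * (1 / sqrt (real n))"
        using P by (simp add: K_def c4_def)
      also have "ennreal \<dots> \<le> ennreal (c4 * r)" by (intro ennreal_leI mult_left_mono r cs)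
      finally show ?thesis .
    qed
    have "ennreal (c1 * r) + ennreal (c2 * r) + ennreal (c3 * r) + ennreal (c4 * r) = ennreal (c1 * r + c2 * r + c3 * r + c4 * r)"
      using cs r0 by simp
    also have "c1 * r + c2 * r + c3 * r + c4 * r = risk_constant CARD('d) \<zeta> C\<^sub>1 C\<^sub>2 A c L \<beta>\<^sub>0 C\<^sub>Z s * r"
      unfolding risk_constant_def c1_def[symmetric] c2_def[symmetric] c3_def[symmetric] c4_def[symmetric]
      by (simp only: distrib_right)
    finally show ?thesis using add_mono[OF add_mono[OF add_mono[OF 1 2] 3] 4] by simp
  qed
  finally show ?thesis by (simp add: r_def)
qed

end

section \<open>Rates of convergence\<close>

lemma rate_pos: "1 \<le> n \<Longrightarrow> 0 < rate \<alpha> n p h"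
proof -
  assume "1 \<le> n"
  then have "0 < 1 / sqrt (real n)" by simp
  also have "1 / sqrt (real n) \<le> rate \<alpha> n p h" by (simp add: rate_def)
  finally show ?thesis .
qed

lemma errors_A1_mgf:
  assumes "errors_A1 p err"
  obtains s where "0 < s" "\<And>n i j v. i \<in> {1..n} \<Longrightarrow> j \<in> grid (p n) \<Longrightarrow>
    (\<integral>\<^sup>+u. ennreal (exp (v * u)) \<partial>err n i j) \<le> ennreal (exp (v\<^sup>2 * s / 2))"
proof -
  let ?V = "\<lambda>n i j. \<integral>u. u\<^sup>2 \<partial>err n i j"
  have "bdd_above {?V n i j | n i j. i \<in> {1..n} \<and> j \<in> grid (p n)}"
    using assms unfolding errors_A1_def by (elim conjE)
  then obtain S where S': "\<forall>v\<in>{?V n i j | n i j. i \<in> {1..n} \<and> j \<in> grid (p n)}. v \<le> S"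
    unfolding bdd_above_def by (elim exE)
  have S: "?V n i j \<le> S" if "i \<in> {1..n}" "j \<in> grid (p n)" for n i j
    by (rule S'[rule_format]) (use that in blast)
  have "\<exists>z>0. \<forall>n. \<forall>i\<in>{1..n}. \<forall>j\<in>grid (p n). sub_gaussian_norm (err n i j) \<le> ennreal (z\<^sup>2 * ?V n i j)"
    using assms unfolding errors_A1_def by (elim conjE)
  then obtain z where z: "0 < z" "\<And>n i j. i \<in> {1..n} \<Longrightarrow> j \<in> grid (p n) \<Longrightarrow>
      sub_gaussian_norm (err n i j) \<le> ennreal (z\<^sup>2 * ?V n i j)"
    by blast
  show ?thesis
  proof
    \<comment> \<open>The added 1 provides the strict gap for \<open>sub_gaussian_norm_mgf\<close>
      and makes the proxy positive. The absolute value is taken because an upper bound of a possibly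
      empty set may be negative.\<close>
    show "0 < z\<^sup>2 * \<bar>S\<bar> + 1" by (intro add_nonneg_pos mult_nonneg_nonneg) auto
    fix n i j v assume ij: "i \<in> {1..n}" "j \<in> grid (p n)"
    have "z\<^sup>2 * ?V n i j \<le> z\<^sup>2 * \<bar>S\<bar>" using S[OF ij] by (intro mult_left_mono) auto
    then show "(\<integral>\<^sup>+u. ennreal (exp (v * u)) \<partial>err n i j) \<le> ennreal (exp (v\<^sup>2 * (z\<^sup>2 * \<bar>S\<bar> + 1) / 2))"
      by (intro sub_gaussian_norm_mgf[OF z(2)[OF ij]]) (auto intro!: mult_nonneg_nonneg integral_nonneg_AE)
  qed
qed

text \<open>
  The count of design points is bounded with \<open>2 * h\<close> in place of \<open>h\<close>, because \<open>h\<close> may be the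
  endpoint that the assumption excludes.
\<close>

lemma local_weightsI:
  fixes p :: "'d::finite \<Rightarrow> nat"
  assumes "weight_conditions \<zeta> p t w C\<^sub>1 C\<^sub>2 h" "design p t" "1 \<le> p_min p" "0 < C\<^sub>1" "0 < C\<^sub>2" "0 < C\<^sub>3" "0 < c"
    and h: "c / real (p_min p) \<le> h"
    and A3: "\<And>x h. x \<in> unit_cube \<Longrightarrow> c / real (p_min p) < h \<Longrightarrow>
      real (card {j \<in> grid p. \<forall>k. x $ k - h \<le> design_point t j $ k \<and> design_point t j $ k \<le> x $ k + h})
        \<le> C\<^sub>3 * h ^ CARD('d) * p_prod p"
  shows "local_weights \<zeta> p t w C\<^sub>1 C\<^sub>2 (C\<^sub>3 * 2 ^ CARD('d)) c h"
proof
  fix x :: "real ^ 'd" assume x: "x \<in> unit_cube"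
  have h0: "0 < c / real (p_min p)" using assms by simp
  have "{j \<in> grid p. infnorm (design_point t j - x) \<le> h}
      \<subseteq> {j \<in> grid p. \<forall>k. x $ k - 2 * h \<le> design_point t j $ k \<and> design_point t j $ k \<le> x $ k + 2 * h}"
  proof (safe, goal_cases)
    case (1 j k)
    then have "\<bar>(design_point t j - x) $ k\<bar> \<le> h" unfolding infnorm_le_iff by blast
    then show ?case using h h0 by simp
  next
    case (2 j k)
    then have "\<bar>(design_point t j - x) $ k\<bar> \<le> h" unfolding infnorm_le_iff by blast
    then show ?case using h h0 by simp
  qed
  then have "real (card {j \<in> grid p. infnorm (design_point t j - x) \<le> h})
      \<le> real (card {j \<in> grid p. \<forall>k. x $ k - 2 * h \<le> design_point t j $ k \<and> design_point t j $ k \<le> x $ k + 2 * h})"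
    by (intro of_nat_mono card_mono) (auto intro: finite_subset[OF _ finite_grid])
  also have "\<dots> \<le> C\<^sub>3 * (2 * h) ^ CARD('d) * p_prod p"
    using h h0 by (intro A3 x) simp
  finally show "real (card {j \<in> grid p. infnorm (design_point t j - x) \<le> h})
      \<le> C\<^sub>3 * 2 ^ CARD('d) * (h ^ CARD('d) * p_prod p)"
    by (simp add: power_mult_distrib mult_ac)
qed (use assms in auto)

text \<open>Keeps the second candidate in \<open>h_star\<close> below \<open>h\<^sub>0\<close>. It
  will be applied to \<open>x = n * P\<close>, which is at least \<open>n\<close>, so largeness of
  \<open>n\<close> suffices whatever the grid is.\<close>

lemma eventually_bandwidth_le:
  fixes h\<^sub>0 D :: real
  assumes "0 < h\<^sub>0" "0 < D"
  obtains X where "\<And>x. X \<le> x \<Longrightarrow> (ln x / x) powr (1 / D) \<le> h\<^sub>0"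
proof -
  have "((\<lambda>x::real. ln x / x) \<longlongrightarrow> 0) at_top" by (rule ln_x_over_x_tendsto_0)
  moreover have "0 < h\<^sub>0 powr D" using assms by simp
  ultimately have "eventually (\<lambda>x. ln x / x < h\<^sub>0 powr D) at_top" by (rule order_tendstoD)
  then obtain X where X: "\<And>x. X \<le> x \<Longrightarrow> ln x / x < h\<^sub>0 powr D" by (auto simp: eventually_at_top_linorder)
  have "(ln x / x) powr (1 / D) \<le> h\<^sub>0" if x: "max X 1 \<le> x" for x
  proof -
    have "(ln x / x) powr (1 / D) \<le> (h\<^sub>0 powr D) powr (1 / D)"
      using X[of x] x assms by (intro powr_mono2) auto
    also have "\<dots> = h\<^sub>0" using assms by (simp add: powr_powr)
    finally show ?thesis .
  qed
  then show ?thesis using that by blast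
qed

text \<open>The power \<open>h powr \<alpha>\<close> is checked for either candidate of the maximum.
  In the logarithmic term \<open>h\<close> is at least \<open>y powr (1 / D)\<close> and
  \<open>ln (1 / h)\<close> at most \<open>ln x\<close>, so the quotient is at most
  \<open>y powr (1 - d / D)\<close>, the square of \<open>y powr (\<alpha> / D)\<close>.\<close>

lemma rate_h_star_le:
  fixes p :: "'d::finite \<Rightarrow> nat"
  assumes \<alpha>: "0 < \<alpha>" and c: "0 < c" and n: "3 \<le> n" and p: "1 \<le> p_min p"
  shows "rate \<alpha> n p (h_star \<alpha> c n p) \<le> (c powr \<alpha> + 1) * rate_star \<alpha> n p"
proof -
  define x where "x = real n * p_prod p"
  define d where "d = real CARD('d)"
  define D where "D = 2 * \<alpha> + d"
  define y where "y = ln x / x"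
  define h where "h = h_star \<alpha> c n p"
  define r where "r = rate_star \<alpha> n p"
  have "1 \<le> real (p_min p) ^ CARD('d)" using p by simp
  then have P: "1 \<le> p_prod p" using p_min_power_le_p_prod[of p] by linarith
  have "3 * 1 \<le> real n * p_prod p" using n P by (intro mult_mono) auto
  then have x: "3 \<le> x" by (simp add: x_def)
  \<comment> \<open>This is what \<open>n \<ge> 3\<close> is for: \<open>ln (ln x)\<close> is
    nonnegative, hence \<open>- ln y = ln x - ln (ln x)\<close> is at most
    \<open>ln x\<close>.\<close>
  have "exp 1 \<le> x" using e_less_272 x by linarith
  then have lnx: "1 \<le> ln x" using x by (subst ln_ge_iff) auto
  have d: "1 \<le> d" by (simp add: d_def Suc_le_eq)
  have D: "1 \<le> D" using d \<alpha> by (simp add: D_def)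
  have y: "0 < y" using x lnx by (simp add: y_def)
  have r: "real (p_min p) powr (- \<alpha>) \<le> r" "y powr (\<alpha> / D) \<le> r" "1 / sqrt (real n) \<le> r"
    by (auto simp: r_def rate_star_def y_def x_def D_def d_def)
  have r0: "0 \<le> r" using r(2) powr_ge_zero[of y "\<alpha> / D"] by linarith
  have hmax: "h = max (c / real (p_min p)) (y powr (1 / D))"
    by (simp add: h_def h_star_def y_def x_def D_def d_def)
  have hy: "y powr (1 / D) \<le> h" by (simp add: hmax)
  have y0: "0 < y powr (1 / D)" using y by simp
  have h0: "0 < h" using hy y0 by linarith
  have K: "r \<le> (c powr \<alpha> + 1) * r" using r0 by (simp add: distrib_right)
  have 1: "h powr \<alpha> \<le> (c powr \<alpha> + 1) * r"
  proof (cases "h = c / real (p_min p)")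
    case True
    have "h powr \<alpha> = c powr \<alpha> * real (p_min p) powr (- \<alpha>)"
      using c p by (simp add: True powr_divide powr_minus_divide)
    also have "\<dots> \<le> c powr \<alpha> * r" using r(1) by (intro mult_left_mono) auto
    also have "\<dots> \<le> (c powr \<alpha> + 1) * r" using r0 by (intro mult_right_mono) auto
    finally show ?thesis .
  next
    case False
    then have "h = y powr (1 / D)" by (auto simp: hmax max_def split: if_splits)
    then have "h powr \<alpha> = y powr (\<alpha> / D)" by (simp add: powr_powr)
    then show ?thesis using r(2) K by linarith
  qed
  have 2: "sqrt (ln (1 / h) / (real n * p_prod p * h ^ CARD('d))) \<le> r"
  proof -
    have hd: "y powr (d / D) \<le> h ^ CARD('d)"
    proof -
      have "y powr (d / D) = (y powr (1 / D)) powr d" by (simp add: powr_powr)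
      also have "\<dots> \<le> h powr d" using hy d by (intro powr_mono2) auto
      also have "\<dots> = h ^ CARD('d)" using h0 by (simp add: d_def powr_realpow)
      finally show ?thesis .
    qed
    have "ln (y powr (1 / D)) \<le> ln h" using hy y0 h0 by (subst ln_le_cancel_iff) auto
    then have "ln (1 / h) \<le> - (ln y / D)" using y h0 by (simp add: ln_div ln_powr)
    also have "\<dots> = (ln x - ln (ln x)) / D" using x lnx by (simp add: y_def ln_div diff_divide_distrib)
    also have "\<dots> \<le> ln x / 1" using D lnx by (intro frac_le) auto
    finally have "ln (1 / h) / (x * h ^ CARD('d)) \<le> ln x / (x * h ^ CARD('d))"
      using x h0 by (intro divide_right_mono) auto
    also have "\<dots> \<le> ln x / (x * y powr (d / D))"
      using x h0 hd lnx y by (intro divide_left_mono mult_left_mono mult_pos_pos) auto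
    also have "\<dots> = y powr 1 / y powr (d / D)" using y x lnx by (simp add: y_def)
    also have "\<dots> = y powr (1 - d / D)" by (rule powr_diff[symmetric])
    also have "1 - d / D = (D - d) / D" using D by (simp add: diff_divide_distrib)
    also have "\<dots> = \<alpha> / D + \<alpha> / D" by (simp add: D_def flip: add_divide_distrib)
    also have "y powr (\<alpha> / D + \<alpha> / D) = (y powr (\<alpha> / D))\<^sup>2" by (simp only: powr_add power2_eq_square)
    finally have "sqrt (ln (1 / h) / (x * h ^ CARD('d))) \<le> y powr (\<alpha> / D)"
      by (intro real_le_lsqrt) auto
    then show ?thesis using r(2) by (simp add: x_def)
  qed
  have "rate \<alpha> n p h \<le> (c powr \<alpha> + 1) * r"
    unfolding rate_def using 1 2 r(3) K by simp
  then show ?thesis by (simp add: h_def r_def)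
qed

theorem theorem1:
  fixes \<alpha> L C\<^sub>Z \<beta>\<^sub>0 c h\<^sub>0 :: real
    and p :: "nat \<Rightarrow> 'd::finite \<Rightarrow> nat"
    and t :: "nat \<Rightarrow> 'd \<Rightarrow> nat \<Rightarrow> real"
    and err :: "nat \<Rightarrow> nat \<Rightarrow> ('d \<Rightarrow> nat) \<Rightarrow> real measure"
    and w :: "nat \<Rightarrow> ('d \<Rightarrow> nat) \<Rightarrow> real ^ 'd \<Rightarrow> real \<Rightarrow> real"
  assumes "\<alpha> > 0" "L > 0" "C\<^sub>Z > 0" "0 < \<beta>\<^sub>0" "\<beta>\<^sub>0 \<le> 1"
    and "\<And>n. design (p n) (t n)"
    and "errors_A1 p err"
    and "c > 0" "h\<^sub>0 > 0"
    and "weights_A2 (strict_floor \<alpha>) p t w (\<lambda>n. {c / real (p_min (p n))<..h\<^sub>0})"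
    and "design_A3 c p t"
  shows
    "(\<exists>C P\<^sub>0 N\<^sub>0. \<forall>n. N\<^sub>0 \<le> n \<and> P\<^sub>0 \<le> p_min (p n) \<longrightarrow>
       (SUP h\<in>{c / real (p_min (p n))<..h\<^sub>0}.
        SUP Z\<in>(process_class \<beta>\<^sub>0 C\<^sub>Z :: ('b measure \<times> (real ^ 'd \<Rightarrow> 'b \<Rightarrow> real)) set).
        SUP \<mu>\<in>holder_class \<alpha> L.
        SUP R\<in>(fda_model n (p n) (err n) Z :: ('a measure \<times> _) set).
          ennreal (inverse (rate \<alpha> n (p n) h)) * expected_error n (p n) (t n) (w n) h \<mu> R)
       \<le> ennreal C)
     \<and>
     \<comment> \<open>The bandwidth \<open>h_star\<close> may attain the left endpoint of the interval above, which that
         interval excludes; if it does, the conditions on the weights are needed there, too.\<close>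
     (weights_A2 (strict_floor \<alpha>) p t w
        (\<lambda>n. {h. h = h_star \<alpha> c n (p n) \<and> h = c / real (p_min (p n))}) \<longrightarrow>
      (\<exists>C P\<^sub>0 N\<^sub>0. \<forall>n. N\<^sub>0 \<le> n \<and> P\<^sub>0 \<le> p_min (p n) \<longrightarrow>
       (SUP Z\<in>(process_class \<beta>\<^sub>0 C\<^sub>Z :: ('b measure \<times> (real ^ 'd \<Rightarrow> 'b \<Rightarrow> real)) set).
        SUP \<mu>\<in>holder_class \<alpha> L.
        SUP R\<in>(fda_model n (p n) (err n) Z :: ('a measure \<times> _) set).
          expected_error n (p n) (t n) (w n) (h_star \<alpha> c n (p n)) \<mu> R)
       \<le> ennreal (C * rate_star \<alpha> n (p n))))"
proof -
  define \<zeta> where "\<zeta> = strict_floor \<alpha>"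
  obtain s where s: "0 < s" "\<And>n i j v. i \<in> {1..n} \<Longrightarrow> j \<in> grid (p n) \<Longrightarrow>
    (\<integral>\<^sup>+u. ennreal (exp (v * u)) \<partial>err n i j) \<le> ennreal (exp (v\<^sup>2 * s / 2))"
    by (rule errors_A1_mgf[OF assms(7)]) blast
  obtain C\<^sub>3 where C3: "0 < C\<^sub>3" "\<And>n x h. x \<in> unit_cube \<Longrightarrow> c / real (p_min (p n)) < h \<Longrightarrow>
      real (card {j \<in> grid (p n). \<forall>k. x $ k - h \<le> design_point (t n) j $ k \<and> design_point (t n) j $ k \<le> x $ k + h})
        \<le> C\<^sub>3 * h ^ CARD('d) * p_prod (p n)"
    using assms(11) unfolding design_A3_def by blast
  define K where "K C\<^sub>1 C\<^sub>2 = risk_constant CARD('d) \<zeta> C\<^sub>1 C\<^sub>2 (C\<^sub>3 * 2 ^ CARD('d)) c L \<beta>\<^sub>0 C\<^sub>Z s" for C\<^sub>1 C\<^sub>2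
  \<comment> \<open>Stated for every \<open>h\<close> from the endpoint \<open>c / p_min\<close> on,
    with the constants of the weights as parameters, so that it serves both claims.\<close>
  have bound: "expected_error n (p n) (t n) (w n) h \<mu> R \<le> ennreal (K C\<^sub>1 C\<^sub>2 * rate \<alpha> n (p n) h)"
    if W: "weight_conditions \<zeta> (p n) (t n) (w n) C\<^sub>1 C\<^sub>2 h" "0 < C\<^sub>1" "0 < C\<^sub>2"
      and n: "1 \<le> n" "1 \<le> p_min (p n)" and h: "c / real (p_min (p n)) \<le> h"
      and Z: "Z \<in> (process_class \<beta>\<^sub>0 C\<^sub>Z :: ('b measure \<times> (real ^ 'd \<Rightarrow> 'b \<Rightarrow> real)) set)"
      and \<mu>: "\<mu> \<in> holder_class \<alpha> L"
      and R: "R \<in> (fda_model n (p n) (err n) Z :: ('a measure \<times> _) set)" for C\<^sub>1 C\<^sub>2 n h Z \<mu> R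
  proof -
    interpret local_weights \<zeta> "p n" "t n" "w n" C\<^sub>1 C\<^sub>2 "C\<^sub>3 * 2 ^ CARD('d)" c h
      using W n h assms(6,8) C3 by (intro local_weightsI) auto
    obtain N Z' where Z': "Z = (N, Z')" by (cases Z)
    obtain M Zs eps where R': "R = (M, Zs, eps)" by (cases R)
    show ?thesis
      unfolding R' K_def using Z \<mu> R assms(1-5) n s
      by (intro expected_error_le[where N = N and Z = Z' and err = "err n"]) (auto simp: Z' R' \<zeta>_def)
  qed
  obtain C\<^sub>1 C\<^sub>2 P\<^sub>0 where C12: "0 < C\<^sub>1" "0 < C\<^sub>2" "\<And>n h. P\<^sub>0 \<le> p_min (p n) \<Longrightarrow> h \<in> {c / real (p_min (p n))<..h\<^sub>0} \<Longrightarrow>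
      weight_conditions \<zeta> (p n) (t n) (w n) C\<^sub>1 C\<^sub>2 h"
    using assms(10) unfolding weights_A2_def \<zeta>_def by blast
  show ?thesis
  proof (intro conjI impI)
    show "\<exists>C P\<^sub>0 N\<^sub>0. \<forall>n. N\<^sub>0 \<le> n \<and> P\<^sub>0 \<le> p_min (p n) \<longrightarrow>
       (SUP h\<in>{c / real (p_min (p n))<..h\<^sub>0}.
        SUP Z\<in>(process_class \<beta>\<^sub>0 C\<^sub>Z :: ('b measure \<times> (real ^ 'd \<Rightarrow> 'b \<Rightarrow> real)) set).
        SUP \<mu>\<in>holder_class \<alpha> L.
        SUP R\<in>(fda_model n (p n) (err n) Z :: ('a measure \<times> _) set).
          ennreal (inverse (rate \<alpha> n (p n) h)) * expected_error n (p n) (t n) (w n) h \<mu> R)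
       \<le> ennreal C"
    proof (rule exI[of _ "K C\<^sub>1 C\<^sub>2"], rule exI[of _ "max 1 P\<^sub>0"], rule exI[of _ 1], intro allI impI SUP_least)
      fix n h and \<mu> :: "real ^ 'd \<Rightarrow> real" and Z :: "'b measure \<times> (real ^ 'd \<Rightarrow> 'b \<Rightarrow> real)"
        and R :: "'a measure \<times> (nat \<Rightarrow> real ^ 'd \<Rightarrow> 'a \<Rightarrow> real) \<times> (nat \<Rightarrow> ('d \<Rightarrow> nat) \<Rightarrow> 'a \<Rightarrow> real)"
      assume n: "1 \<le> n \<and> max 1 P\<^sub>0 \<le> p_min (p n)" and h: "h \<in> {c / real (p_min (p n))<..h\<^sub>0}"
        and R: "Z \<in> process_class \<beta>\<^sub>0 C\<^sub>Z" "\<mu> \<in> holder_class \<alpha> L" "R \<in> fda_model n (p n) (err n) Z"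
      let ?r = "rate \<alpha> n (p n) h"
      have r: "0 < ?r" using n by (intro rate_pos) simp
      have "expected_error n (p n) (t n) (w n) h \<mu> R \<le> ennreal (K C\<^sub>1 C\<^sub>2 * ?r)"
        using n h by (intro bound[where Z = Z] C12 R) auto
      then have "ennreal (inverse ?r) * expected_error n (p n) (t n) (w n) h \<mu> R
          \<le> ennreal (inverse ?r) * ennreal (K C\<^sub>1 C\<^sub>2 * ?r)" by (rule mult_left_mono) simp
      also have "\<dots> = ennreal (K C\<^sub>1 C\<^sub>2)" using r by (simp add: field_simps flip: ennreal_mult')
      finally show "ennreal (inverse ?r) * expected_error n (p n) (t n) (w n) h \<mu> R \<le> ennreal (K C\<^sub>1 C\<^sub>2)" .
    qed
  next
    assume "weights_A2 (strict_floor \<alpha>) p t w (\<lambda>n. {h. h = h_star \<alpha> c n (p n) \<and> h = c / real (p_min (p n))})"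
    then obtain C\<^sub>1' C\<^sub>2' P\<^sub>0' where C12': "0 < C\<^sub>1'" "0 < C\<^sub>2'" "\<And>n h. P\<^sub>0' \<le> p_min (p n) \<Longrightarrow>
        h \<in> {h. h = h_star \<alpha> c n (p n) \<and> h = c / real (p_min (p n))} \<Longrightarrow> weight_conditions \<zeta> (p n) (t n) (w n) C\<^sub>1' C\<^sub>2' h"
      unfolding weights_A2_def \<zeta>_def by blast
    define D where "D = 2 * \<alpha> + real CARD('d)"
    have "0 < D" using assms(1) by (simp add: D_def add_pos_nonneg)
    then obtain X where X: "\<And>x. X \<le> x \<Longrightarrow> (ln x / x) powr (1 / D) \<le> h\<^sub>0"
      using eventually_bandwidth_le[OF assms(9)] by blast
    \<comment> \<open>The weights at the endpoint come with constants of their own; \<open>B\<close>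
      dominates the risk constants of both situations and is nonnegative.\<close>
    define B where "B = \<bar>K C\<^sub>1 C\<^sub>2\<bar> + \<bar>K C\<^sub>1' C\<^sub>2'\<bar>"
    show "\<exists>C P\<^sub>0 N\<^sub>0. \<forall>n. N\<^sub>0 \<le> n \<and> P\<^sub>0 \<le> p_min (p n) \<longrightarrow>
       (SUP Z\<in>(process_class \<beta>\<^sub>0 C\<^sub>Z :: ('b measure \<times> (real ^ 'd \<Rightarrow> 'b \<Rightarrow> real)) set).
        SUP \<mu>\<in>holder_class \<alpha> L.
        SUP R\<in>(fda_model n (p n) (err n) Z :: ('a measure \<times> _) set).
          expected_error n (p n) (t n) (w n) (h_star \<alpha> c n (p n)) \<mu> R)
       \<le> ennreal (C * rate_star \<alpha> n (p n))"
    \<comment> \<open>The 3 is required by \<open>rate_h_star_le\<close>, and \<open>X\<close>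
      ensures that the second candidate in \<open>h_star\<close> is at most
      \<open>h\<^sub>0\<close>.\<close>
    proof (rule exI[of _ "B * (c powr \<alpha> + 1)"], rule exI[of _ "max 1 (max P\<^sub>0 P\<^sub>0')"],
        rule exI[of _ "max 3 (nat \<lceil>X\<rceil>)"], intro allI impI SUP_least)
      fix n and \<mu> :: "real ^ 'd \<Rightarrow> real" and Z :: "'b measure \<times> (real ^ 'd \<Rightarrow> 'b \<Rightarrow> real)"
        and R :: "'a measure \<times> (nat \<Rightarrow> real ^ 'd \<Rightarrow> 'a \<Rightarrow> real) \<times> (nat \<Rightarrow> ('d \<Rightarrow> nat) \<Rightarrow> 'a \<Rightarrow> real)"
      assume n: "max 3 (nat \<lceil>X\<rceil>) \<le> n \<and> max 1 (max P\<^sub>0 P\<^sub>0') \<le> p_min (p n)"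
        and R: "Z \<in> process_class \<beta>\<^sub>0 C\<^sub>Z" "\<mu> \<in> holder_class \<alpha> L" "R \<in> fda_model n (p n) (err n) Z"
      define h where "h = h_star \<alpha> c n (p n)"
      have r: "0 < rate \<alpha> n (p n) h" using n by (intro rate_pos) simp
      have "1 \<le> real (p_min (p n)) ^ CARD('d)" using n by simp
      then have P: "1 \<le> p_prod (p n)" using p_min_power_le_p_prod[of "p n"] by linarith
      have "X \<le> real n" using n by linarith
      also have "real n * 1 \<le> real n * p_prod (p n)" using P by (intro mult_left_mono) auto
      finally have "(ln (real n * p_prod (p n)) / (real n * p_prod (p n))) powr (1 / D) \<le> h\<^sub>0" using X by simp
      \<comment> \<open>Either \<open>h_star\<close> is the endpoint, covered by the extra
        assumption on the weights, or it is the second candidate and lies in the half-open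
        interval.\<close>
      then have "h = c / real (p_min (p n)) \<or> c / real (p_min (p n)) < h \<and> h \<le> h\<^sub>0"
        unfolding h_def h_star_def D_def by (auto simp: max_def)
      then have "expected_error n (p n) (t n) (w n) h \<mu> R \<le> ennreal (B * rate \<alpha> n (p n) h)"
      proof
        assume h: "h = c / real (p_min (p n))"
        have "expected_error n (p n) (t n) (w n) h \<mu> R \<le> ennreal (K C\<^sub>1' C\<^sub>2' * rate \<alpha> n (p n) h)"
          using n h h_def by (intro bound[where Z = Z] C12' R) auto
        also have "\<dots> \<le> ennreal (B * rate \<alpha> n (p n) h)"
          using r by (intro ennreal_leI mult_right_mono) (auto simp: B_def)
        finally show ?thesis .
      next
        assume h: "c / real (p_min (p n)) < h \<and> h \<le> h\<^sub>0"
        have "expected_error n (p n) (t n) (w n) h \<mu> R \<le> ennreal (K C\<^sub>1 C\<^sub>2 * rate \<alpha> n (p n) h)"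
          using n h by (intro bound[where Z = Z] C12 R) auto
        also have "\<dots> \<le> ennreal (B * rate \<alpha> n (p n) h)"
          using r by (intro ennreal_leI mult_right_mono) (auto simp: B_def)
        finally show ?thesis .
      qed
      also have "\<dots> \<le> ennreal (B * ((c powr \<alpha> + 1) * rate_star \<alpha> n (p n)))"
        unfolding h_def using n assms(1,8)
        by (intro ennreal_leI mult_left_mono rate_h_star_le) (auto simp: B_def)
      finally show "expected_error n (p n) (t n) (w n) (h_star \<alpha> c n (p n)) \<mu> R
          \<le> ennreal (B * (c powr \<alpha> + 1) * rate_star \<alpha> n (p n))"
        by (simp add: h_def mult.assoc)
    qed
  qed
qed

end
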